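(* Let $\alpha$ be an irrational number with $0<\alpha<1$ and let $0\leqslant\rho<1$. The monadic second-order theory $\mathrm{MT}\langle\mathbb{N},<,s_{\alpha,\rho}\rangle$ of the Sturmian sequence $s_{\alpha,\rho}$ is decidable if and only if both $\alpha$ and $\rho$ are computable real numbers.
   Context: The lower mechanical sequence with slope $\alpha$ and shift $\rho$ is $s_{\alpha,\rho}(n)=\lfloor\alpha(n+1)+\rho\rfloor-\lfloor\alpha n+\rho\rfloor$, $n\in\mathbb{N}$, a sequence over $\{0,1\}$; for irrational $\alpha$ it is a Sturmian sequence. For a sequence $x\colon\mathbb{N}\to A$, $\mathrm{MT}\langle\mathbb{N},<,x\rangle$ is the monadic second-order theory of the structure $(\mathbb{N},S,<,X)$ with successor $S$, order $<$ and function symbol $X$ interpreted as $x$ (individual variables over $\mathbb{N}$, set variables over subsets of $\mathbb{N}$, atomic formulas $S(p,q)$, $p<q$, $p=q$, $X(p)=a$, $P(p)$, quantifiers over both kinds of variables); it is decidable if an algorithm determines the truth of every closed formula. A real $a$ is computable if an algorithm, given a positive rational $\epsilon$, outputs a number in $(a-\epsilon,a+\epsilon)$. *)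

theory Defs
  imports Complex_Main "HOL-Library.Nat_Bijection"
begin

text \<open>
  Algorithms are modelled by the total recursive functions: the least class containing the
  constant zero functions, successor and projections, and closed under composition, primitive
  recursion and minimization of regular functions. In \<open>total_recursive k f\<close> only the values of
  \<open>f\<close> on lists of length \<open>k\<close> are meaningful.
\<close>

inductive total_recursive :: "nat \<Rightarrow> (nat list \<Rightarrow> nat) \<Rightarrow> bool" where
  zero: "total_recursive k (\<lambda>xs. 0)"
| succ: "total_recursive 1 (\<lambda>xs. Suc (xs ! 0))"
| proj: "i < k \<Longrightarrow> total_recursive k (\<lambda>xs. xs ! i)"
| comp: "\<lbrakk>total_recursive (length gs) f; \<forall>g\<in>set gs. total_recursive k g\<rbrakk>
    \<Longrightarrow> total_recursive k (\<lambda>xs. f (map (\<lambda>g. g xs) gs))"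
| prim_rec: "\<lbrakk>total_recursive k f; total_recursive (Suc (Suc k)) g\<rbrakk>
    \<Longrightarrow> total_recursive (Suc k)
          (\<lambda>xs. rec_nat (f (tl xs)) (\<lambda>n r. g (n # r # tl xs)) (hd xs))"
| minim: "\<lbrakk>total_recursive (Suc k) f; \<forall>xs. length xs = k \<longrightarrow> (\<exists>n. f (n # xs) = 0)\<rbrakk>
    \<Longrightarrow> total_recursive k (\<lambda>xs. LEAST n. f (n # xs) = 0)"

definition computable :: "(nat \<Rightarrow> nat) \<Rightarrow> bool" where
  "computable f \<longleftrightarrow> (\<exists>F. total_recursive 1 F \<and> (\<forall>n. f n = F [n]))"

text \<open>
  A rational is presented to an algorithm as the code of any fraction with positive denominator
  representing it, not necessarily in lowest terms.
\<close>

definition rat_decode :: "nat \<Rightarrow> rat" where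
  "rat_decode m = (case prod_decode m of (i, j) \<Rightarrow> Fract (int_decode i) (int (Suc j)))"

lemma surj_rat_decode: "surj rat_decode"
proof (rule surjI)
  fix q :: rat
  obtain a b where ab: "quotient_of q = (a, b)" by fastforce
  then have b: "b > 0" by (rule quotient_of_denom_pos)
  have "q = Fract a b" using ab by (simp add: quotient_of_div Fract_of_int_quotient)
  with ab b show
    "rat_decode (case quotient_of q of (a, b) \<Rightarrow> prod_encode (int_encode a, nat (b - 1))) = q"
    by (simp only: rat_decode_def prod.case prod_encode_inverse int_encode_inverse) simp
qed

definition computable_real :: "real \<Rightarrow> bool" where
  "computable_real a \<longleftrightarrow>
     (\<exists>f. computable f \<and>
        (\<forall>m. rat_decode m > 0 \<longrightarrow>
           real_of_rat (rat_decode (f m)) \<in>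
             {a - real_of_rat (rat_decode m) <..< a + real_of_rat (rat_decode m)}))"

text \<open>
  Individual variables and set variables are two separate sorts, each indexed by \<^typ>\<open>nat\<close>.
  \<open>Sym p a\<close> stands for \<open>X(p) = a\<close>, and \<open>Mem P p\<close> for \<open>P(p)\<close>.
\<close>

datatype mso =
    Succ nat nat
  | Less nat nat
  | Eq nat nat
  | Sym nat int
  | Mem nat nat
  | Neg mso
  | Conj mso mso
  | Disj mso mso
  | Impl mso mso
  | ExI nat mso
  | AllI nat mso
  | ExS nat mso
  | AllS nat mso

primrec sat :: "(nat \<Rightarrow> int) \<Rightarrow> (nat \<Rightarrow> nat) \<Rightarrow> (nat \<Rightarrow> nat set) \<Rightarrow> mso \<Rightarrow> bool" where
  "sat x v V (Succ p q) \<longleftrightarrow> v q = Suc (v p)"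
| "sat x v V (Less p q) \<longleftrightarrow> v p < v q"
| "sat x v V (Eq p q) \<longleftrightarrow> v p = v q"
| "sat x v V (Sym p a) \<longleftrightarrow> x (v p) = a"
| "sat x v V (Mem P p) \<longleftrightarrow> v p \<in> V P"
| "sat x v V (Neg \<phi>) \<longleftrightarrow> \<not> sat x v V \<phi>"
| "sat x v V (Conj \<phi> \<psi>) \<longleftrightarrow> sat x v V \<phi> \<and> sat x v V \<psi>"
| "sat x v V (Disj \<phi> \<psi>) \<longleftrightarrow> sat x v V \<phi> \<or> sat x v V \<psi>"
| "sat x v V (Impl \<phi> \<psi>) \<longleftrightarrow> (sat x v V \<phi> \<longrightarrow> sat x v V \<psi>)"
| "sat x v V (ExI p \<phi>) \<longleftrightarrow> (\<exists>n. sat x (v(p := n)) V \<phi>)"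
| "sat x v V (AllI p \<phi>) \<longleftrightarrow> (\<forall>n. sat x (v(p := n)) V \<phi>)"
| "sat x v V (ExS P \<phi>) \<longleftrightarrow> (\<exists>M. sat x v (V(P := M)) \<phi>)"
| "sat x v V (AllS P \<phi>) \<longleftrightarrow> (\<forall>M. sat x v (V(P := M)) \<phi>)"

primrec free_ind :: "mso \<Rightarrow> nat set" where
  "free_ind (Succ p q) = {p, q}"
| "free_ind (Less p q) = {p, q}"
| "free_ind (Eq p q) = {p, q}"
| "free_ind (Sym p a) = {p}"
| "free_ind (Mem P p) = {p}"
| "free_ind (Neg \<phi>) = free_ind \<phi>"
| "free_ind (Conj \<phi> \<psi>) = free_ind \<phi> \<union> free_ind \<psi>"
| "free_ind (Disj \<phi> \<psi>) = free_ind \<phi> \<union> free_ind \<psi>"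
| "free_ind (Impl \<phi> \<psi>) = free_ind \<phi> \<union> free_ind \<psi>"
| "free_ind (ExI p \<phi>) = free_ind \<phi> - {p}"
| "free_ind (AllI p \<phi>) = free_ind \<phi> - {p}"
| "free_ind (ExS P \<phi>) = free_ind \<phi>"
| "free_ind (AllS P \<phi>) = free_ind \<phi>"

primrec free_set :: "mso \<Rightarrow> nat set" where
  "free_set (Succ p q) = {}"
| "free_set (Less p q) = {}"
| "free_set (Eq p q) = {}"
| "free_set (Sym p a) = {}"
| "free_set (Mem P p) = {P}"
| "free_set (Neg \<phi>) = free_set \<phi>"
| "free_set (Conj \<phi> \<psi>) = free_set \<phi> \<union> free_set \<psi>"
| "free_set (Disj \<phi> \<psi>) = free_set \<phi> \<union> free_set \<psi>"
| "free_set (Impl \<phi> \<psi>) = free_set \<phi> \<union> free_set \<psi>"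
| "free_set (ExI p \<phi>) = free_set \<phi>"
| "free_set (AllI p \<phi>) = free_set \<phi>"
| "free_set (ExS P \<phi>) = free_set \<phi> - {P}"
| "free_set (AllS P \<phi>) = free_set \<phi> - {P}"

primrec letters :: "mso \<Rightarrow> int set" where
  "letters (Succ p q) = {}"
| "letters (Less p q) = {}"
| "letters (Eq p q) = {}"
| "letters (Sym p a) = {a}"
| "letters (Mem P p) = {}"
| "letters (Neg \<phi>) = letters \<phi>"
| "letters (Conj \<phi> \<psi>) = letters \<phi> \<union> letters \<psi>"
| "letters (Disj \<phi> \<psi>) = letters \<phi> \<union> letters \<psi>"
| "letters (Impl \<phi> \<psi>) = letters \<phi> \<union> letters \<psi>"
| "letters (ExI p \<phi>) = letters \<phi>"
| "letters (AllI p \<phi>) = letters \<phi>"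
| "letters (ExS P \<phi>) = letters \<phi>"
| "letters (AllS P \<phi>) = letters \<phi>"

definition sentences :: "int set \<Rightarrow> mso set" where
  "sentences A = {\<phi>. free_ind \<phi> = {} \<and> free_set \<phi> = {} \<and> letters \<phi> \<subseteq> A}"

lemma sat_cong:
  assumes "\<forall>p\<in>free_ind \<phi>. v p = w p" and "\<forall>P\<in>free_set \<phi>. V P = W P"
  shows "sat x v V \<phi> \<longleftrightarrow> sat x w W \<phi>"
  using assms
proof (induction \<phi> arbitrary: v w V W)
  case (ExI p \<phi>)
  then have "sat x (v(p := n)) V \<phi> \<longleftrightarrow> sat x (w(p := n)) W \<phi>" for n
    by (intro ExI.IH) auto
  then show ?case by simp
next
  case (AllI p \<phi>)
  then have "sat x (v(p := n)) V \<phi> \<longleftrightarrow> sat x (w(p := n)) W \<phi>" for n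
    by (intro AllI.IH) auto
  then show ?case by simp
next
  case (ExS P \<phi>)
  then have "sat x v (V(P := M)) \<phi> \<longleftrightarrow> sat x w (W(P := M)) \<phi>" for M
    by (intro ExS.IH) auto
  then show ?case by simp
next
  case (AllS P \<phi>)
  then have "sat x v (V(P := M)) \<phi> \<longleftrightarrow> sat x w (W(P := M)) \<phi>" for M
    by (intro AllS.IH) auto
  then show ?case by simp
next
  case (Neg \<phi>)
  then show ?case by (metis free_ind.simps(6) free_set.simps(6) sat.simps(6))
next
  case (Conj \<phi> \<psi>)
  then have "sat x v V \<phi> \<longleftrightarrow> sat x w W \<phi>" "sat x v V \<psi> \<longleftrightarrow> sat x w W \<psi>"
    by (intro Conj.IH; simp)+
  then show ?case by simp
next
  case (Disj \<phi> \<psi>)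
  then have "sat x v V \<phi> \<longleftrightarrow> sat x w W \<phi>" "sat x v V \<psi> \<longleftrightarrow> sat x w W \<psi>"
    by (intro Disj.IH; simp)+
  then show ?case by simp
next
  case (Impl \<phi> \<psi>)
  then have "sat x v V \<phi> \<longleftrightarrow> sat x w W \<phi>" "sat x v V \<psi> \<longleftrightarrow> sat x w W \<psi>"
    by (intro Impl.IH; simp)+
  then show ?case by simp
qed simp_all

definition MT :: "int set \<Rightarrow> (nat \<Rightarrow> int) \<Rightarrow> mso set" where
  "MT A x = {\<phi> \<in> sentences A. \<forall>v V. sat x v V \<phi>}"

lemma MT_iff: "\<phi> \<in> sentences A \<Longrightarrow> \<phi> \<in> MT A x \<longleftrightarrow> sat x v V \<phi>"
  unfolding MT_def sentences_def by (auto intro: sat_cong[THEN iffD1, of \<phi> v _ V])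

primrec mso_encode :: "mso \<Rightarrow> nat" where
  "mso_encode (Succ p q) = prod_encode (0, prod_encode (p, q))"
| "mso_encode (Less p q) = prod_encode (1, prod_encode (p, q))"
| "mso_encode (Eq p q) = prod_encode (2, prod_encode (p, q))"
| "mso_encode (Sym p a) = prod_encode (3, prod_encode (p, int_encode a))"
| "mso_encode (Mem P p) = prod_encode (4, prod_encode (P, p))"
| "mso_encode (Neg \<phi>) = prod_encode (5, mso_encode \<phi>)"
| "mso_encode (Conj \<phi> \<psi>) = prod_encode (6, prod_encode (mso_encode \<phi>, mso_encode \<psi>))"
| "mso_encode (Disj \<phi> \<psi>) = prod_encode (7, prod_encode (mso_encode \<phi>, mso_encode \<psi>))"
| "mso_encode (Impl \<phi> \<psi>) = prod_encode (8, prod_encode (mso_encode \<phi>, mso_encode \<psi>))"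
| "mso_encode (ExI p \<phi>) = prod_encode (9, prod_encode (p, mso_encode \<phi>))"
| "mso_encode (AllI p \<phi>) = prod_encode (10, prod_encode (p, mso_encode \<phi>))"
| "mso_encode (ExS P \<phi>) = prod_encode (11, prod_encode (P, mso_encode \<phi>))"
| "mso_encode (AllS P \<phi>) = prod_encode (12, prod_encode (P, mso_encode \<phi>))"

lemma inj_mso_encode: "inj mso_encode"
proof (rule injI)
  fix \<phi> \<psi>
  show "mso_encode \<phi> = mso_encode \<psi> \<Longrightarrow> \<phi> = \<psi>"
    by (induction \<phi> arbitrary: \<psi>; case_tac \<psi>; simp add: prod_encode_eq int_encode_eq)
qed

definition decidable_MT :: "int set \<Rightarrow> (nat \<Rightarrow> int) \<Rightarrow> bool" where
  "decidable_MT A x \<longleftrightarrow>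
     (\<exists>f. computable f \<and>
        (\<forall>\<phi>\<in>sentences A. f (mso_encode \<phi>) = (if \<phi> \<in> MT A x then 1 else 0)))"

definition mechanical :: "real \<Rightarrow> real \<Rightarrow> nat \<Rightarrow> int" where
  "mechanical \<alpha> \<rho> n = \<lfloor>\<alpha> * real (n + 1) + \<rho>\<rfloor> - \<lfloor>\<alpha> * real n + \<rho>\<rfloor>"

lemma mechanical_range:
  assumes "0 < \<alpha>" and "\<alpha> < 1"
  shows "mechanical \<alpha> \<rho> n \<in> {0, 1}"
proof -
  have "\<lfloor>\<alpha> * real n + \<rho>\<rfloor> \<le> \<lfloor>\<alpha> * real (n + 1) + \<rho>\<rfloor>"
    using assms by (intro floor_mono) (simp add: algebra_simps)
  moreover have "\<lfloor>\<alpha> * real (n + 1) + \<rho>\<rfloor> \<le> \<lfloor>\<alpha> * real n + \<rho> + 1\<rfloor>"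
    using assms by (intro floor_mono) (simp add: algebra_simps)
  ultimately show ?thesis by (auto simp: mechanical_def)
qed

end

theory Submission
  imports Defs "HOL-Analysis.Kronecker_Approximation_Theorem" "HOL-Library.Ramsey"
begin

text \<open>
  Monadic second-order formulas are evaluated by the composition method. For every formula \<open>\<phi>\<close> the
  factors of a word have finitely many \<open>\<phi>\<close>-types, which multiply under concatenation; by Ramsey's
  theorem the type of an infinite product of factors of the same idempotent type \<open>e\<close> depends on \<open>e\<close>
  only. In a finite semigroup the factors of a uniformly recurrent word beyond some length lie in a
  single minimal ideal class, hence cutting the word in the middle of the occurrences of a long factor
  yields blocks whose types lie in one group. Any infinite product of elements of a group with unit \<open>e\<close>
  equals the infinite power of \<open>e\<close>. For Sturmian words of slope \<open>\<alpha>\<close> the factors of length \<open>N\<close> are computable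
  from \<open>\<alpha>\<close>, so that such a decomposition can be found and verified by search, and it determines the truth of \<open>\<phi>\<close>.
  Conversely, the truth of sentences describing single positions gives \<open>\<lfloor>\<alpha> n + \<rho>\<rfloor>\<close>, from
  which \<open>\<alpha>\<close> and \<open>\<rho>\<close> are approximated.
\<close>

subsection \<open>Recursive functions on encoded data\<close>

text \<open>The parameters enter differently. The set of factors depends on \<alpha> only, and the
  condition on the blocks is tested on all factors of one length N, so a finite test controls
  infinitely many blocks. The shift \<rho> is used only for a prefix of length 2 l: the tail from
  position l on has the type \<open>omega\<close> of the group unit, wherever the blocks lie in the
  group. This is where the group is essential: the sequence of block types may be complicated and is
  never computed, but Ramsey regroups the blocks into equal idempotents, a group has a single
  idempotent, and the finite stretch cut off is absorbed. The length l comes from a minimal ideal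
  and is not computed from it; it is found by search, since a certificate is a condition on finitely
  many words whose soundness proof does not mention ideals. With computable reals the obstacle is
  equality: \<alpha> n + \<rho> may be an integer for one n, which no approximation can confirm.
  That one value is built into the algorithm, so the construction is not uniform in \<alpha> and
  \<rho>.\<close>

definition trec :: "nat \<Rightarrow> (nat list \<Rightarrow> nat) \<Rightarrow> bool" where
  "trec k F \<longleftrightarrow> (\<exists>G. total_recursive k G \<and> (\<forall>xs. length xs = k \<longrightarrow> F xs = G xs))"

text \<open>\<open>total_recursive\<close> fixes a function on lists of every length. In
  \<open>trec\<close> agreement on lists of length k is enough, so that functions produced by the
  closure rules may be rewritten into readable form.\<close>

lemma trec_cong:
  assumes "trec k F" "\<And>xs. length xs = k \<Longrightarrow> F xs = G xs"
  shows "trec k G"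
  using assms unfolding trec_def by metis

lemma trec_proj: "i < k \<Longrightarrow> trec k (\<lambda>xs. xs ! i)"
  unfolding trec_def by (blast intro: total_recursive.proj)

lemma trec_proj_drop: "i + j < k \<Longrightarrow> trec k (\<lambda>xs. drop i xs ! j)"
  by (rule trec_cong[OF trec_proj[of "i + j"]]) simp_all

lemma trec_comp:
  assumes "trec (length gs) f" and "\<forall>g\<in>set gs. trec k g"
  shows "trec k (\<lambda>xs. f (map (\<lambda>g. g xs) gs))"
proof -
  obtain f' where f': "total_recursive (length gs) f'" "\<And>xs. length xs = length gs \<Longrightarrow> f xs = f' xs"
    using assms(1) unfolding trec_def by blast
  obtain c where c: "\<And>g. g \<in> set gs \<Longrightarrow> total_recursive k (c g) \<and> (\<forall>xs. length xs = k \<longrightarrow> g xs = c g xs)"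
    using assms(2) unfolding trec_def by metis
  have "total_recursive k (\<lambda>xs. f' (map (\<lambda>g. g xs) (map c gs)))"
    by (rule total_recursive.comp) (use f' c in auto)
  moreover have "f (map (\<lambda>g. g xs) gs) = f' (map (\<lambda>g. g xs) (map c gs))" if "length xs = k" for xs
  proof -
    have "map (\<lambda>g. g xs) gs = map (\<lambda>g. g xs) (map c gs)" using c that by simp
    then show ?thesis using f'(2) by (metis length_map)
  qed
  ultimately show ?thesis unfolding trec_def by blast
qed

lemma trec_comp1: "trec 1 f \<Longrightarrow> trec k g \<Longrightarrow> trec k (\<lambda>xs. f [g xs])"
  using trec_comp[of "[g]" f k] by simp

lemma trec_comp2: "trec 2 f \<Longrightarrow> trec k g \<Longrightarrow> trec k h \<Longrightarrow> trec k (\<lambda>xs. f [g xs, h xs])"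
  using trec_comp[of "[g, h]" f k] by (simp add: numeral_2_eq_2)

lemma trec_0: "trec k (\<lambda>xs. 0)"
  unfolding trec_def by (blast intro: total_recursive.zero)

lemma trec_Suc: "trec k f \<Longrightarrow> trec k (\<lambda>xs. Suc (f xs))"
proof -
  have "trec 1 (\<lambda>xs. Suc (xs ! 0))" unfolding trec_def by (blast intro: total_recursive.succ)
  then show "trec k f \<Longrightarrow> ?thesis" using trec_comp1[of "\<lambda>xs. Suc (xs ! 0)" k f] by simp
qed

lemma trec_const: "trec k (\<lambda>xs. c)"
  by (induction c) (rule trec_0, erule trec_Suc)

text \<open>\<open>prim_rec\<close> takes its bound from the head of the argument list; composing
  with \<open>n\<close> followed by all projections turns this into an arbitrary bound. The
  parameters of the step stand behind counter and previous value, hence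
  \<open>drop 2 ys\<close>.\<close>

lemma trec_rec:
  assumes a: "trec k a" and n: "trec k n"
    and g: "trec (Suc (Suc k)) (\<lambda>ys. g (ys ! 0) (ys ! 1) (drop 2 ys))"
  shows "trec k (\<lambda>xs. rec_nat (a xs) (\<lambda>i r. g i r xs) (n xs))"
proof -
  obtain a' where a': "total_recursive k a'" "\<And>xs. length xs = k \<Longrightarrow> a xs = a' xs"
    using a unfolding trec_def by blast
  obtain g' where g': "total_recursive (Suc (Suc k)) g'"
      "\<And>ys. length ys = Suc (Suc k) \<Longrightarrow> g (ys ! 0) (ys ! 1) (drop 2 ys) = g' ys"
    using g unfolding trec_def by blast
  define R where "R = (\<lambda>xs. rec_nat (a' (tl xs)) (\<lambda>n r. g' (n # r # tl xs)) (hd xs))"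
  have "trec (Suc k) R"
    unfolding trec_def R_def using total_recursive.prim_rec[OF a'(1) g'(1)] by blast
  then have "trec (length (n # map (\<lambda>i xs. xs ! i) [0..<k])) R" by simp
  then have "trec k (\<lambda>xs. R (map (\<lambda>g. g xs) (n # map (\<lambda>i xs. xs ! i) [0..<k])))"
    by (rule trec_comp) (auto intro: trec_proj n)
  then show ?thesis
  proof (rule trec_cong)
    fix xs :: "nat list" assume xs: "length xs = k"
    then have "map (\<lambda>g. g xs) (n # map (\<lambda>i xs. xs ! i) [0..<k]) = n xs # xs"
      using map_nth[of xs] by (simp add: comp_def)
    moreover have "g i r xs = g' (i # r # xs)" for i r
      using g'(2)[of "i # r # xs"] xs by simp
    ultimately show "R (map (\<lambda>g. g xs) (n # map (\<lambda>i xs. xs ! i) [0..<k]))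
        = rec_nat (a xs) (\<lambda>i r. g i r xs) (n xs)"
      using a'(2)[OF xs] by (simp add: R_def)
  qed
qed

lemma trec_least:
  assumes f: "trec (Suc k) f" and ex: "\<And>xs. length xs = k \<Longrightarrow> \<exists>n. f (n # xs) = 0"
  shows "trec k (\<lambda>xs. LEAST n. f (n # xs) = 0)"
proof -
  obtain f' where f': "total_recursive (Suc k) f'" "\<And>xs. length xs = Suc k \<Longrightarrow> f xs = f' xs"
    using f unfolding trec_def by blast
  then have eq: "f (n # xs) = f' (n # xs)" if "length xs = k" for n xs using that by simp
  then have "total_recursive k (\<lambda>xs. LEAST n. f' (n # xs) = 0)"
    using ex by (intro total_recursive.minim f') simp
  then show ?thesis unfolding trec_def using eq by force
qed

section \<open>Arithmetic, case distinction and pairing\<close>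

lemma trec_nat2: "trec 2 (\<lambda>ys. h (ys ! 0) (ys ! 1)) \<Longrightarrow> trec k f \<Longrightarrow> trec k g \<Longrightarrow> trec k (\<lambda>xs. h (f xs) (g xs))"
  using trec_comp2[of "\<lambda>ys. h (ys ! 0) (ys ! 1)" k f g] by simp

lemma trec_nat1: "trec 1 (\<lambda>ys. h (ys ! 0)) \<Longrightarrow> trec k f \<Longrightarrow> trec k (\<lambda>xs. h (f xs))"
  using trec_comp1[of "\<lambda>ys. h (ys ! 0)" k f] by simp

lemma trec_add: assumes "trec k f" "trec k g" shows "trec k (\<lambda>xs. f xs + g xs)"
proof (rule trec_nat2[OF _ assms])
  have "trec 2 (\<lambda>ys. rec_nat (ys ! 0) (\<lambda>i r. Suc r) (ys ! 1))"
    by (intro trec_rec trec_Suc trec_proj) simp_all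
  moreover have "rec_nat x (\<lambda>i r. Suc r) y = x + y" for x y by (induction y) simp_all
  ultimately show "trec 2 (\<lambda>ys. ys ! 0 + ys ! 1)" by simp
qed

lemma trec_mult: assumes "trec k f" "trec k g" shows "trec k (\<lambda>xs. f xs * g xs)"
proof (rule trec_nat2[OF _ assms])
  have "trec 2 (\<lambda>ys. rec_nat 0 (\<lambda>i r. r + ys ! 0) (ys ! 1))"
    by (rule trec_rec, rule trec_0, rule trec_proj, simp, simp, intro trec_add trec_proj trec_proj_drop) simp_all
  moreover have "rec_nat 0 (\<lambda>i r. r + x) y = x * y" for x y :: nat by (induction y) simp_all
  ultimately show "trec 2 (\<lambda>ys. ys ! 0 * ys ! 1)" by simp
qed

lemma trec_pred: assumes "trec k f" shows "trec k (\<lambda>xs. f xs - 1)"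
proof (rule trec_nat1[OF _ assms])
  have "trec 1 (\<lambda>ys. rec_nat 0 (\<lambda>i r. i) (ys ! 0))"
    by (intro trec_rec trec_0 trec_proj) simp_all
  moreover have "rec_nat 0 (\<lambda>i r. i) y = y - 1" for y :: nat by (induction y) simp_all
  ultimately show "trec 1 (\<lambda>ys. ys ! 0 - 1)" by simp
qed

lemma trec_diff: assumes "trec k f" "trec k g" shows "trec k (\<lambda>xs. f xs - g xs)"
proof (rule trec_nat2[OF _ assms])
  have "trec 2 (\<lambda>ys. rec_nat (ys ! 0) (\<lambda>i r. r - 1) (ys ! 1))"
    by (intro trec_rec trec_pred trec_proj) simp_all
  moreover have "rec_nat x (\<lambda>i r. r - 1) y = x - y" for x y :: nat by (induction y) simp_all
  ultimately show "trec 2 (\<lambda>ys. ys ! 0 - ys ! 1)" by simp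
qed

lemma trec_triangle: assumes "trec k f" shows "trec k (\<lambda>xs. triangle (f xs))"
proof (rule trec_nat1[OF _ assms])
  have "trec 1 (\<lambda>ys. rec_nat 0 (\<lambda>i r. r + Suc i) (ys ! 0))"
    by (intro trec_rec trec_0 trec_add trec_Suc trec_proj) simp_all
  moreover have "rec_nat 0 (\<lambda>i r. r + Suc i) y = triangle y" for y :: nat by (induction y) simp_all
  ultimately show "trec 1 (\<lambda>ys. triangle (ys ! 0))" by simp
qed

lemma trec_if0:
  assumes "trec k c" "trec k f" "trec k g"
  shows "trec k (\<lambda>xs. if c xs = 0 then f xs else g xs)"
proof -
  have "trec k (\<lambda>xs. f xs * (1 - c xs) + g xs * (1 - (1 - c xs)))"
    using assms by (intro trec_add trec_mult trec_diff trec_const)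
  then show ?thesis by (rule trec_cong) simp
qed

lemma trec_pair: "trec k f \<Longrightarrow> trec k g \<Longrightarrow> trec k (\<lambda>xs. prod_encode (f xs, g xs))"
  by (simp add: prod_encode_def trec_add trec_triangle)

lemma mono_triangle: "m \<le> n \<Longrightarrow> triangle m \<le> triangle n"
  by (induction n rule: dec_induct) simp_all

text \<open>The diagonal on which a pair lies is found by unbounded search.\<close>
lemma trec_unpair:
  assumes "trec k f"
  shows "trec k (\<lambda>xs. fst (prod_decode (f xs)))" "trec k (\<lambda>xs. snd (prod_decode (f xs)))"
proof -
  define d where "d = (\<lambda>z. LEAST s. Suc z - triangle (Suc s) = 0)"
  have d: "d z = fst (prod_decode z) + snd (prod_decode z)" for z
  proof -
    obtain m n where z: "z = prod_encode (m, n)" by (metis prod_decode_inverse surj_pair)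
    have "(LEAST s. Suc z - triangle (Suc s) = 0) = m + n"
    proof (rule Least_equality)
      show "Suc z - triangle (Suc (m + n)) = 0" by (simp add: z prod_encode_def)
    next
      fix s assume "Suc z - triangle (Suc s) = 0"
      then have *: "z < triangle (Suc s)" by simp
      show "m + n \<le> s"
      proof (rule ccontr)
        assume "\<not> ?thesis"
        then have "triangle (Suc s) \<le> triangle (m + n)" by (intro mono_triangle) simp
        with * show False by (simp add: z prod_encode_def)
      qed
    qed
    then show ?thesis by (simp add: d_def z)
  qed
  have td: "trec 1 (\<lambda>xs. d (xs ! 0))"
  proof -
    have "trec 1 (\<lambda>xs. LEAST s. (\<lambda>ys. Suc (ys ! 1) - triangle (Suc (ys ! 0))) (s # xs) = 0)"
    proof (rule trec_least)
      show "trec (Suc 1) (\<lambda>ys. Suc (ys ! 1) - triangle (Suc (ys ! 0)))"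
        by (intro trec_diff trec_Suc trec_triangle trec_proj) simp_all
      fix xs :: "nat list"
      have le: "n \<le> triangle n" for n by (induction n) simp_all
      show "\<exists>s. Suc ((s # xs) ! 1) - triangle (Suc ((s # xs) ! 0)) = 0"
      proof
        have "(xs ! 0 # xs) ! 1 = xs ! 0" "(xs ! 0 # xs) ! 0 = xs ! 0" by simp_all
        then show "Suc ((xs ! 0 # xs) ! 1) - triangle (Suc ((xs ! 0 # xs) ! 0)) = 0"
          using le[of "Suc (xs ! 0)"] by (simp only: diff_is_0_eq)
      qed
    qed
    then show ?thesis by (simp only: d_def One_nat_def nth_Cons_Suc nth_Cons_0)
  qed
  have dz: "fst (prod_decode z) = z - triangle (d z)" for z
  proof -
    obtain m n where z: "z = prod_encode (m, n)" by (metis prod_decode_inverse surj_pair)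
    then have "d z = m + n" by (simp add: d)
    then show ?thesis by (simp add: z) (simp add: prod_encode_def)
  qed
  have "trec 1 (\<lambda>xs. xs ! 0 - triangle (d (xs ! 0)))"
    by (intro trec_diff trec_triangle td trec_proj) simp
  then have 1: "trec 1 (\<lambda>xs. fst (prod_decode (xs ! 0)))" by (simp add: dz)
  have "trec 1 (\<lambda>xs. d (xs ! 0) - fst (prod_decode (xs ! 0)))"
    by (intro trec_diff td 1)
  then have 2: "trec 1 (\<lambda>xs. snd (prod_decode (xs ! 0)))" by (simp add: d)
  show "trec k (\<lambda>xs. fst (prod_decode (f xs)))" "trec k (\<lambda>xs. snd (prod_decode (f xs)))"
    using trec_nat1[OF 1 assms] trec_nat1[OF 2 assms] by simp_all
qed

text \<open>A bijection rather than an injection: every number decodes, so an unbounded search over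
  numbers is a search over all objects, without tests for well-formed codes.\<close>

class enc =
  fixes enc :: "'a \<Rightarrow> nat"
  assumes bij_enc: "bij enc"
begin

definition dec :: "nat \<Rightarrow> 'a" where "dec = inv enc"

lemma dec_enc [simp]: "dec (enc x) = x"
  unfolding dec_def using bij_enc by (simp add: bij_is_inj)

lemma enc_dec [simp]: "enc (dec n) = n"
  unfolding dec_def using bij_enc by (simp add: bij_is_surj surj_f_inv_f)

lemma enc_inject [simp]: "enc x = enc y \<longleftrightarrow> x = y"
  by (metis dec_enc)

end

instantiation nat :: enc
begin
definition enc_nat :: "nat \<Rightarrow> nat" where "enc_nat n = n"
instance by standard (simp add: enc_nat_def bij_def inj_def surj_def)
end

instantiation prod :: (enc, enc) enc
begin
definition enc_prod :: "'a \<times> 'b \<Rightarrow> nat" where "enc_prod p = prod_encode (enc (fst p), enc (snd p))"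
instance
proof
  have "surj (enc :: 'a \<times> 'b \<Rightarrow> nat)"
  proof (rule surjI)
    fix n show "enc (dec (fst (prod_decode n)) :: 'a, dec (snd (prod_decode n)) :: 'b) = n"
      by (simp add: enc_prod_def)
  qed
  moreover have "inj (enc :: 'a \<times> 'b \<Rightarrow> nat)"
    by (rule injI) (simp add: enc_prod_def prod_eq_iff)
  ultimately show "bij (enc :: 'a \<times> 'b \<Rightarrow> nat)" by (simp add: bij_def)
qed
end

instantiation list :: (enc) enc
begin
definition enc_list :: "'a list \<Rightarrow> nat" where "enc_list xs = list_encode (map enc xs)"
instance
proof
  have "inj (map (enc :: 'a \<Rightarrow> nat))" by (simp add: bij_enc bij_is_inj inj_mapI)
  moreover have "surj (map (enc :: 'a \<Rightarrow> nat))" by (rule surjI[of _ "map dec"]) (simp add: map_idI)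
  ultimately have "bij (list_encode \<circ> map (enc :: 'a \<Rightarrow> nat))"
    by (intro bij_comp bij_list_encode) (simp add: bij_def)
  moreover have "(enc :: 'a list \<Rightarrow> nat) = list_encode \<circ> map enc" by (rule ext) (simp add: enc_list_def)
  ultimately show "bij (enc :: 'a list \<Rightarrow> nat)" by simp
qed
end

definition recursive :: "('a::enc \<Rightarrow> 'b::enc) \<Rightarrow> bool" where
  "recursive f \<longleftrightarrow> trec 1 (\<lambda>xs. enc (f (dec (xs ! 0))))"

definition decidable :: "('a::enc \<Rightarrow> bool) \<Rightarrow> bool" where
  "decidable P \<longleftrightarrow> recursive (\<lambda>x. if P x then 1 else (0 :: nat))"

lemma dec_nat [simp]: "(dec n :: nat) = n" by (metis enc_dec enc_nat_def)

lemma computable_iff_recursive: "computable f \<longleftrightarrow> recursive f"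
proof
  assume "computable f"
  then obtain F where "total_recursive 1 F" "\<forall>n. f n = F [n]" unfolding computable_def by blast
  then show "recursive f" unfolding recursive_def trec_def enc_nat_def
    by (intro exI[of _ F]) (auto simp: length_Suc_conv)
next
  assume "recursive f"
  then obtain F where F: "total_recursive 1 F" "\<forall>xs. length xs = 1 \<longrightarrow> f (xs ! 0) = F xs"
    unfolding recursive_def trec_def by (auto simp: enc_nat_def)
  have "f n = F [n]" for n using F(2)[rule_format, of "[n]"] by simp
  with F(1) show "computable f" unfolding computable_def by blast
qed

lemma recursive_comp:
  assumes "recursive f" "recursive g" shows "recursive (\<lambda>x. f (g x))"
proof -
  have "trec 1 (\<lambda>xs. enc (f (dec (enc (g (dec (xs ! 0)))))))"
    using trec_comp1[OF assms(1)[unfolded recursive_def] assms(2)[unfolded recursive_def]] by simp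
  then show ?thesis by (simp add: recursive_def)
qed

lemma recursive_id: "recursive (\<lambda>x. x)"
  unfolding recursive_def using trec_proj[of 0 1] by simp

lemma recursive_const: "recursive (\<lambda>x. c)"
  unfolding recursive_def by (rule trec_const)

lemma recursive_Pair: "recursive f \<Longrightarrow> recursive g \<Longrightarrow> recursive (\<lambda>x. (f x, g x))"
  unfolding recursive_def by (simp add: enc_prod_def trec_pair)

lemma dec_prod: "(dec n :: 'a::enc \<times> 'b::enc) = (dec (fst (prod_decode n)), dec (snd (prod_decode n)))"
proof -
  have "enc (dec (fst (prod_decode n)) :: 'a, dec (snd (prod_decode n)) :: 'b) = n"
    by (simp add: enc_prod_def)
  then show ?thesis by (metis dec_enc)
qed

lemma recursive_fst: "recursive f \<Longrightarrow> recursive (\<lambda>x. fst (f x))"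
  unfolding recursive_def
  by (drule trec_unpair(1)) (simp add: enc_prod_def)

lemma recursive_snd: "recursive f \<Longrightarrow> recursive (\<lambda>x. snd (f x))"
  unfolding recursive_def
  by (drule trec_unpair(2)) (simp add: enc_prod_def)

lemma recursive_Suc: "recursive f \<Longrightarrow> recursive (\<lambda>x. Suc (f x))"
  unfolding recursive_def enc_nat_def by (rule trec_Suc)

lemma recursive_add: "recursive f \<Longrightarrow> recursive g \<Longrightarrow> recursive (\<lambda>x. f x + g x :: nat)"
  unfolding recursive_def enc_nat_def by (rule trec_add)

lemma recursive_mult: "recursive f \<Longrightarrow> recursive g \<Longrightarrow> recursive (\<lambda>x. f x * g x :: nat)"
  unfolding recursive_def enc_nat_def by (rule trec_mult)

lemma recursive_diff: "recursive f \<Longrightarrow> recursive g \<Longrightarrow> recursive (\<lambda>x. f x - g x :: nat)"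
  unfolding recursive_def enc_nat_def by (rule trec_diff)

lemma recursive_prod_encode: "recursive f \<Longrightarrow> recursive g \<Longrightarrow> recursive (\<lambda>x. prod_encode (f x, g x))"
  unfolding recursive_def enc_nat_def by (rule trec_pair)

lemma recursive_prod_decode: "recursive f \<Longrightarrow> recursive (\<lambda>x. prod_decode (f x))"
  unfolding recursive_def by (simp add: enc_prod_def enc_nat_def)

lemma recursive_enc: "recursive f \<Longrightarrow> recursive (\<lambda>x. enc (f x))"
  unfolding recursive_def enc_nat_def .

lemma recursive_dec: "recursive f \<Longrightarrow> recursive (\<lambda>x. dec (f x))"
  unfolding recursive_def enc_nat_def by simp

lemma recursive_if: "decidable P \<Longrightarrow> recursive f \<Longrightarrow> recursive g \<Longrightarrow> recursive (\<lambda>x. if P x then f x else g x)"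
proof -
  assume "decidable P" "recursive f" "recursive g"
  then have "trec 1 (\<lambda>xs. if (if P (dec (xs ! 0)) then 1 else (0::nat)) = 0
      then enc (g (dec (xs ! 0))) else enc (f (dec (xs ! 0))))"
    by (intro trec_if0) (simp_all add: decidable_def recursive_def enc_nat_def)
  then show ?thesis unfolding recursive_def by (rule trec_cong) simp
qed

lemma decidable_eq0: "recursive f \<Longrightarrow> decidable (\<lambda>x. f x = (0 :: nat))"
proof -
  assume "recursive f"
  then have "recursive (\<lambda>x. 1 - f x)" by (intro recursive_diff recursive_const)
  moreover have "(if n = 0 then 1 else 0) = 1 - n" for n :: nat by simp
  ultimately show ?thesis by (simp only: decidable_def)
qed

lemma decidable_not: "decidable P \<Longrightarrow> decidable (\<lambda>x. \<not> P x)"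
proof -
  assume "decidable P"
  then have "decidable (\<lambda>x. (if P x then 1 else (0::nat)) = 0)"
    unfolding decidable_def[of P] by (rule decidable_eq0)
  moreover have "(if P x then 1 else (0::nat)) = 0 \<longleftrightarrow> \<not> P x" for x by simp
  ultimately show ?thesis by simp
qed

lemma decidable_conj:
  assumes "decidable P" "decidable Q" shows "decidable (\<lambda>x. P x \<and> Q x)"
proof -
  have "recursive (\<lambda>x. if P x then if Q x then 1 else 0 else (0::nat))"
    using assms by (intro recursive_if recursive_const) (simp_all add: decidable_def)
  moreover have "(if P x \<and> Q x then 1 else 0) = (if P x then if Q x then 1 else 0 else (0::nat))" for x
    by simp
  ultimately show ?thesis unfolding decidable_def by simp
qed

lemma decidable_disj: "decidable P \<Longrightarrow> decidable Q \<Longrightarrow> decidable (\<lambda>x. P x \<or> Q x)"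
  using decidable_not[OF decidable_conj[OF decidable_not decidable_not], of P Q] by simp

lemma decidable_imp: "decidable P \<Longrightarrow> decidable Q \<Longrightarrow> decidable (\<lambda>x. P x \<longrightarrow> Q x)"
  using decidable_not[OF decidable_conj[OF _ decidable_not], of P Q] by simp

lemma decidable_le: "recursive f \<Longrightarrow> recursive g \<Longrightarrow> decidable (\<lambda>x. f x \<le> (g x :: nat))"
  using decidable_eq0[OF recursive_diff, of f g] by simp

lemma decidable_less: "recursive f \<Longrightarrow> recursive g \<Longrightarrow> decidable (\<lambda>x. f x < (g x :: nat))"
  using decidable_le[OF recursive_Suc, of f g] by (simp add: Suc_le_eq)

lemma decidable_eq: "recursive f \<Longrightarrow> recursive g \<Longrightarrow> decidable (\<lambda>x. f x = (g x :: 'a::enc))"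
proof -
  assume "recursive f" "recursive g"
  then have "decidable (\<lambda>x. enc (f x) \<le> enc (g x) \<and> enc (g x) \<le> enc (f x))"
    by (intro decidable_conj decidable_le recursive_enc)
  moreover have "enc a \<le> enc b \<and> enc b \<le> enc a \<longleftrightarrow> a = b" for a b :: 'a
    by (metis enc_inject le_antisym order_refl)
  ultimately show ?thesis by simp
qed

lemma decidable_comp: "decidable P \<Longrightarrow> recursive f \<Longrightarrow> decidable (\<lambda>x. P (f x))"
  unfolding decidable_def by (rule recursive_comp)

text \<open>The recursion runs on codes: each round decodes the accumulator, applies
  \<open>g\<close> and encodes the result. The nested projections are the format in which
  \<open>rec_intros\<close> treats functions of several variables.\<close>

lemma recursive_rec_nat:
  assumes a: "recursive a" and n: "recursive n"
    and g: "recursive (\<lambda>p. g (fst p) (fst (snd p)) (snd (snd p)))"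
  shows "recursive (\<lambda>z. rec_nat (a z) (g z) (n z))"
proof -
  have "trec (Suc (Suc 1)) (\<lambda>ys. enc (g (dec (drop 2 ys ! 0)) (ys ! 0) (dec (ys ! 1))))"
  proof -
    have "trec 3 (\<lambda>ys. prod_encode (ys ! 2, prod_encode (ys ! 0, ys ! 1)))"
      by (intro trec_pair trec_proj) simp_all
    from trec_comp1[OF g[unfolded recursive_def] this]
    have "trec 3 (\<lambda>ys. enc (g (dec (ys ! 2)) (ys ! 0) (dec (ys ! 1))))"
      by (simp add: dec_prod)
    then show ?thesis by (simp add: numeral_3_eq_3 numeral_2_eq_2 nth_drop) (erule trec_cong, simp)
  qed
  from trec_rec[OF a[unfolded recursive_def] n[unfolded recursive_def] this]
  have "trec 1 (\<lambda>xs. rec_nat (enc (a (dec (xs ! 0)))) (\<lambda>i r. enc (g (dec (xs ! 0)) i (dec r))) (n (dec (xs ! 0))))"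
    by (simp add: enc_nat_def)
  moreover have "rec_nat (enc (a z)) (\<lambda>i r. enc (g z i (dec r))) m = enc (rec_nat (a z) (g z) m)" for z m
    by (induction m) simp_all
  ultimately show ?thesis by (simp add: recursive_def)
qed

lemma recursive_Least:
  assumes P: "decidable (\<lambda>p. P (fst p) (snd p))" and ex: "\<And>z. \<exists>n. P z n"
  shows "recursive (\<lambda>z. LEAST n :: nat. P z n)"
proof -
  have "trec 2 (\<lambda>ys. prod_encode (ys ! 1, ys ! 0))"
    by (intro trec_pair trec_proj) simp_all
  from trec_comp1[OF decidable_not[OF P, unfolded decidable_def recursive_def] this]
  have "trec (Suc 1) (\<lambda>ys. if P (dec (ys ! 1)) (ys ! 0) then 0 else 1)"
    by (simp add: dec_prod numeral_2_eq_2 enc_nat_def) (erule trec_cong, simp)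
  from trec_least[OF this]
  have "trec 1 (\<lambda>xs. LEAST n. (if P (dec (xs ! 0)) n then 0 else (1::nat)) = 0)"
    using ex by simp
  moreover have "(if Q then 0 else (1::nat)) = 0 \<longleftrightarrow> Q" for Q by simp
  ultimately have "trec 1 (\<lambda>xs. LEAST n. P (dec (xs ! 0)) n)" by simp
  then show ?thesis by (simp add: recursive_def enc_nat_def)
qed

subsection \<open>Lists and well-founded recursion\<close>

text \<open>These rules prove recursiveness along the syntax of a term. Composition rules stay
  outside, because their conclusions unify with any goal; they are supplied in instantiated form for
  functions that have no rule of their own.\<close>

named_theorems rec_intros

declare recursive_id [rec_intros] recursive_const [rec_intros]
  recursive_Pair [rec_intros] recursive_fst [rec_intros] recursive_snd [rec_intros]
  recursive_Suc [rec_intros] recursive_add [rec_intros] recursive_mult [rec_intros]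
  recursive_diff [rec_intros] recursive_prod_encode [rec_intros]
  recursive_prod_decode [rec_intros] recursive_if [rec_intros]
  decidable_not [rec_intros] decidable_conj [rec_intros]
  decidable_disj [rec_intros] decidable_imp [rec_intros] decidable_le [rec_intros]
  decidable_less [rec_intros] decidable_eq [rec_intros]
  recursive_rec_nat [rec_intros]

lemma recursive_comp2: "recursive (\<lambda>p. P (fst p) (snd p)) \<Longrightarrow> recursive f \<Longrightarrow> recursive g \<Longrightarrow> recursive (\<lambda>x. P (f x) (g x))"
  using recursive_comp[of "\<lambda>p. P (fst p) (snd p)" "\<lambda>x. (f x, g x)"] by (simp add: recursive_Pair)

lemma recursive_comp3:
  "recursive (\<lambda>p. P (fst p) (fst (snd p)) (snd (snd p))) \<Longrightarrow> recursive f \<Longrightarrow> recursive g \<Longrightarrow> recursive h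
    \<Longrightarrow> recursive (\<lambda>x. P (f x) (g x) (h x))"
  using recursive_comp[of "\<lambda>p. P (fst p) (fst (snd p)) (snd (snd p))" "\<lambda>x. (f x, g x, h x)"]
  by (simp add: recursive_Pair)

lemma enc_Cons: "enc (x # xs) = Suc (prod_encode (enc x, enc xs))" by (simp add: enc_list_def)

lemma recursive_Cons [rec_intros]: "recursive f \<Longrightarrow> recursive g \<Longrightarrow> recursive (\<lambda>x. f x # g x)"
proof -
  assume "recursive f" "recursive g"
  then have "recursive (\<lambda>x. dec (Suc (prod_encode (enc (f x), enc (g x)))) :: 'b list)"
    by (intro recursive_dec recursive_Suc recursive_prod_encode recursive_enc)
  then show ?thesis by (simp flip: enc_Cons)
qed

lemma recursive_case_list [rec_intros]:
  assumes "recursive l" "recursive a" and f: "recursive (\<lambda>p. f (fst p) (fst (snd p)) (snd (snd p)))"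
  shows "recursive (\<lambda>z. case l z of [] \<Rightarrow> a z | x # xs \<Rightarrow> f z x xs)"
proof -
  let ?d = "\<lambda>z. prod_decode (enc (l z) - 1)"
  have "recursive (\<lambda>z. (z, dec (fst (?d z)) :: 'b, dec (snd (?d z)) :: 'b list))"
    by (intro rec_intros recursive_dec recursive_enc assms)
  from recursive_comp[OF f this]
  have "recursive (\<lambda>z. if l z = [] then a z else f z (dec (fst (?d z))) (dec (snd (?d z))))"
    by (intro rec_intros assms) simp
  moreover have "(if l z = [] then a z else f z (dec (fst (?d z))) (dec (snd (?d z))))
      = (case l z of [] \<Rightarrow> a z | x # xs \<Rightarrow> f z x xs)" for z
    by (cases "l z") (simp_all add: enc_Cons)
  ultimately show ?thesis by simp
qed

text \<open>Provides a computable bound on the number of rounds needed to traverse a list, before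
  the length is known to be computable.\<close>

lemma length_le_enc: "length xs \<le> enc xs"
proof (induction xs)
  case (Cons x xs)
  have "enc xs \<le> prod_encode (enc x, enc xs)" by (rule le_prod_encode_2)
  with Cons show ?case by (simp add: enc_Cons)
qed simp

lemma recursive_foldl [rec_intros]:
  assumes f: "recursive (\<lambda>p. f (fst p) (fst (snd p)) (snd (snd p)))" and "recursive a" "recursive l"
  shows "recursive (\<lambda>z. foldl (f z) (a z) (l z))"
proof -
  define step where "step = (\<lambda>z (i::nat) r. case snd r of [] \<Rightarrow> r | x # xs \<Rightarrow> (f z (fst r) x, xs))"
  have st: "recursive (\<lambda>p. step (fst p) (fst (snd p)) (snd (snd p)))"
    unfolding step_def
    by (intro recursive_case_list recursive_comp3[OF f] rec_intros)
  have "recursive (\<lambda>z. fst (rec_nat (a z, l z) (step z) (enc (l z))))"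
    by (rule recursive_fst, rule recursive_rec_nat) (intro rec_intros recursive_enc assms st)+
  moreover have "fst (rec_nat (a z, l z) (step z) (enc (l z))) = foldl (f z) (a z) (l z)" for z
  proof -
    \<comment> \<open>\<open>rec_nat\<close> applies the last round outermost, whereas induction on
      the list splits off the first one. The exchange is possible since \<open>step\<close> ignores
      the counter.\<close>
    have Suc: "rec_nat r (step z) (Suc n) = rec_nat (step z 0 r) (step z) n" for r n
      by (induction n) (simp_all add: step_def)
    have "fst (rec_nat (b, xs) (step z) n) = foldl (f z) b xs" if "length xs \<le> n" for b xs n
      using that
    proof (induction xs arbitrary: b n)
      case Nil
      have "rec_nat (b, []) (step z) n = (b, [])" by (induction n) (simp_all add: step_def)
      then show ?case by simp
    next
      case (Cons x xs)
      then obtain m where "n = Suc m" "length xs \<le> m" by (cases n) auto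
      with Cons.IH[of m "f z b x"] show ?case by (simp only: Suc) (simp add: step_def)
    qed
    then show ?thesis by (simp add: length_le_enc)
  qed
  ultimately show ?thesis by simp
qed

lemma recursive_rev [rec_intros]: "recursive l \<Longrightarrow> recursive (\<lambda>z. rev (l z))"
proof -
  assume "recursive l"
  then have "recursive (\<lambda>z. foldl (\<lambda>a x. x # a) [] (l z))" by (intro rec_intros)
  moreover have "foldl (\<lambda>a x. x # a) b xs = rev xs @ b" for b xs :: "'b list"
    by (induction xs arbitrary: b) simp_all
  ultimately show ?thesis by simp
qed

lemma recursive_append [rec_intros]:
  "recursive l \<Longrightarrow> recursive m \<Longrightarrow> recursive (\<lambda>z. l z @ m z)"
proof -
  assume "recursive l" "recursive m"
  then have "recursive (\<lambda>z. foldl (\<lambda>a x. x # a) (m z) (rev (l z)))" by (intro rec_intros)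
  moreover have "foldl (\<lambda>a x. x # a) b (rev xs) = xs @ b" for b xs :: "'b list"
    by (induction xs arbitrary: b) simp_all
  ultimately show ?thesis by simp
qed

lemma recursive_map [rec_intros]:
  assumes f: "recursive (\<lambda>p. f (fst p) (snd p))" and l: "recursive l"
  shows "recursive (\<lambda>z. map (f z) (l z))"
proof -
  have "recursive (\<lambda>p. f (fst p) (snd (snd p)))"
    using recursive_comp[OF f, of "\<lambda>p. (fst p, snd (snd p))"] by (simp add: rec_intros)
  then have "recursive (\<lambda>z. rev (foldl (\<lambda>a x. f z x # a) [] (l z)))"
    using l by (intro rec_intros) 
  moreover have "foldl (\<lambda>a x. f z x # a) b xs = rev (map (f z) xs) @ b" for z b xs
    by (induction xs arbitrary: b) simp_all
  ultimately show ?thesis by simp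
qed

lemma recursive_concat [rec_intros]: "recursive l \<Longrightarrow> recursive (\<lambda>z. concat (l z))"
proof -
  assume "recursive l"
  then have "recursive (\<lambda>z. foldl (\<lambda>a x. a @ x) [] (l z))" by (intro rec_intros)
  moreover have "foldl (\<lambda>a x. a @ x) b xs = b @ concat xs" for b and xs :: "'b list list"
    by (induction xs arbitrary: b) simp_all
  ultimately show ?thesis by simp
qed

lemma recursive_filter [rec_intros]:
  assumes P: "decidable (\<lambda>p. P (fst p) (snd p))" and l: "recursive l"
  shows "recursive (\<lambda>z. filter (P z) (l z))"
proof -
  have "recursive (\<lambda>z. concat (map (\<lambda>x. if P z x then [x] else []) (l z)))"
    by (intro rec_intros P l)
  moreover have "concat (map (\<lambda>x. if P z x then [x] else []) xs) = filter (P z) xs" for z xs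
    by (induction xs) simp_all
  ultimately show ?thesis by simp
qed

lemma decidable_ball [rec_intros]:
  assumes P: "decidable (\<lambda>p. P (fst p) (snd p))" and l: "recursive l"
  shows "decidable (\<lambda>z. \<forall>x\<in>set (l z). P z x)"
proof -
  have "decidable (\<lambda>z. filter (\<lambda>x. \<not> P z x) (l z) = [])" by (intro rec_intros P l)
  then show ?thesis by (simp add: filter_empty_conv)
qed

lemma decidable_bex [rec_intros]:
  assumes "decidable (\<lambda>p. P (fst p) (snd p))" and "recursive l"
  shows "decidable (\<lambda>z. \<exists>x\<in>set (l z). P z x)"
  using decidable_not[OF decidable_ball[OF decidable_not[OF assms(1)] assms(2)]] by simp

lemma decidable_mem [rec_intros]:
  "recursive f \<Longrightarrow> recursive l \<Longrightarrow> decidable (\<lambda>z. f z \<in> set (l z))"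
proof -
  assume f: "recursive f" and l: "recursive l"
  have "decidable (\<lambda>z. \<exists>x\<in>set (l z). f z = x)"
    by (intro rec_intros recursive_comp[OF f] l)
  then show ?thesis by simp
qed

lemma recursive_length [rec_intros]: "recursive l \<Longrightarrow> recursive (\<lambda>z. length (l z))"
proof -
  assume "recursive l"
  then have "recursive (\<lambda>z. foldl (\<lambda>a x. Suc a) 0 (l z))" by (intro rec_intros)
  moreover have "foldl (\<lambda>a x. Suc a) b xs = b + length xs" for b and xs :: "'b list"
    by (induction xs arbitrary: b) simp_all
  ultimately show ?thesis by simp
qed

lemma recursive_upt [rec_intros]: "recursive n \<Longrightarrow> recursive (\<lambda>z. [0..<n z])"
proof -
  assume "recursive n"
  then have "recursive (\<lambda>z. rec_nat [] (\<lambda>i r. r @ [i]) (n z))" by (intro rec_intros)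
  moreover have "rec_nat [] (\<lambda>i r. r @ [i]) k = [0..<k]" for k by (induction k) simp_all
  ultimately show ?thesis by simp
qed

lemma decidable_bounded_ex [rec_intros]:
  assumes "decidable (\<lambda>p. P (fst p) (snd p))" and "recursive n"
  shows "decidable (\<lambda>z. \<exists>x<n z :: nat. P z x)"
  using decidable_bex[OF assms(1) recursive_upt[OF assms(2)]] by (simp add: Bex_def)

lemma recursive_drop [rec_intros]:
  "recursive n \<Longrightarrow> recursive l \<Longrightarrow> recursive (\<lambda>z. drop (n z) (l z))"
proof -
  assume "recursive n" "recursive l"
  then have "recursive (\<lambda>z. rec_nat (l z) (\<lambda>i r. case r of [] \<Rightarrow> [] | x # xs \<Rightarrow> xs) (n z))"
    by (intro rec_intros)
  moreover have "rec_nat xs (\<lambda>i r. case r of [] \<Rightarrow> [] | x # xs \<Rightarrow> xs) k = drop k xs" for k and xs :: "'b list"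
    by (induction k) (simp_all add: drop_Suc drop_tl split: list.split)
  ultimately show ?thesis by simp
qed

lemma recursive_take [rec_intros]:
  "recursive n \<Longrightarrow> recursive l \<Longrightarrow> recursive (\<lambda>z. take (n z) (l z))"
proof -
  assume "recursive n" "recursive l"
  then have "recursive (\<lambda>z. rev (drop (length (l z) - n z) (rev (l z))))"
    by (intro rec_intros)
  moreover have "rev (drop (length xs - k) (rev xs)) = take k xs" for k and xs :: "'b list"
    by (cases "k \<le> length xs") (simp_all add: rev_drop)
  ultimately show ?thesis by simp
qed

lemma recursive_power [rec_intros]:
  "recursive b \<Longrightarrow> recursive n \<Longrightarrow> recursive (\<lambda>z. (b z :: nat) ^ n z)"
proof -
  assume b: "recursive b" and n: "recursive n"
  have "recursive (\<lambda>z. rec_nat 1 (\<lambda>i r. r * b z) (n z))"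
    by (intro rec_intros n recursive_comp[OF b])
  moreover have "rec_nat 1 (\<lambda>i r. r * c) k = c ^ k" for k c :: nat by (induction k) simp_all
  ultimately show ?thesis by simp
qed

lemma recursive_div [rec_intros]:
  assumes a: "recursive a" and b: "recursive b" shows "recursive (\<lambda>z. (a z :: nat) div b z)"
proof -
  \<comment> \<open>The disjunct for divisor 0 keeps the search total; it then stops at 0, the value
    of division by 0.\<close>
  have "recursive (\<lambda>z. LEAST q. b z = 0 \<or> a z < Suc q * b z)"
  proof (rule recursive_Least)
    show "decidable (\<lambda>p. b (fst p) = 0 \<or> a (fst p) < Suc (snd p) * b (fst p))"
      by (intro rec_intros recursive_comp[OF a] recursive_comp[OF b])
    have "y = 0 \<or> x < Suc x * y" for x y :: nat by (cases y) simp_all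
    then show "\<exists>q. b z = 0 \<or> a z < Suc q * b z" for z by blast
  qed
  moreover have "(LEAST q. d = 0 \<or> c < Suc q * d) = c div d" for c d :: nat
  proof (cases "d = 0")
    case False
    show ?thesis
    proof (rule Least_equality)
      show "d = 0 \<or> c < Suc (c div d) * d" using False by (simp add: dividend_less_div_times)
      show "c div d \<le> q" if "d = 0 \<or> c < Suc q * d" for q
        using that False by (metis less_Suc_eq_le less_mult_imp_div_less)
    qed
  qed (simp add: Least_eq_0)
  ultimately show ?thesis by simp
qed

lemma decidable_even [rec_intros]: "recursive a \<Longrightarrow> decidable (\<lambda>z. even (a z :: nat))"
proof -
  assume "recursive a"
  then have "decidable (\<lambda>z. 2 * (a z div 2) = a z)" by (intro rec_intros)
  moreover have "2 * (n div 2) = n \<longleftrightarrow> even n" for n :: nat by presburger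
  ultimately show ?thesis by simp
qed

definition head :: "'a::enc list \<Rightarrow> 'a" where
  "head xs = (case xs of [] \<Rightarrow> dec 0 | x # _ \<Rightarrow> x)"

lemma head_Cons [simp]: "head (x # xs) = x" by (simp add: head_def)

lemma recursive_head [rec_intros]: "recursive l \<Longrightarrow> recursive (\<lambda>z. head (l z))"
  unfolding head_def by (intro rec_intros)

definition look :: "('a::enc \<times> 'b::enc) list \<Rightarrow> 'a \<Rightarrow> 'b" where
  "look T y = head (map snd (filter (\<lambda>p. fst p = y) T))"

lemma recursive_look [rec_intros]:
  assumes T: "recursive T" and y: "recursive y" shows "recursive (\<lambda>z. look (T z) (y z))"
  unfolding look_def by (intro rec_intros recursive_comp[OF y] T)

lemma look_mem: "y \<in> fst ` set T \<Longrightarrow> (y, look T y) \<in> set T"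
proof -
  assume "y \<in> fst ` set T"
  then obtain p ps where p: "filter (\<lambda>p. fst p = y) T = p # ps"
    by (cases "filter (\<lambda>p. fst p = y) T") (auto simp: filter_empty_conv)
  then have "p \<in> set (filter (\<lambda>p. fst p = y) T)" by simp
  then have "p \<in> set T" "fst p = y" by (simp_all only: set_filter mem_Collect_eq)
  then show ?thesis using p by (auto simp: look_def)
qed

text \<open>
  Recursion along an arbitrary well-founded call relation: a value is computed by searching for a
  finite table of values that is closed under recursive calls and locally correct.
\<close>
theorem recursive_wf:
  fixes f :: "'a::enc \<Rightarrow> 'b::enc" and \<mu> :: "'a \<Rightarrow> nat"
  assumes C: "recursive C" and G: "recursive (\<lambda>p. G (fst p) (snd p))"
    and f: "\<And>z. f z = G z (map f (C z))"
    and \<mu>: "\<And>z c. c \<in> set (C z) \<Longrightarrow> \<mu> c < \<mu> z"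
  shows "recursive f"
proof -
  define V where "V = (\<lambda>T :: ('a \<times> 'b) list. \<forall>p\<in>set T. (\<forall>c\<in>set (C (fst p)). c \<in> set (map fst T))
     \<and> snd p = G (fst p) (map (look T) (C (fst p))))"
  have dV: "decidable V"
    unfolding V_def
    by (intro rec_intros recursive_comp2[OF G] recursive_comp[OF C])
  \<comment> \<open>Any valid table is correct, by induction on \<mu>. The measure occurs in the
    proof only and not in the algorithm, so it may be arbitrary.\<close>
  have V: "look T z = f z" if "V T" "z \<in> set (map fst T)" for T z
    using that(2)
  proof (induction z rule: measure_induct_rule[of \<mu>])
    case (less z)
    then have "(z, look T z) \<in> set T" by (intro look_mem) simp
    then have *: "\<forall>c\<in>set (C z). c \<in> set (map fst T)" "look T z = G z (map (look T) (C z))"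
      using \<open>V T\<close> unfolding V_def by fastforce+
    have "map (look T) (C z) = map f (C z)" using *(1) less.IH \<mu> by simp
    with *(2) f show ?case by metis
  qed
  \<comment> \<open>The invariant records true values instead of \<open>V\<close>: it survives
    concatenation of the tables of all calls, even if these list an argument repeatedly.\<close>
  have ex: "\<exists>T. (\<forall>p\<in>set T. snd p = f (fst p) \<and> set (C (fst p)) \<subseteq> set (map fst T)) \<and> z \<in> set (map fst T)" for z
  proof (induction z rule: measure_induct_rule[of \<mu>])
    case (less z)
    then have "\<forall>c\<in>set (C z). \<exists>T. (\<forall>p\<in>set T. snd p = f (fst p) \<and> set (C (fst p)) \<subseteq> set (map fst T)) \<and> c \<in> set (map fst T)"
      using \<mu> by blast
    then obtain T where T: "\<And>c. c \<in> set (C z) \<Longrightarrow>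
        (\<forall>p\<in>set (T c). snd p = f (fst p) \<and> set (C (fst p)) \<subseteq> set (map fst (T c))) \<and> c \<in> set (map fst (T c))"
      by metis
    show ?case
    proof (intro exI[of _ "(z, f z) # concat (map T (C z))"] conjI ballI)
      fix p assume "p \<in> set ((z, f z) # concat (map T (C z)))"
      then consider "p = (z, f z)" | c where "c \<in> set (C z)" "p \<in> set (T c)" by auto
      then show "snd p = f (fst p)"
        by cases (use T in auto)
      from \<open>p \<in> _\<close> consider "p = (z, f z)" | c where "c \<in> set (C z)" "p \<in> set (T c)" by auto
      then show "set (C (fst p)) \<subseteq> set (map fst ((z, f z) # concat (map T (C z))))"
        by cases (use T in \<open>fastforce+\<close>)
    qed simp
  qed
  have ex': "\<exists>n. V (dec n) \<and> z \<in> set (map fst (dec n :: ('a \<times> 'b) list))" for z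
  proof -
    obtain T where T: "\<forall>p\<in>set T. snd p = f (fst p) \<and> set (C (fst p)) \<subseteq> set (map fst T)" "z \<in> set (map fst T)"
      using ex by blast
    have l: "look T y = f y" if "y \<in> set (map fst T)" for y
      using look_mem[of y T] that T(1) by fastforce
    have "V T" unfolding V_def
    proof (intro ballI conjI)
      fix p assume p: "p \<in> set T"
      show "c \<in> set (map fst T)" if "c \<in> set (C (fst p))" for c using T(1) p that by blast
      have "map (look T) (C (fst p)) = map f (C (fst p))"
        using l T(1) p by (intro map_cong) blast+
      then show "snd p = G (fst p) (map (look T) (C (fst p)))" using T(1) p f by metis
    qed
    then show ?thesis using T(2) by (intro exI[of _ "enc T"]) simp
  qed
  have "recursive (\<lambda>z. look (dec (LEAST n. V (dec n) \<and> z \<in> set (map fst (dec n :: ('a \<times> 'b) list)))) z :: 'b)"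
    by (intro recursive_look recursive_dec recursive_Least ex' rec_intros decidable_comp[OF dV])
  moreover have "look (dec (LEAST n. V (dec n) \<and> z \<in> set (map fst (dec n :: ('a \<times> 'b) list)))) z = f z" for z
    using LeastI_ex[OF ex'[of z]] V by blast
  ultimately show ?thesis by simp
qed

section \<open>Finite sets of numbers as binary codes\<close>

lemma decidable_set_decode [rec_intros]:
  "recursive x \<Longrightarrow> recursive a \<Longrightarrow> decidable (\<lambda>z. x z \<in> set_decode (a z))"
  unfolding set_decode_def mem_Collect_eq by (intro rec_intros)

definition elems :: "nat \<Rightarrow> nat list" where
  "elems a = filter (\<lambda>x. x \<in> set_decode a) [0..<a]"

lemma set_decode_less: "x \<in> set_decode a \<Longrightarrow> x < a"
proof -
  assume "x \<in> set_decode a"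
  then have "odd (a div 2 ^ x)" by (simp add: set_decode_def)
  then have "a div 2 ^ x \<noteq> 0" by (rule contrapos_nn) simp
  then have "2 ^ x \<le> a" by (simp add: div_eq_0_iff)
  then show ?thesis using less_exp[of x] by linarith
qed

lemma set_elems [simp]: "set (elems a) = set_decode a"
  by (auto simp: elems_def set_decode_less)

lemma recursive_elems [rec_intros]: 
  assumes a: "recursive a" shows "recursive (\<lambda>z. elems (a z))"
  unfolding elems_def by (intro rec_intros recursive_comp[OF a])

lemma recursive_set_encode [rec_intros]:
  "recursive l \<Longrightarrow> recursive (\<lambda>z. set_encode (set (l z)))"
proof -
  assume l: "recursive l"
  have "recursive (\<lambda>z. foldl (\<lambda>a x. if x \<in> set_decode a then a else 2 ^ x + a) 0 (l z))"
    by (intro rec_intros l)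
  moreover have "foldl (\<lambda>a x. if x \<in> set_decode a then a else 2 ^ x + a) (set_encode A) xs = set_encode (A \<union> set xs)"
    if "finite A" for A xs using that
  proof (induction xs arbitrary: A)
    case (Cons x xs)
    have "(if x \<in> set_decode (set_encode A) then set_encode A else 2 ^ x + set_encode A) = set_encode (insert x A)"
      using Cons.prems by (simp add: insert_absorb)
    with Cons.IH[of "insert x A"] Cons.prems show ?case by simp
  qed simp
  from this[of "{}"] have "foldl (\<lambda>a x. if x \<in> set_decode a then a else 2 ^ x + a) 0 xs = set_encode (set xs)" for xs
    by simp
  ultimately show ?thesis by simp
qed

subsection \<open>Types of factors of a word\<close>

abbreviation pr :: "nat \<Rightarrow> nat \<Rightarrow> nat" where "pr a b \<equiv> prod_encode (a, b)"
abbreviation lft :: "nat \<Rightarrow> nat" where "lft a \<equiv> fst (prod_decode a)"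
abbreviation rgt :: "nat \<Rightarrow> nat" where "rgt a \<equiv> snd (prod_decode a)"

text \<open>
  \<open>tp \<phi> x I V D\<close> is the \<open>\<phi>\<close>-type of the factor of the word on the set \<open>D\<close> of positions, where a
  first-order variable \<open>p\<close> is interpreted by a set \<open>I p\<close> of positions.
\<close>
primrec tp :: "mso \<Rightarrow> (nat \<Rightarrow> int) \<Rightarrow> (nat \<Rightarrow> nat set) \<Rightarrow> (nat \<Rightarrow> nat set) \<Rightarrow> nat set \<Rightarrow> nat" where
  "tp (Succ p q) x I V D = pr (of_bool (\<exists>i\<in>D. i \<in> I q \<and> (\<forall>j\<in>D. i \<le> j)))
     (pr (of_bool (\<exists>i\<in>D. i \<in> I p \<and> (\<forall>j\<in>D. j \<le> i)))
       (of_bool (\<exists>i\<in>D. i \<in> I p \<and> Suc i \<in> D \<and> Suc i \<in> I q)))"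
| "tp (Less p q) x I V D = pr (of_bool (\<exists>i\<in>D. i \<in> I p)) (pr (of_bool (\<exists>i\<in>D. i \<in> I q))
       (of_bool (\<exists>i\<in>D. \<exists>j\<in>D. i < j \<and> i \<in> I p \<and> j \<in> I q)))"
| "tp (Eq p q) x I V D = of_bool (\<exists>i\<in>D. i \<in> I p \<and> i \<in> I q)"
| "tp (Sym p a) x I V D = of_bool (\<exists>i\<in>D. i \<in> I p \<and> x i = a)"
| "tp (Mem P p) x I V D = of_bool (\<exists>i\<in>D. i \<in> I p \<and> i \<in> V P)"
| "tp (Neg \<phi>) x I V D = tp \<phi> x I V D"
| "tp (Conj \<phi> \<psi>) x I V D = pr (tp \<phi> x I V D) (tp \<psi> x I V D)"
| "tp (Disj \<phi> \<psi>) x I V D = pr (tp \<phi> x I V D) (tp \<psi> x I V D)"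
| "tp (Impl \<phi> \<psi>) x I V D = pr (tp \<phi> x I V D) (tp \<psi> x I V D)"
| "tp (ExI p \<phi>) x I V D = pr (set_encode ((\<lambda>n. tp \<phi> x (I(p := {n})) V D) ` D)) (tp \<phi> x (I(p := {})) V D)"
| "tp (AllI p \<phi>) x I V D = pr (set_encode ((\<lambda>n. tp \<phi> x (I(p := {n})) V D) ` D)) (tp \<phi> x (I(p := {})) V D)"
| "tp (ExS P \<phi>) x I V D = set_encode (range (\<lambda>M. tp \<phi> x I (V(P := M)) D))"
| "tp (AllS P \<phi>) x I V D = set_encode (range (\<lambda>M. tp \<phi> x I (V(P := M)) D))"

text \<open>For \<open>Succ\<close> the bits mean: q at the first position, p at the last position,
  an adjacent pair inside; a pair across the cut is p last on the left and q first on the right. For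
  individual quantifiers the left component collects the types with the variable inside the factor,
  the right one is the type with the variable elsewhere. A set splits into independent choices on
  both parts, hence all combinations for set quantifiers.\<close>

primrec mult :: "mso \<Rightarrow> nat \<Rightarrow> nat \<Rightarrow> nat" where
  "mult (Succ p q) a b = pr (lft a) (pr (lft (rgt b))
     (max (max (rgt (rgt a)) (rgt (rgt b))) (lft (rgt a) * lft b)))"
| "mult (Less p q) a b = pr (max (lft a) (lft b)) (pr (max (lft (rgt a)) (lft (rgt b)))
     (max (max (rgt (rgt a)) (rgt (rgt b))) (lft a * lft (rgt b))))"
| "mult (Eq p q) a b = max a b"
| "mult (Sym p c) a b = max a b"
| "mult (Mem P p) a b = max a b"
| "mult (Neg \<phi>) a b = mult \<phi> a b"
| "mult (Conj \<phi> \<psi>) a b = pr (mult \<phi> (lft a) (lft b)) (mult \<psi> (rgt a) (rgt b))"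
| "mult (Disj \<phi> \<psi>) a b = pr (mult \<phi> (lft a) (lft b)) (mult \<psi> (rgt a) (rgt b))"
| "mult (Impl \<phi> \<psi>) a b = pr (mult \<phi> (lft a) (lft b)) (mult \<psi> (rgt a) (rgt b))"
| "mult (ExI p \<phi>) a b = pr (set_encode ((\<lambda>s. mult \<phi> s (rgt b)) ` set_decode (lft a)
       \<union> (\<lambda>t. mult \<phi> (rgt a) t) ` set_decode (lft b))) (mult \<phi> (rgt a) (rgt b))"
| "mult (AllI p \<phi>) a b = pr (set_encode ((\<lambda>s. mult \<phi> s (rgt b)) ` set_decode (lft a)
       \<union> (\<lambda>t. mult \<phi> (rgt a) t) ` set_decode (lft b))) (mult \<phi> (rgt a) (rgt b))"
| "mult (ExS P \<phi>) a b = set_encode ((\<lambda>(s, t). mult \<phi> s t) ` (set_decode a \<times> set_decode b))"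
| "mult (AllS P \<phi>) a b = set_encode ((\<lambda>(s, t). mult \<phi> s t) ` (set_decode a \<times> set_decode b))"

text \<open>The type of an infinite product of factors of the same idempotent type.\<close>
primrec omega :: "mso \<Rightarrow> nat \<Rightarrow> nat" where
  "omega (Succ p q) e = pr (lft e) (pr 0 (rgt (rgt e)))"
| "omega (Less p q) e = e"
| "omega (Eq p q) e = e"
| "omega (Sym p c) e = e"
| "omega (Mem P p) e = e"
| "omega (Neg \<phi>) e = omega \<phi> e"
| "omega (Conj \<phi> \<psi>) e = pr (omega \<phi> (lft e)) (omega \<psi> (rgt e))"
| "omega (Disj \<phi> \<psi>) e = pr (omega \<phi> (lft e)) (omega \<psi> (rgt e))"
| "omega (Impl \<phi> \<psi>) e = pr (omega \<phi> (lft e)) (omega \<psi> (rgt e))"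
| "omega (ExI p \<phi>) e = pr (set_encode ((\<lambda>s. mult \<phi> s (omega \<phi> (rgt e))) ` set_decode (lft e))) (omega \<phi> (rgt e))"
| "omega (AllI p \<phi>) e = pr (set_encode ((\<lambda>s. mult \<phi> s (omega \<phi> (rgt e))) ` set_decode (lft e))) (omega \<phi> (rgt e))"
| "omega (ExS P \<phi>) e = set_encode ((\<lambda>(s, t). mult \<phi> s (omega \<phi> t)) ` (set_decode e \<times> {t \<in> set_decode e. mult \<phi> t t = t}))"
| "omega (AllS P \<phi>) e = set_encode ((\<lambda>(s, t). mult \<phi> s (omega \<phi> t)) ` (set_decode e \<times> {t \<in> set_decode e. mult \<phi> t t = t}))"

text \<open>Meant for the type of the whole word. Of an individual quantifier only the left
  component counts, since in a valuation the variable does have a position.\<close>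

primrec acc :: "mso \<Rightarrow> nat \<Rightarrow> bool" where
  "acc (Succ p q) t = (rgt (rgt t) = 1)"
| "acc (Less p q) t = (rgt (rgt t) = 1)"
| "acc (Eq p q) t = (t = 1)"
| "acc (Sym p c) t = (t = 1)"
| "acc (Mem P p) t = (t = 1)"
| "acc (Neg \<phi>) t = (\<not> acc \<phi> t)"
| "acc (Conj \<phi> \<psi>) t = (acc \<phi> (lft t) \<and> acc \<psi> (rgt t))"
| "acc (Disj \<phi> \<psi>) t = (acc \<phi> (lft t) \<or> acc \<psi> (rgt t))"
| "acc (Impl \<phi> \<psi>) t = (acc \<phi> (lft t) \<longrightarrow> acc \<psi> (rgt t))"
| "acc (ExI p \<phi>) t = (\<exists>s\<in>set_decode (lft t). acc \<phi> s)"
| "acc (AllI p \<phi>) t = (\<forall>s\<in>set_decode (lft t). acc \<phi> s)"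
| "acc (ExS P \<phi>) t = (\<exists>s\<in>set_decode t. acc \<phi> s)"
| "acc (AllS P \<phi>) t = (\<forall>s\<in>set_decode t. acc \<phi> s)"

section \<open>Finiteness, locality and multiplicativity of types\<close>

definition types :: "mso \<Rightarrow> nat set" where
  "types \<phi> = {tp \<phi> x I V D | x I V D. True}"

lemma tp_in_types [simp]: "tp \<phi> x I V D \<in> types \<phi>"
  unfolding types_def by blast

lemma finite_pr: "finite A \<Longrightarrow> finite B \<Longrightarrow> finite {pr a b | a b. a \<in> A \<and> b \<in> B}"
  by (rule finite_subset[of _ "prod_encode ` (A \<times> B)"]) auto

text \<open>Types of quantified formulas are built from codes of subsets of the types of the body.
  Finiteness keeps \<open>set_encode\<close> invertible on the sets that occur, and it gives
  Ramsey's theorem finitely many colours.\<close>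

lemma finite_types: "finite (types \<phi>)"
proof (induction \<phi>)
  have b: "finite {0, 1 :: nat}" by simp
  have 1: "finite (types \<phi>)" if "\<And>x I V D. tp \<phi> x I V D \<in> {0, 1}" for \<phi>
  proof (rule finite_subset[OF _ b])
    show "types \<phi> \<subseteq> {0, 1}"
    proof
      fix t assume "t \<in> types \<phi>"
      then obtain x I V D where "t = tp \<phi> x I V D" by (auto simp: types_def)
      with that[of x I V D] show "t \<in> {0, 1}" by simp
    qed
  qed
  have 3: "finite (types \<phi>)" if three: "\<And>x I V D. \<exists>b c d. tp \<phi> x I V D = pr (of_bool b) (pr (of_bool c) (of_bool d))" for \<phi>
  proof (rule finite_subset[OF _ finite_pr[OF b finite_pr[OF b b]]])
    show "types \<phi> \<subseteq> {pr a c |a c. a \<in> {0, 1} \<and> c \<in> {pr a c |a c. a \<in> {0, 1} \<and> c \<in> {0, 1}}}"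
    proof
      fix t assume "t \<in> types \<phi>"
      then obtain x I V D where t: "t = tp \<phi> x I V D" by (auto simp: types_def)
      obtain b c d where "tp \<phi> x I V D = pr (of_bool b) (pr (of_bool c) (of_bool d))" using three by blast
      then show "t \<in> {pr a c |a c. a \<in> {0, 1} \<and> c \<in> {pr a c |a c. a \<in> {0, 1} \<and> c \<in> {0, 1}}}"
        unfolding t by (intro CollectI exI conjI) auto
    qed
  qed
  have 2: "finite (types \<theta>)" if "finite (types \<phi>)" "finite (types \<psi>)"
    "\<And>x I V D. tp \<theta> x I V D = pr (tp \<phi> x I V D) (tp \<psi> x I V D)" for \<phi> \<psi> \<theta>
    by (rule finite_subset[OF _ finite_pr[OF that(1,2)]]) (auto simp: that(3) types_def[of \<theta>])
  have I: "finite (types \<theta>)" if "finite (types \<phi>)"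
    "\<And>x I V D. tp \<theta> x I V D = pr (set_encode ((\<lambda>n. tp \<phi> x (I(p := {n})) V D) ` D)) (tp \<phi> x (I(p := {})) V D)" for \<phi> \<theta> p
    by (rule finite_subset[OF _ finite_pr[OF finite_imageI[of "Pow (types \<phi>)" set_encode] that(1)]])
      (use that in \<open>auto simp: types_def[of \<theta>] intro!: imageI\<close>)
  have S: "finite (types \<theta>)" if "finite (types \<phi>)"
    "\<And>x I V D. tp \<theta> x I V D = set_encode (range (\<lambda>M. tp \<phi> x I (V(P := M)) D))" for \<phi> \<theta> P
    by (rule finite_subset[OF _ finite_imageI[of "Pow (types \<phi>)" set_encode]])
      (use that in \<open>auto simp: types_def[of \<theta>] intro!: imageI\<close>)
  { case (Succ p q) show ?case by (rule 3) auto }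
  { case (Less p q) show ?case by (rule 3) auto }
  { case (Eq p q) show ?case by (rule 1) auto }
  { case (Sym p q) show ?case by (rule 1) auto }
  { case (Mem p q) show ?case by (rule 1) auto }
  { case (Neg \<phi>) then show ?case by (simp add: types_def) }
  { case (Conj \<phi> \<psi>) then show ?case by (rule 2) simp }
  { case (Disj \<phi> \<psi>) then show ?case by (rule 2) simp }
  { case (Impl \<phi> \<psi>) then show ?case by (rule 2) simp }
  { case (ExI p \<phi>) then show ?case by (rule I) simp }
  { case (AllI p \<phi>) then show ?case by (rule I) simp }
  { case (ExS p \<phi>) then show ?case by (rule S) simp }
  { case (AllS p \<phi>) then show ?case by (rule S) simp }
qed

lemma finite_tp_image: "finite ((\<lambda>k. tp \<phi> (x k) (I k) (V k) (D k)) ` A)"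
  by (rule finite_subset[OF _ finite_types[of \<phi>]]) auto

lemma set_decode_tps [simp]:
  "set_decode (set_encode ((\<lambda>k. tp \<phi> (x k) (I k) (V k) (D k)) ` A)) = (\<lambda>k. tp \<phi> (x k) (I k) (V k) (D k)) ` A"
  by (rule set_encode_inverse[OF finite_tp_image])

lemma tp_cong:
  assumes "\<And>n. n \<in> D \<Longrightarrow> x n = y n" "\<And>n p. n \<in> D \<Longrightarrow> n \<in> I p \<longleftrightarrow> n \<in> J p"
    "\<And>n P. n \<in> D \<Longrightarrow> n \<in> V P \<longleftrightarrow> n \<in> W P"
  shows "tp \<phi> x I V D = tp \<phi> y J W D"
  using assms
proof (induction \<phi> arbitrary: I J V W)
  case (ExI p \<phi>)
  have "tp \<phi> x (I(p := A)) V D = tp \<phi> y (J(p := A)) W D" for A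
    by (rule ExI.IH) (use ExI.prems in auto)
  then show ?case by simp
next
  case (AllI p \<phi>)
  have "tp \<phi> x (I(p := A)) V D = tp \<phi> y (J(p := A)) W D" for A
    by (rule AllI.IH) (use AllI.prems in auto)
  then show ?case by simp
next
  case (ExS P \<phi>)
  have "tp \<phi> x I (V(P := A)) D = tp \<phi> y J (W(P := A)) D" for A
    by (rule ExS.IH) (use ExS.prems in auto)
  then show ?case by simp
next
  case (AllS P \<phi>)
  have "tp \<phi> x I (V(P := A)) D = tp \<phi> y J (W(P := A)) D" for A
    by (rule AllS.IH) (use AllS.prems in auto)
  then show ?case by simp
next
  case (Conj \<phi> \<psi>)
  show ?case using Conj.IH(1)[OF Conj.prems] Conj.IH(2)[OF Conj.prems] by simp
next
  case (Disj \<phi> \<psi>)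
  show ?case using Disj.IH(1)[OF Disj.prems] Disj.IH(2)[OF Disj.prems] by simp
next
  case (Impl \<phi> \<psi>)
  show ?case using Impl.IH(1)[OF Impl.prems] Impl.IH(2)[OF Impl.prems] by simp
next
  case (Neg \<phi>)
  show ?case using Neg.IH[OF Neg.prems] by simp
qed (auto cong: bex_cong conj_cong)

text \<open>Only the last position on the left and the first on the right are prescribed, so that
  finite and infinite right parts are covered alike.\<close>

definition adj :: "nat set \<Rightarrow> nat set \<Rightarrow> bool" where
  "adj D E \<longleftrightarrow> (\<exists>j. D \<subseteq> {..j} \<and> j \<in> D \<and> E \<subseteq> {Suc j..} \<and> Suc j \<in> E)"

lemma of_bool_max: "max (of_bool P) (of_bool Q) = (of_bool (P \<or> Q) :: nat)" by simp

text \<open>An individual variable lies in one of the two parts and has an empty interpretation in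
  the other one; this is why \<open>tp\<close> records the empty case separately.\<close>

lemma mult_tp_I:
  assumes IH: "\<And>I. tp \<phi> x I V (D \<union> E) = mult \<phi> (tp \<phi> x I V D) (tp \<phi> x I V E)"
    and disj: "D \<inter> E = {}"
  shows "tp (ExI p \<phi>) x I V (D \<union> E) = mult (ExI p \<phi>) (tp (ExI p \<phi>) x I V D) (tp (ExI p \<phi>) x I V E)"
proof -
  have *: "tp \<phi> x (I(p := {n})) V F = tp \<phi> x (I(p := {})) V F" if "n \<notin> F" for n F
    by (rule tp_cong) (use that in auto)
  have "tp \<phi> x (I(p := {n})) V (D \<union> E) = mult \<phi> (tp \<phi> x (I(p := {n})) V D) (tp \<phi> x (I(p := {})) V E)"
    if "n \<in> D" for n
  proof -
    have "n \<notin> E" using that disj by blast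
    from *[OF this] show ?thesis by (simp add: IH)
  qed
  moreover have "tp \<phi> x (I(p := {n})) V (D \<union> E) = mult \<phi> (tp \<phi> x (I(p := {})) V D) (tp \<phi> x (I(p := {n})) V E)"
    if "n \<in> E" for n
  proof -
    have "n \<notin> D" using that disj by blast
    from *[OF this] show ?thesis by (simp add: IH)
  qed
  ultimately have "(\<lambda>n. tp \<phi> x (I(p := {n})) V (D \<union> E)) ` (D \<union> E)
     = (\<lambda>n. mult \<phi> (tp \<phi> x (I(p := {n})) V D) (tp \<phi> x (I(p := {})) V E)) ` D
     \<union> (\<lambda>n. mult \<phi> (tp \<phi> x (I(p := {})) V D) (tp \<phi> x (I(p := {n})) V E)) ` E"
    unfolding image_Un by (intro arg_cong2[of _ _ _ _ "(\<union>)"] image_cong) auto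
  then show ?thesis by (simp add: image_image IH)
qed

text \<open>A set chosen on \<open>D\<close> and a set chosen on \<open>E\<close> glue to a single
  set, so every product of types occurs.\<close>

lemma mult_tp_S:
  assumes IH: "\<And>V. tp \<phi> x I V (D \<union> E) = mult \<phi> (tp \<phi> x I V D) (tp \<phi> x I V E)"
    and disj: "D \<inter> E = {}"
  shows "tp (ExS P \<phi>) x I V (D \<union> E) = mult (ExS P \<phi>) (tp (ExS P \<phi>) x I V D) (tp (ExS P \<phi>) x I V E)"
proof -
  have "range (\<lambda>M. tp \<phi> x I (V(P := M)) (D \<union> E)) =
    (\<lambda>(s, t). mult \<phi> s t) ` (range (\<lambda>M. tp \<phi> x I (V(P := M)) D) \<times> range (\<lambda>M. tp \<phi> x I (V(P := M)) E))"
    (is "?A = ?B")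
  proof
    show "?A \<subseteq> ?B" by (auto simp: IH)
    show "?B \<subseteq> ?A"
    proof
      fix t assume "t \<in> ?B"
      then obtain M N where t: "t = mult \<phi> (tp \<phi> x I (V(P := M)) D) (tp \<phi> x I (V(P := N)) E)" by auto
      have "tp \<phi> x I (V(P := M)) D = tp \<phi> x I (V(P := M \<inter> D \<union> N \<inter> E)) D"
        by (rule tp_cong) (use disj in auto)
      moreover have "tp \<phi> x I (V(P := N)) E = tp \<phi> x I (V(P := M \<inter> D \<union> N \<inter> E)) E"
        by (rule tp_cong) (use disj in auto)
      ultimately have "t = tp \<phi> x I (V(P := M \<inter> D \<union> N \<inter> E)) (D \<union> E)" by (simp add: t IH)
      then show "t \<in> ?A" by blast
    qed
  qed
  then show ?thesis by simp
qed

text \<open>Only \<open>Succ\<close> and \<open>Less\<close> relate positions across the cut, and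
  the additional bits in their types (first, last, some position) are exactly what such a pair
  requires.\<close>

theorem tp_mult:
  assumes "adj D E"
  shows "tp \<phi> x I V (D \<union> E) = mult \<phi> (tp \<phi> x I V D) (tp \<phi> x I V E)"
proof -
  obtain j where j: "\<And>i. i \<in> D \<Longrightarrow> i \<le> j" "j \<in> D" "\<And>i. i \<in> E \<Longrightarrow> Suc j \<le> i" "Suc j \<in> E"
    using assms unfolding adj_def by auto
  have disj: "D \<inter> E = {}" using j by fastforce
  have lt: "a < b" if "a \<in> D" "b \<in> E" for a b using j that by fastforce
  show ?thesis
  proof (induction \<phi> arbitrary: I V)
    case (Succ p q)
    have first: "(\<exists>i\<in>D \<union> E. i \<in> I q \<and> (\<forall>k\<in>D \<union> E. i \<le> k)) \<longleftrightarrow> (\<exists>i\<in>D. i \<in> I q \<and> (\<forall>k\<in>D. i \<le> k))"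
    proof -
      have "i \<in> D" if "i \<in> D \<union> E" "\<forall>k\<in>D \<union> E. i \<le> k" for i
      proof -
        have "i \<le> j" using that(2) j(2) by blast
        then show ?thesis using that(1) j(3)[of i] by auto
      qed
      moreover have "i \<le> k" if "i \<in> D" "k \<in> E" for i k using lt[OF that] by simp
      ultimately show ?thesis by blast
    qed
    have last: "(\<exists>i\<in>D \<union> E. i \<in> I p \<and> (\<forall>k\<in>D \<union> E. k \<le> i)) \<longleftrightarrow> (\<exists>i\<in>E. i \<in> I p \<and> (\<forall>k\<in>E. k \<le> i))"
    proof -
      have "i \<in> E" if "i \<in> D \<union> E" "\<forall>k\<in>D \<union> E. k \<le> i" for i
      proof -
        have "Suc j \<le> i" using that(2) j(4) by blast
        then show ?thesis using that(1) j(1)[of i] by auto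
      qed
      moreover have "k \<le> i" if "i \<in> E" "k \<in> D" for i k using lt[OF that(2,1)] by simp
      ultimately show ?thesis by blast
    qed
    have cross: "a = j \<and> b = Suc j" if "a \<in> D" "b \<in> E" "b = Suc a" for a b
      using j(1)[OF that(1)] j(3)[OF that(2)] that(3) by simp
    have fE: "(\<exists>i\<in>E. i \<in> I q \<and> (\<forall>k\<in>E. i \<le> k)) \<longleftrightarrow> Suc j \<in> I q"
      using j(3,4) by (metis le_antisym)
    have lD: "(\<exists>i\<in>D. i \<in> I p \<and> (\<forall>k\<in>D. k \<le> i)) \<longleftrightarrow> j \<in> I p"
      using j(1,2) by (metis le_antisym)
    have "(\<exists>i\<in>D \<union> E. i \<in> I p \<and> Suc i \<in> D \<union> E \<and> Suc i \<in> I q) \<longleftrightarrow>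
      ((\<exists>i\<in>D. i \<in> I p \<and> Suc i \<in> D \<and> Suc i \<in> I q) \<or> (\<exists>i\<in>E. i \<in> I p \<and> Suc i \<in> E \<and> Suc i \<in> I q))
      \<or> (j \<in> I p \<and> Suc j \<in> I q)" (is "?l \<longleftrightarrow> ?r")
    proof
      assume ?l
      then obtain i where i: "i \<in> D \<union> E" "i \<in> I p" "Suc i \<in> D \<union> E" "Suc i \<in> I q" by blast
      show ?r
      proof (cases "i \<in> D")
        case True
        then show ?thesis using i cross[of i "Suc i"] by blast
      next
        case False
        then have "i \<in> E" using i by blast
        moreover have "Suc i \<notin> D" using lt[of "Suc i" i] \<open>i \<in> E\<close> by auto
        ultimately show ?thesis using i by blast
      qed
    next
      assume ?r
      then show ?l using j(2,4) by auto
    qed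
    then show ?case
      unfolding tp.simps mult.simps first last fE lD prod_encode_inverse fst_conv snd_conv
        of_bool_max of_bool_conj[symmetric] by (simp only:)
  next
    case (Less p q)
    have "(\<exists>a\<in>D \<union> E. \<exists>b\<in>D \<union> E. a < b \<and> a \<in> I p \<and> b \<in> I q) \<longleftrightarrow>
      ((\<exists>a\<in>D. \<exists>b\<in>D. a < b \<and> a \<in> I p \<and> b \<in> I q) \<or> (\<exists>a\<in>E. \<exists>b\<in>E. a < b \<and> a \<in> I p \<and> b \<in> I q))
      \<or> ((\<exists>a\<in>D. a \<in> I p) \<and> (\<exists>b\<in>E. b \<in> I q))"
    proof -
      have no: "\<not> a < b" if "a \<in> E" "b \<in> D" for a b using lt[OF that(2,1)] by simp
      show ?thesis
      proof (intro iffI)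
        assume "\<exists>a\<in>D \<union> E. \<exists>b\<in>D \<union> E. a < b \<and> a \<in> I p \<and> b \<in> I q"
        then obtain a b where "a \<in> D \<union> E" "b \<in> D \<union> E" "a < b" "a \<in> I p" "b \<in> I q" by blast
        then show "((\<exists>a\<in>D. \<exists>b\<in>D. a < b \<and> a \<in> I p \<and> b \<in> I q)
            \<or> (\<exists>a\<in>E. \<exists>b\<in>E. a < b \<and> a \<in> I p \<and> b \<in> I q)) \<or> ((\<exists>a\<in>D. a \<in> I p) \<and> (\<exists>b\<in>E. b \<in> I q))"
          using no[of a b] by blast
      next
        assume "((\<exists>a\<in>D. \<exists>b\<in>D. a < b \<and> a \<in> I p \<and> b \<in> I q)
            \<or> (\<exists>a\<in>E. \<exists>b\<in>E. a < b \<and> a \<in> I p \<and> b \<in> I q)) \<or> ((\<exists>a\<in>D. a \<in> I p) \<and> (\<exists>b\<in>E. b \<in> I q))"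
        then have "\<exists>a b. a \<in> D \<union> E \<and> b \<in> D \<union> E \<and> a < b \<and> a \<in> I p \<and> b \<in> I q"
        proof (elim disjE)
          assume "(\<exists>a\<in>D. a \<in> I p) \<and> (\<exists>b\<in>E. b \<in> I q)"
          then obtain a b where "a \<in> D" "a \<in> I p" "b \<in> E" "b \<in> I q" by blast
          then show ?thesis using lt[of a b] by blast
        qed blast+
        then show "\<exists>a\<in>D \<union> E. \<exists>b\<in>D \<union> E. a < b \<and> a \<in> I p \<and> b \<in> I q" by blast
      qed
    qed
    then show ?case
      unfolding tp.simps mult.simps prod_encode_inverse fst_conv snd_conv
        of_bool_max of_bool_conj[symmetric] bex_Un[of D E "\<lambda>i. i \<in> _"] by (simp only:)
  next
    case (ExI p \<phi>)
    show ?case by (rule mult_tp_I[OF ExI.IH disj])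
  next
    case (AllI p \<phi>)
    show ?case using mult_tp_I[OF AllI.IH disj] by simp
  next
    case (ExS p \<phi>)
    show ?case by (rule mult_tp_S[OF ExS.IH disj])
  next
    case (AllS p \<phi>)
    show ?case using mult_tp_S[OF AllS.IH disj] by simp
  qed (auto simp: bex_Un)
qed

text \<open>The condition concerns free variables only. For a sentence all variables may therefore
  be interpreted by the empty set, which is how \<open>wtp\<close> is used.\<close>

lemma acc_tp:
  assumes "\<And>p. p \<in> free_ind \<phi> \<Longrightarrow> I p = {v p}"
  shows "sat x v V \<phi> \<longleftrightarrow> acc \<phi> (tp \<phi> x I V {0..})"
  using assms
proof (induction \<phi> arbitrary: v V I)
  case (ExI p \<phi>)
  have "sat x (v(p := n)) V \<phi> \<longleftrightarrow> acc \<phi> (tp \<phi> x (I(p := {n})) V {0..})" for n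
    by (rule ExI.IH) (use ExI.prems in auto)
  then show ?case by simp
next
  case (AllI p \<phi>)
  have "sat x (v(p := n)) V \<phi> \<longleftrightarrow> acc \<phi> (tp \<phi> x (I(p := {n})) V {0..})" for n
    by (rule AllI.IH) (use AllI.prems in auto)
  then show ?case by simp
next
  case (ExS P \<phi>)
  have "sat x v (V(P := M)) \<phi> \<longleftrightarrow> acc \<phi> (tp \<phi> x I (V(P := M)) {0..})" for M
    by (rule ExS.IH) (use ExS.prems in auto)
  then show ?case by simp
next
  case (AllS P \<phi>)
  have "sat x v (V(P := M)) \<phi> \<longleftrightarrow> acc \<phi> (tp \<phi> x I (V(P := M)) {0..})" for M
    by (rule AllS.IH) (use AllS.prems in auto)
  then show ?case by simp
next
  case (Neg \<phi>)
  show ?case using Neg.IH[of I v V] Neg.prems by simp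
next
  case (Conj \<phi> \<psi>)
  show ?case using Conj.IH(1)[of I v V] Conj.IH(2)[of I v V] Conj.prems by simp
next
  case (Disj \<phi> \<psi>)
  show ?case using Disj.IH(1)[of I v V] Disj.IH(2)[of I v V] Disj.prems by simp
next
  case (Impl \<phi> \<psi>)
  show ?case using Impl.IH(1)[of I v V] Impl.IH(2)[of I v V] Impl.prems by simp
qed auto

subsection \<open>Infinite products of factors\<close>

lemma adj_fin: "i < j \<Longrightarrow> j < k \<Longrightarrow> adj {i..<j} {j..<k}"
  unfolding adj_def by (rule exI[of _ "j - 1"]) auto

lemma adj_inf: "i < j \<Longrightarrow> adj {i..<j} {j..}"
  unfolding adj_def by (rule exI[of _ "j - 1"]) auto

lemma tp_split_fin: "i < j \<Longrightarrow> j < k \<Longrightarrow> tp \<phi> x I V {i..<k} = mult \<phi> (tp \<phi> x I V {i..<j}) (tp \<phi> x I V {j..<k})"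
  using tp_mult[OF adj_fin] by (simp add: ivl_disj_un_two(3))

lemma tp_split_inf: "i < j \<Longrightarrow> tp \<phi> x I V {i..} = mult \<phi> (tp \<phi> x I V {i..<j}) (tp \<phi> x I V {j..})"
  using tp_mult[OF adj_inf] by (simp add: ivl_disj_un_one(8))

lemma tp_blocks:
  assumes c: "strict_mono c" and b: "\<And>k. tp \<phi> x I V {c k..<c (Suc k)} = e" and e: "mult \<phi> e e = e"
    and "i < j"
  shows "tp \<phi> x I V {c i..<c j} = e"
proof -
  have "tp \<phi> x I V {c i..<c (Suc i + d)} = e" for d
  proof (induction d)
    case (Suc d)
    have "tp \<phi> x I V {c i..<c (Suc i + Suc d)}
      = mult \<phi> (tp \<phi> x I V {c i..<c (Suc i + d)}) (tp \<phi> x I V {c (Suc i + d)..<c (Suc i + Suc d)})"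
      using c by (intro tp_split_fin) (simp_all add: strict_mono_less)
    then show ?case using Suc b[of "Suc i + d"] e by simp
  qed (simp add: b)
  from this[of "j - Suc i"] \<open>i < j\<close> show ?thesis by simp
qed

lemma cut_above:
  assumes c: "strict_mono (c :: nat \<Rightarrow> nat)" and "finite A"
  obtains k where "k > 0" "\<And>n. n \<in> A \<Longrightarrow> n < c k"
proof
  show "n < c (Suc (Max (insert 0 A)))" if "n \<in> A" for n
  proof -
    have "n \<le> Max (insert 0 A)" using that \<open>finite A\<close> by simp
    then show ?thesis using strict_mono_imp_increasing[OF c, of "Suc (Max (insert 0 A))"] by linarith
  qed
qed simp

text \<open>A pair i < j is coloured by the type of the merged block; colours belong to unordered
  pairs, hence \<open>Min\<close> and \<open>Max\<close>. Splitting a merged block shows the common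
  type to be idempotent, so \<open>omega\<close> becomes applicable to a cutting with arbitrary
  block types.\<close>

lemma ramsey_blocks:
  assumes c: "strict_mono (c :: nat \<Rightarrow> nat)"
  shows "\<exists>d t. strict_mono (d :: nat \<Rightarrow> nat) \<and> (\<forall>i j. i < j \<longrightarrow> tp \<phi> x I V {c (d i)..<c (d j)} = t)"
proof -
  obtain s where s: "\<And>t. t \<in> types \<phi> \<Longrightarrow> t < s"
    using finite_types[of \<phi>] unfolding finite_nat_set_iff_bounded by blast
  define f where "f = (\<lambda>X. tp \<phi> x I V {c (Min X)..<c (Max X)})"
  have "\<exists>Y t. Y \<subseteq> UNIV \<and> infinite Y \<and> t < s \<and> (\<forall>i\<in>Y. \<forall>j\<in>Y. i \<noteq> j \<longrightarrow> f {i, j} = t)"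
  proof (rule Ramsey2)
    show "\<forall>i\<in>UNIV. \<forall>j\<in>UNIV. i \<noteq> j \<longrightarrow> f {i, j} < s"
      unfolding f_def by (intro ballI impI s tp_in_types)
  qed simp
  then obtain Y t where Y: "infinite Y" "\<forall>i\<in>Y. \<forall>j\<in>Y. i \<noteq> j \<longrightarrow> f {i, j} = t" by metis
  show ?thesis
  proof (intro exI conjI allI impI)
    show sm: "strict_mono (enumerate Y)" using Y(1) by (simp add: strict_mono_enumerate)
    fix i j :: nat assume "i < j"
    show "tp \<phi> x I V {c (enumerate Y i)..<c (enumerate Y j)} = t"
    proof -
      have "enumerate Y i < enumerate Y j" using sm \<open>i < j\<close> by (simp add: strict_mono_less)
      then have "f {enumerate Y i, enumerate Y j} = tp \<phi> x I V {c (enumerate Y i)..<c (enumerate Y j)}"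
        by (simp add: f_def)
      moreover have "f {enumerate Y i, enumerate Y j} = t"
        using Y(2) \<open>enumerate Y i < enumerate Y j\<close> Y(1) enumerate_in_set by (metis less_irrefl)
      ultimately show ?thesis by simp
    qed
  qed
qed

text \<open>All cut sequences and interpretations are quantified, because the induction applies the
  claim to tails, to regrouped blocks and to modified variables.\<close>

definition omega_ok :: "(nat \<Rightarrow> int) \<Rightarrow> mso \<Rightarrow> bool" where
  "omega_ok x \<phi> \<longleftrightarrow> (\<forall>c I V e. strict_mono c \<longrightarrow> (\<forall>k. tp \<phi> x I V {c k..<c (Suc k)} = e) \<longrightarrow>
     mult \<phi> e e = e \<longrightarrow> tp \<phi> x I V {c 0..} = omega \<phi> e)"

lemma omega_okI:
  assumes "\<And>c I V e. strict_mono c \<Longrightarrow> (\<And>k. tp \<phi> x I V {c k..<c (Suc k)} = e) \<Longrightarrow> mult \<phi> e e = e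
    \<Longrightarrow> tp \<phi> x I V {c 0..} = omega \<phi> e"
  shows "omega_ok x \<phi>"
  unfolding omega_ok_def by (intro allI impI assms) simp_all

lemma omega_okD:
  assumes "omega_ok x \<phi>" "strict_mono c" "\<And>k. tp \<phi> x I V {c k..<c (Suc k)} = e" "mult \<phi> e e = e"
  shows "tp \<phi> x I V {c 0..} = omega \<phi> e"
  using assms unfolding omega_ok_def by metis

text \<open>The variable sits before some cut. Behind that cut it is absent, and the merged blocks
  before it realize the same set of types as the first block alone, so a single factor s in front of
  the infinite power is enough.\<close>

lemma omega_I:
  assumes "omega_ok x \<phi>" shows "omega_ok x (ExI p \<phi>)"
proof (rule omega_okI)
  note IH = omega_okD[OF assms]
  fix c I V e
  assume c: "strict_mono c" and b: "\<And>k. tp (ExI p \<phi>) x I V {c k..<c (Suc k)} = e"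
    and e: "mult (ExI p \<phi>) e e = e"
  let ?a = "rgt e" let ?A = "set_decode (lft e)"
  have b1: "(\<lambda>n. tp \<phi> x (I(p := {n})) V {c i..<c j}) ` {c i..<c j} = ?A"
    and b2: "tp \<phi> x (I(p := {})) V {c i..<c j} = ?a" if "i < j" for i j
    using tp_blocks[OF c b e that] by auto
  have ia: "mult \<phi> ?a ?a = ?a" using arg_cong[OF e, of rgt] by simp
  have tail: "tp \<phi> x (I(p := {})) V {c i..} = omega \<phi> ?a" for i
  proof -
    have "strict_mono (\<lambda>k. c (i + k))" using c by (simp add: strict_mono_def)
    from IH[OF this _ ia, of "I(p := {})" V] show ?thesis using b2 by simp
  qed
  have tail': "tp \<phi> x (I(p := {n})) V {c i..} = omega \<phi> ?a" if "n < c i" for i n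
    unfolding tail[of i, symmetric] by (rule tp_cong) (use that in auto)
  have split: "tp \<phi> x (I(p := {n})) V {c 0..} = mult \<phi> (tp \<phi> x (I(p := {n})) V {c 0..<c k}) (omega \<phi> ?a)"
    if "n < c k" "k > 0" for n k
    using tp_split_inf[of "c 0" "c k"] c that by (simp add: tail' strict_mono_less)
  have "(\<lambda>n. tp \<phi> x (I(p := {n})) V {c 0..}) ` {c 0..} = (\<lambda>s. mult \<phi> s (omega \<phi> ?a)) ` ?A"
  proof (intro equalityI subsetI)
    fix t assume "t \<in> (\<lambda>n. tp \<phi> x (I(p := {n})) V {c 0..}) ` {c 0..}"
    then obtain n where n: "c 0 \<le> n" "t = tp \<phi> x (I(p := {n})) V {c 0..}" by auto
    obtain k where k: "k > 0" "n < c k" using cut_above[OF c, of "{n}"] by auto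
    have "tp \<phi> x (I(p := {n})) V {c 0..<c k} \<in> ?A" using b1[OF k(1)] n(1) k(2) by auto
    then show "t \<in> (\<lambda>s. mult \<phi> s (omega \<phi> ?a)) ` ?A" using n(2) split[OF k(2,1)] by simp
  next
    fix t assume "t \<in> (\<lambda>s. mult \<phi> s (omega \<phi> ?a)) ` ?A"
    then obtain s where s: "s \<in> ?A" "t = mult \<phi> s (omega \<phi> ?a)" by blast
    then have "s \<in> (\<lambda>n. tp \<phi> x (I(p := {n})) V {c 0..<c 1}) ` {c 0..<c 1}" using b1[of 0 1] by simp
    with s(2) obtain n where n: "n \<in> {c 0..<c 1}" "t = mult \<phi> (tp \<phi> x (I(p := {n})) V {c 0..<c 1}) (omega \<phi> ?a)"
      by blast
    then show "t \<in> (\<lambda>n. tp \<phi> x (I(p := {n})) V {c 0..}) ` {c 0..}" using split[of n 1] by (intro image_eqI[of _ _ n]) auto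
  qed
  then show "tp (ExI p \<phi>) x I V {c 0..} = omega (ExI p \<phi>) e" using tail[of 0] by simp
qed

text \<open>For a fixed set, Ramsey regroups the blocks into an initial one and blocks of a common
  idempotent type. Merged blocks still have the type e, so both types belong to
  \<open>set_decode e\<close>. Conversely a set is chosen block by block.\<close>

lemma omega_S:
  assumes "omega_ok x \<phi>" shows "omega_ok x (ExS P \<phi>)"
proof (rule omega_okI)
  note IH = omega_okD[OF assms]
  fix c I V e
  assume c: "strict_mono c" and b: "\<And>k. tp (ExS P \<phi>) x I V {c k..<c (Suc k)} = e"
    and e: "mult (ExS P \<phi>) e e = e"
  have b1: "range (\<lambda>M. tp \<phi> x I (V(P := M)) {c i..<c j}) = set_decode e" if "i < j" for i j
    using tp_blocks[OF c b e that] by auto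
  have "range (\<lambda>M. tp \<phi> x I (V(P := M)) {c 0..})
    = (\<lambda>(s, t). mult \<phi> s (omega \<phi> t)) ` (set_decode e \<times> {t \<in> set_decode e. mult \<phi> t t = t})"
    (is "?A = ?B")
  proof (intro equalityI subsetI)
    fix t assume "t \<in> ?A"
    then obtain M where t: "t = tp \<phi> x I (V(P := M)) {c 0..}" by blast
    obtain d :: "nat \<Rightarrow> nat" and u where d: "strict_mono d"
        and u: "\<And>i j. i < j \<Longrightarrow> tp \<phi> x I (V(P := M)) {c (d i)..<c (d j)} = u"
      using ramsey_blocks[OF c, of \<phi> x I "V(P := M)"] by blast
    have dd: "d i < d j" if "i < j" for i j using d that by (simp add: strict_mono_less)
    have cd: "c (d i) < c (d j)" if "i < j" for i j using c dd[OF that] by (simp add: strict_mono_less)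
    have uu: "mult \<phi> u u = u"
      using tp_split_fin[OF cd[of 0 1] cd[of 1 2], of \<phi> x I "V(P := M)"] u[of 0 1] u[of 1 2] u[of 0 2] by simp
    have "strict_mono (\<lambda>k. c (d (Suc k)))" using cd by (simp add: strict_mono_def)
    from IH[OF this _ uu, of I "V(P := M)"] have "tp \<phi> x I (V(P := M)) {c (d 1)..} = omega \<phi> u"
      using u by simp
    moreover have d1: "0 < d 1" using dd[of 0 1] by simp
    then have "c 0 < c (d 1)" using c by (simp add: strict_mono_less)
    ultimately have "t = mult \<phi> (tp \<phi> x I (V(P := M)) {c 0..<c (d 1)}) (omega \<phi> u)"
      using tp_split_inf[of "c 0" "c (d 1)"] t by simp
    moreover have "tp \<phi> x I (V(P := M)) {c 0..<c (d 1)} \<in> set_decode e" using b1[OF d1] by blast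
    moreover have "u \<in> set_decode e" using b1[OF dd[of 0 1]] u[of 0 1] by auto
    ultimately show "t \<in> ?B" using uu by force
  next
    fix t assume "t \<in> ?B"
    then obtain s u where su: "s \<in> set_decode e" "u \<in> set_decode e" "mult \<phi> u u = u" "t = mult \<phi> s (omega \<phi> u)"
      by auto
    have "\<exists>M. tp \<phi> x I (V(P := M)) {c k..<c (Suc k)} = (if k = 0 then s else u)" for k
    proof -
      have "(if k = 0 then s else u) \<in> range (\<lambda>M. tp \<phi> x I (V(P := M)) {c k..<c (Suc k)})"
        using b1[of k "Suc k"] su(1,2) by simp
      then show ?thesis by (elim rangeE) (rule exI, erule sym)
    qed
    then obtain M where M: "\<And>k. tp \<phi> x I (V(P := M k)) {c k..<c (Suc k)} = (if k = 0 then s else u)" by metis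
    \<comment> \<open>The choices are glued; as the blocks are disjoint, \<open>N\<close> agrees
      with \<open>M k\<close> on block k.\<close>
    define N where "N = {n. \<exists>k. c k \<le> n \<and> n < c (Suc k) \<and> n \<in> M k}"
    have N: "tp \<phi> x I (V(P := N)) {c k..<c (Suc k)} = (if k = 0 then s else u)" for k
    proof -
      have "n \<in> N \<longleftrightarrow> n \<in> M k" if n: "c k \<le> n" "n < c (Suc k)" for n
      proof -
        have "l = k" if "c l \<le> n" "n < c (Suc l)" for l
        proof -
          have "c l < c (Suc k)" "c k < c (Suc l)" using n that by simp_all
          then show ?thesis using c by (simp add: strict_mono_less)
        qed
        then show ?thesis using n unfolding N_def by blast
      qed
      then have "tp \<phi> x I (V(P := N)) {c k..<c (Suc k)} = tp \<phi> x I (V(P := M k)) {c k..<c (Suc k)}"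
        by (intro tp_cong) auto
      then show ?thesis using M by simp
    qed
    have "strict_mono (\<lambda>k. c (Suc k))" using c by (simp add: strict_mono_def)
    from IH[OF this _ su(3), of I "V(P := N)"] have "tp \<phi> x I (V(P := N)) {c 1..} = omega \<phi> u"
      using N by simp
    then have "t = tp \<phi> x I (V(P := N)) {c 0..}"
      using tp_split_inf[of "c 0" "c 1" \<phi> x I "V(P := N)"] N[of 0] su(4) c by (simp add: strict_mono_less)
    then show "t \<in> ?A" by blast
  qed
  then show "tp (ExS P \<phi>) x I V {c 0..} = omega (ExS P \<phi>) e" by simp
qed

text \<open>Witnesses in the tail already lie before some cut. Two positions are quantified so that
  one lemma serves all atoms; for a condition on a single position b is a dummy, harmless because
  the ranges are nonempty.\<close>

lemma bit_omega:
  assumes c: "strict_mono (c :: nat \<Rightarrow> nat)"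
    and z: "\<And>j. 0 < j \<Longrightarrow> (\<exists>a\<in>{c 0..<c j}. \<exists>b\<in>{c 0..<c j}. Q a b) \<longleftrightarrow> z"
  shows "(\<exists>a\<in>{c 0..}. \<exists>b\<in>{c 0..}. Q a b) \<longleftrightarrow> z"
proof
  assume "\<exists>a\<in>{c 0..}. \<exists>b\<in>{c 0..}. Q a b"
  then obtain a b where ab: "c 0 \<le> a" "c 0 \<le> b" "Q a b" by auto
  obtain j where "j > 0" and j: "\<And>n. n \<in> {a, b} \<Longrightarrow> n < c j"
    by (rule cut_above[OF c, of "{a, b}"]) auto
  have "a \<in> {c 0..<c j}" "b \<in> {c 0..<c j}" using ab(1,2) j by simp_all
  with ab(3) z[OF \<open>j > 0\<close>] show z by blast
next
  assume z
  with z[of 1] show "\<exists>a\<in>{c 0..}. \<exists>b\<in>{c 0..}. Q a b" by force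
qed

theorem omega_ok: "omega_ok x \<phi>"
proof (induction \<phi>)
  have one: "omega_ok x \<phi>"
    if R: "\<And>I V D. tp \<phi> x I V D = of_bool (\<exists>n\<in>D. R I V n)" and om: "\<And>e. omega \<phi> e = e" for \<phi> R
  proof (rule omega_okI)
    fix c I V e
    assume c: "strict_mono c" and b: "\<And>k. tp \<phi> x I V {c k..<c (Suc k)} = e" and e: "mult \<phi> e e = e"
    have "(\<exists>a\<in>{c 0..}. \<exists>b\<in>{c 0..}. R I V a) \<longleftrightarrow> e = 1"
    proof (rule bit_omega[OF c])
      fix j :: nat assume "0 < j"
      from tp_blocks[OF c b e this] have "of_bool (\<exists>n\<in>{c 0..<c j}. R I V n) = e" by (simp only: R)
      then have "(\<exists>n\<in>{c 0..<c j}. R I V n) \<longleftrightarrow> e = 1" by (cases "\<exists>n\<in>{c 0..<c j}. R I V n") (simp_all only: of_bool_eq, simp_all)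
      then show "(\<exists>a\<in>{c 0..<c j}. \<exists>b\<in>{c 0..<c j}. R I V a) \<longleftrightarrow> e = 1" by blast
    qed
    then have "(\<exists>n\<in>{c 0..}. R I V n) \<longleftrightarrow> e = 1" by blast
    moreover have "e = of_bool (\<exists>n\<in>{c 0..<c (Suc 0)}. R I V n)" using b[of 0] by (simp only: R)
    then have "e = 0 \<or> e = 1" by (cases "\<exists>n\<in>{c 0..<c (Suc 0)}. R I V n") (simp_all only: of_bool_eq simp_thms)
    ultimately show "tp \<phi> x I V {c 0..} = omega \<phi> e" unfolding R om by (elim disjE) (simp_all only: of_bool_eq, simp_all)
  qed
  { case (Eq p q) show ?case by (rule one[of _ "\<lambda>I V i. i \<in> I p \<and> i \<in> I q"]) simp_all }
  { case (Sym p a) show ?case by (rule one[of _ "\<lambda>I V i. i \<in> I p \<and> x i = a"]) simp_all }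
  { case (Mem P p) show ?case by (rule one[of _ "\<lambda>I V i. i \<in> I p \<and> i \<in> V P"]) simp_all }
  { case (Less p q)
    show ?case
    proof (rule omega_okI)
      fix c I V e
      assume Less: "strict_mono c" "\<And>k. tp (Less p q) x I V {c k..<c (Suc k)} = e" "mult (Less p q) e e = e"
      note bl = tp_blocks[OF Less, of 0, symmetric]
      have "(\<exists>a\<in>{c 0..}. \<exists>b\<in>{c 0..}. a \<in> I p) \<longleftrightarrow> lft e = 1"
        by (rule bit_omega[OF Less(1)], subst bl) auto
      moreover have "(\<exists>a\<in>{c 0..}. \<exists>b\<in>{c 0..}. a \<in> I q) \<longleftrightarrow> lft (rgt e) = 1"
        by (rule bit_omega[OF Less(1)], subst bl) auto
      moreover have "(\<exists>a\<in>{c 0..}. \<exists>b\<in>{c 0..}. a < b \<and> a \<in> I p \<and> b \<in> I q) \<longleftrightarrow> rgt (rgt e) = 1"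
        by (rule bit_omega[OF Less(1)], subst bl) auto
      moreover obtain u v w where "e = pr (of_bool u) (pr (of_bool v) (of_bool w))"
        using Less(2)[of 0] by auto
      ultimately show "tp (Less p q) x I V {c 0..} = omega (Less p q) e" by auto
    qed }
  { case (Succ p q)
    show ?case
    proof (rule omega_okI)
      fix c I V e
      assume Succ: "strict_mono c" "\<And>k. tp (Succ p q) x I V {c k..<c (Suc k)} = e" "mult (Succ p q) e e = e"
      note bl = tp_blocks[OF Succ, of 0, symmetric]
      have c01: "c 0 < c 1" using Succ(1) by (simp add: strict_mono_less)
      have "(\<exists>a\<in>{c 0..}. \<exists>b\<in>{c 0..}. b = Suc a \<and> a \<in> I p \<and> Suc a \<in> I q) \<longleftrightarrow> rgt (rgt e) = 1"
        by (rule bit_omega[OF Succ(1)], subst bl) auto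
      then have ok: "(\<exists>i\<in>{c 0..}. i \<in> I p \<and> Suc i \<in> {c 0..} \<and> Suc i \<in> I q) \<longleftrightarrow> rgt (rgt e) = 1" by blast
      have fm: "(\<exists>i\<in>D. i \<in> I q \<and> (\<forall>j\<in>D. i \<le> j)) \<longleftrightarrow> c 0 \<in> I q" if "c 0 \<in> D" "D \<subseteq> {c 0..}" for D
      proof -
        have "i = c 0" if "i \<in> D" "\<forall>j\<in>D. i \<le> j" for i
          using that \<open>c 0 \<in> D\<close> \<open>D \<subseteq> {c 0..}\<close> by (metis atLeast_iff le_antisym subsetD)
        moreover have "c 0 \<le> j" if "j \<in> D" for j using that \<open>D \<subseteq> {c 0..}\<close> by auto
        ultimately show ?thesis using \<open>c 0 \<in> D\<close> by blast
      qed
      have sub: "c 0 \<in> {c 0..<c 1}" "{c 0..<c 1} \<subseteq> {c 0..}" "c 0 \<in> {c 0..}" using c01 by auto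
      have "lft e = of_bool (\<exists>i\<in>{c 0..<c 1}. i \<in> I q \<and> (\<forall>j\<in>{c 0..<c 1}. i \<le> j))"
        unfolding bl[of 1, OF zero_less_one] tp.simps prod_encode_inverse fst_conv ..
      then have "lft e = of_bool (c 0 \<in> I q)" unfolding fm[OF sub(1,2)] .
      then have first: "(\<exists>i\<in>{c 0..}. i \<in> I q \<and> (\<forall>j\<in>{c 0..}. i \<le> j)) \<longleftrightarrow> lft e = 1"
        unfolding fm[OF sub(3) subset_refl] by (cases "c 0 \<in> I q") simp_all
      \<comment> \<open>An infinite tail has no last position; this is the 0 in \<open>omega\<close>
        for \<open>Succ\<close>.\<close>
      have last: "\<not> (\<exists>i\<in>{c 0..}. i \<in> I p \<and> (\<forall>j\<in>{c 0..}. j \<le> i))"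
        by (metis atLeast_iff le_Suc_eq le_trans not_less_eq_eq order_refl)
      obtain u v w where "e = pr (of_bool u) (pr (of_bool v) (of_bool w))"
        using Succ(2)[of 0] by auto
      then show "tp (Succ p q) x I V {c 0..} = omega (Succ p q) e"
        unfolding tp.simps omega.simps ok first using last by auto
    qed }
  { case (Neg \<phi>) then show ?case by (simp add: omega_ok_def) }
  have two: "omega_ok x (Conj \<phi> \<psi>)" if ok: "omega_ok x \<phi>" "omega_ok x \<psi>" for \<phi> \<psi>
  proof (rule omega_okI)
    fix c I V e
    assume c: "strict_mono c" and b: "\<And>k. tp (Conj \<phi> \<psi>) x I V {c k..<c (Suc k)} = e"
      and e: "mult (Conj \<phi> \<psi>) e e = e"
    have "tp \<phi> x I V {c k..<c (Suc k)} = lft e" "tp \<psi> x I V {c k..<c (Suc k)} = rgt e" for k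
      using b[of k] by auto
    moreover have "mult \<phi> (lft e) (lft e) = lft e" "mult \<psi> (rgt e) (rgt e) = rgt e"
      using arg_cong[OF e, of lft] arg_cong[OF e, of rgt] by simp_all
    ultimately show "tp (Conj \<phi> \<psi>) x I V {c 0..} = omega (Conj \<phi> \<psi>) e"
      using omega_okD[OF ok(1) c] omega_okD[OF ok(2) c] by simp
  qed
  { case (Conj \<phi> \<psi>) then show ?case by (rule two) }
  { case (Disj \<phi> \<psi>) show ?case using two[OF Disj] by (simp add: omega_ok_def) }
  { case (Impl \<phi> \<psi>) show ?case using two[OF Impl] by (simp add: omega_ok_def) }
  { case (ExI p \<phi>) then show ?case by (rule omega_I) }
  { case (AllI p \<phi>) show ?case using omega_I[OF AllI, of p] by (simp add: omega_ok_def) }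
  { case (ExS P \<phi>) then show ?case by (rule omega_S) }
  { case (AllS P \<phi>) show ?case using omega_S[OF AllS, of P] by (simp add: omega_ok_def) }
qed

lemmas tp_omega = omega_okD[OF omega_ok]

subsection \<open>Finite-index congruences on words\<close>

abbreviation wpow :: "'a list \<Rightarrow> nat \<Rightarrow> 'a list" where "wpow u n \<equiv> concat (replicate n u)"

lemma wpow_add: "wpow u (m + n) = wpow u m @ wpow u n"
  by (simp add: replicate_add)

lemma wpow_comm: "u @ wpow u n = wpow u n @ u"
  using wpow_add[of 1 n u] wpow_add[of n 1 u] by (simp add: add.commute)

lemma wpow_eq_Nil: "wpow u n = [] \<longleftrightarrow> u = [] \<or> n = 0"
  by (induction n) auto

lemma idempotent_iterate:
  assumes "finite (range f)" and shift: "\<And>i j. f i = f j \<Longrightarrow> f (Suc i) = f (Suc j)"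
  shows "\<exists>k>0. f (k + k) = f (k :: nat)"
proof -
  have "\<not> inj f" using assms(1) finite_imageD infinite_UNIV_nat by blast
  then obtain i j where ij: "i < j" "f i = f j"
    by (metis injI linorder_neqE_nat)
  define d where "d = j - i"
  have per1: "f (n + d) = f n" if "i \<le> n" for n
    using that
  proof (induction n rule: dec_induct)
    case base then show ?case using ij by (simp add: d_def)
  next
    case (step n) then show ?case using shift[of "n + d" n] by simp
  qed
  have per: "f (n + m * d) = f n" if "i \<le> n" for n m
  proof (induction m)
    case (Suc m)
    then show ?case using per1[of "n + m * d"] that by (simp add: ac_simps)
  qed simp
  have d: "0 < d" using ij by (simp add: d_def)
  \<comment> \<open>The exponent has to be a multiple of the period d that is at least i; the factor
    \<open>Suc i\<close> keeps it positive when i = 0.\<close>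
  have "i \<le> Suc i * d" using d by (cases d) auto
  then have "f (Suc i * d + Suc i * d) = f (Suc i * d)" using per[of "Suc i * d" "Suc i"] by simp
  then show ?thesis using d by (intro exI[of _ "Suc i * d"]) simp
qed

text \<open>Compatibility is limited to nonempty words because no unit of \<open>m\<close> is
  assumed. Computing with words instead of elements of the range makes associativity that of
  \<open>@\<close>.\<close>

locale word_hom =
  fixes h :: "'a list \<Rightarrow> 'b" and m :: "'b \<Rightarrow> 'b \<Rightarrow> 'b"
  assumes hom: "\<lbrakk>u \<noteq> []; v \<noteq> []\<rbrakk> \<Longrightarrow> h (u @ v) = m (h u) (h v)"
    and fin: "finite (range h)"
begin

lemma ctx:
  assumes "h u = h v" "u \<noteq> []" "v \<noteq> []"
  shows "h (a @ u @ b) = h (a @ v @ b)"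
proof -
  have "h (u @ b) = h (v @ b)" using assms by (cases "b = []") (simp_all add: hom)
  then show ?thesis using assms by (cases "a = []") (simp_all add: hom)
qed

lemma ctxl: "h u = h v \<Longrightarrow> u \<noteq> [] \<Longrightarrow> v \<noteq> [] \<Longrightarrow> h (a @ u) = h (a @ v)"
  using ctx[of u v a "[]"] by simp

lemma ctxr: "h u = h v \<Longrightarrow> u \<noteq> [] \<Longrightarrow> v \<noteq> [] \<Longrightarrow> h (u @ b) = h (v @ b)"
  using ctx[of u v "[]" b] by simp

lemma idempotent_power:
  assumes "u \<noteq> []" shows "\<exists>k>0. h (wpow u k @ wpow u k) = h (wpow u k)"
proof -
  have "\<exists>k>0. h (wpow u (Suc (k + k) - 1)) = h (wpow u (Suc k - 1))"
  proof -
    \<comment> \<open>Exponent 0 is kept apart by \<open>None\<close>, since \<open>h []\<close>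
      says nothing about products.\<close>
    define f where "f k = (if k = 0 then None else Some (h (wpow u k)))" for k
    have "finite (range f)"
      by (rule finite_subset[of _ "insert None (Some ` range h)"]) (auto simp: f_def fin)
    moreover have "f (Suc i) = f (Suc j)" if "f i = f j" for i j
    proof (cases "i = 0 \<or> j = 0")
      case True
      with that have "i = 0" "j = 0" by (auto simp: f_def split: if_splits)
      then show ?thesis by simp
    next
      case False
      with that have "h (wpow u i) = h (wpow u j)" by (auto simp: f_def split: if_splits)
      then have "h (u @ wpow u i) = h (u @ wpow u j)"
        using False assms by (intro ctxl) (auto simp: wpow_eq_Nil simp del: concat_eq_Nil_conv)
      then show ?thesis by (simp add: f_def)
    qed
    ultimately obtain k where "k > 0" "f (k + k) = f k" using idempotent_iterate by blast
    then show ?thesis by (auto simp: f_def split: if_splits)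
  qed
  then show ?thesis by (simp add: wpow_add)
qed

text \<open>Membership of h u in the maximal subgroup with unit h E, phrased with words only; v
  represents the inverse.\<close>

definition grp :: "'a list \<Rightarrow> 'a list \<Rightarrow> bool" where
  "grp E u \<longleftrightarrow> u \<noteq> [] \<and> h (u @ E) = h u \<and> h (E @ u) = h u \<and>
     (\<exists>v. v \<noteq> [] \<and> h (u @ v) = h E \<and> h (v @ u) = h E)"

text \<open>The premises are equations between types, which a certificate can test. Writing E for
  the power of u gives the left unit law E u = u^(n+1) u = u u^(n+1) = u E = u, and u^n E is an
  inverse, nonempty also for n = 0.\<close>

lemma grpI:
  assumes u: "u \<noteq> []" and E: "E \<noteq> []" and uE: "h (u @ E) = h u" and p: "h (wpow u (Suc n)) = h E"
  shows "grp E u"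
proof -
  have ne: "wpow u (Suc n) \<noteq> []" using u by simp
  have pE: "h (wpow u (Suc n) @ E) = h (wpow u (Suc n))"
    using ctxl[OF uE, of "wpow u n"] u by (simp add: wpow_comm)
  have EE: "h (E @ E) = h E" using ctxr[OF p ne E, of E] pE p by simp
  have Eu: "h (E @ u) = h u"
  proof -
    have "h (E @ u) = h (wpow u (Suc n) @ u)" by (rule ctxr[OF p ne E, symmetric])
    also have "\<dots> = h (u @ wpow u (Suc n))" by (simp only: wpow_comm)
    also have "\<dots> = h (u @ E)" by (rule ctxl[OF p ne E])
    finally show ?thesis using uE by simp
  qed
  have "h (u @ wpow u n @ E) = h E" using pE p by simp
  moreover have "h ((wpow u n @ E) @ u) = h E"
    using ctxl[OF Eu, of "wpow u n"] u p by (simp add: wpow_comm)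
  ultimately show ?thesis unfolding grp_def using u E uE Eu
    by (intro conjI exI[of _ "wpow u n @ E"]) simp_all
qed

lemma grp_append:
  assumes E: "E \<noteq> []" and "grp E u" "grp E v" shows "grp E (u @ v)"
proof -
  obtain u' v' where u: "u \<noteq> []" "h (u @ E) = h u" "h (E @ u) = h u" "u' \<noteq> []" "h (u @ u') = h E" "h (u' @ u) = h E"
    and v: "v \<noteq> []" "h (v @ E) = h v" "h (E @ v) = h v" "v' \<noteq> []" "h (v @ v') = h E" "h (v' @ v) = h E"
    using assms unfolding grp_def by blast
  have 1: "h ((u @ v) @ E) = h (u @ v)" using ctxl[OF v(2), of u] v by simp
  have 2: "h (E @ u @ v) = h (u @ v)" using ctxr[OF u(3), of v] u by simp
  have "h ((u @ v) @ v' @ u') = h (u @ E @ u')"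
    using ctx[OF v(5), of u u'] v E by simp
  also have "\<dots> = h (u @ u')" using ctxr[OF u(2), of u'] u by simp
  finally have 3: "h ((u @ v) @ v' @ u') = h E" using u(5) by simp
  have "h ((v' @ u') @ u @ v) = h (v' @ E @ v)"
    using ctx[OF u(6), of v' v] u E by simp
  also have "\<dots> = h (v' @ v)" using ctxl[OF v(3), of v'] v E by simp
  finally have "h ((v' @ u') @ u @ v) = h E" using v(6) by simp
  with 1 2 3 show ?thesis unfolding grp_def using u(1,4) by (intro conjI exI[of _ "v' @ u'"]) simp_all
qed

lemma grp_idempotent:
  assumes E: "E \<noteq> []" and "grp E u" and uu: "h (u @ u) = h u" shows "h u = h E"
proof -
  obtain v where u: "u \<noteq> []" "h (u @ E) = h u" "v \<noteq> []" "h (u @ v) = h E"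
    using assms unfolding grp_def by blast
  have "h u = h (u @ u @ v)" using ctxl[OF u(4), of u] u E by simp
  also have "\<dots> = h (u @ v)" using ctxr[OF uu, of v] u by simp
  finally show ?thesis using u by simp
qed

lemma grp_wpow: "E \<noteq> [] \<Longrightarrow> grp E u \<Longrightarrow> grp E (wpow u (Suc n))"
  by (induction n) (simp_all add: grp_append)

lemma grp_power:
  assumes E: "E \<noteq> []" and u: "grp E u" shows "\<exists>k>0. h (wpow u k) = h E"
proof -
  have "u \<noteq> []" using u by (simp add: grp_def)
  then obtain k where k: "k > 0" "h (wpow u k @ wpow u k) = h (wpow u k)" using idempotent_power by blast
  then have "grp E (wpow u k)" using grp_wpow[OF E u, of "k - 1"] by simp
  then show ?thesis using grp_idempotent[OF E _ k(2)] k(1) by blast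
qed

section \<open>Principal two-sided ideals and Green's relations\<close>

definition ideal :: "'a list \<Rightarrow> 'b set" where "ideal w = {h (a @ w @ b) | a b. True}"

lemma finite_ideal: "finite (ideal w)"
  by (rule finite_subset[OF _ fin]) (auto simp: ideal_def)

lemma ideal_factor: "ideal (a @ w @ b) \<subseteq> ideal w"
proof
  fix t assume "t \<in> ideal (a @ w @ b)"
  then obtain c d where "t = h (c @ (a @ w @ b) @ d)" by (auto simp: ideal_def)
  then have "t = h ((c @ a) @ w @ (b @ d))" by simp
  then show "t \<in> ideal w" unfolding ideal_def by blast
qed

lemma self_ideal: "h w \<in> ideal w"
  unfolding ideal_def by (rule CollectI, rule exI[of _ "[]"], rule exI[of _ "[]"]) simp

lemma ideal_right:
  assumes a: "a \<noteq> []" and "h a \<in> ideal (a @ b)" shows "\<exists>c. h (a @ b @ c) = h a"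
proof -
  obtain s t where st: "h a = h (s @ a @ b @ t)" using assms(2) by (auto simp: ideal_def)
  have it: "h a = h (wpow s k @ a @ wpow (b @ t) k)" for k
  proof (induction k)
    case (Suc k)
    have "wpow s (Suc k) @ a @ wpow (b @ t) (Suc k) = wpow s k @ (s @ a @ b @ t) @ wpow (b @ t) k"
      using wpow_comm[of s k] by simp
    moreover have "h (wpow s k @ (s @ a @ b @ t) @ wpow (b @ t) k) = h (wpow s k @ a @ wpow (b @ t) k)"
      by (rule ctx[OF st[symmetric]]) (use a in auto)
    ultimately show ?case using Suc by simp
  qed simp
  show ?thesis
  proof (cases "s = []")
    case True then show ?thesis using st by (intro exI[of _ t]) simp
  next
    case False
    then obtain k where k: "k > 0" "h (wpow s k @ wpow s k) = h (wpow s k)" using idempotent_power by blast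
    have ne: "wpow s k \<noteq> []" using False k(1) by (simp add: wpow_eq_Nil del: concat_eq_Nil_conv)
    let ?r = "wpow (b @ t) k"
    have "h (wpow s k @ a) = h (wpow s k @ wpow s k @ a @ ?r)"
      by (rule ctxl[OF it]) (use a in auto)
    also have "\<dots> = h (wpow s k @ a @ ?r)"
      using ctxr[OF k(2), of "a @ ?r"] ne by simp
    finally have sa: "h (wpow s k @ a) = h a" using it[of k] by simp
    have "h (a @ ?r) = h (wpow s k @ a @ ?r)"
      using ctxr[OF sa[symmetric], of ?r] a by simp
    then have "h (a @ ?r) = h a" using it[of k] by simp
    moreover have "?r = b @ t @ wpow (b @ t) (k - 1)" using k(1) by (cases k) auto
    ultimately show ?thesis by (intro exI[of _ "t @ wpow (b @ t) (k - 1)"]) simp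
  qed
qed

text \<open>The mirror image of \<open>ideal_right\<close>, obtained by reversing all words and the
  factors of \<open>m\<close>.\<close>

lemma ideal_left:
  assumes a: "a \<noteq> []" and "h a \<in> ideal (b @ a)" shows "\<exists>c. h (c @ b @ a) = h a"
proof -
  interpret rv: word_hom "\<lambda>w. h (rev w)" "\<lambda>x y. m y x"
  proof
    show "h (rev (u @ v)) = m (h (rev v)) (h (rev u))" if "u \<noteq> []" "v \<noteq> []" for u v
      using that hom[of "rev v" "rev u"] by simp
    show "finite (range (\<lambda>w. h (rev w)))" by (rule finite_subset[OF _ fin]) auto
  qed
  obtain s t where "h a = h (s @ (b @ a) @ t)" using assms(2) by (auto simp: ideal_def)
  then have "h (rev (rev a)) = h (rev (rev t @ (rev a @ rev b) @ rev s))" by simp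
  then have "h (rev (rev a)) \<in> rv.ideal (rev a @ rev b)" unfolding rv.ideal_def by blast
  then obtain c where "h (rev (rev a @ rev b @ c)) = h (rev (rev a))"
    using rv.ideal_right[of "rev a" "rev b"] a by auto
  then show ?thesis by (intro exI[of _ "rev c"]) simp
qed

text \<open>
  Beyond a certain length all words of a uniformly recurrent language generate the same two-sided
  ideal. Green's relations then force the factors between the midpoints of occurrences of \<open>w1 @ w2\<close>
  into one subgroup.
\<close>
lemma uniform_group:
  assumes fac: "\<And>a w b. a @ w @ b \<in> L \<Longrightarrow> w \<in> L"
    and rec: "\<And>w. w \<in> L \<Longrightarrow> \<exists>M. \<forall>f\<in>L. M \<le> length f \<longrightarrow> (\<exists>a b. f = a @ w @ b)"
    and ne: "w0 \<in> L" "w0 \<noteq> []"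
  shows "\<exists>l>0. \<forall>w1 w2. length w1 = l \<longrightarrow> length w2 = l \<longrightarrow> w1 @ w2 \<in> L \<longrightarrow>
    (\<exists>E. E \<noteq> [] \<and> (\<forall>v r r'. w1 @ v @ w2 \<in> L \<longrightarrow> v = w2 @ r \<longrightarrow> v = r' @ w1 \<longrightarrow>
       h (v @ E) = h v \<and> (\<exists>n. h (wpow v (Suc n)) = h E)))"
proof -
  \<comment> \<open>Prolonging a word can only shrink its ideal, so once the ideal is smallest it
    stays the same in all words containing \<open>w\<close>.\<close>
  define w where "w = arg_min (\<lambda>w. card (ideal w)) (\<lambda>w. w \<in> L \<and> w \<noteq> [])"
  have "w \<in> L \<and> w \<noteq> []" unfolding w_def by (rule arg_min_natI[of _ w0]) (use ne in auto)
  then have w: "w \<in> L" "w \<noteq> []" by auto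
  have wmin: "card (ideal w) \<le> card (ideal u)" if "u \<in> L" "u \<noteq> []" for u
    unfolding w_def by (rule arg_min_nat_le) (use that in auto)
  obtain M where M: "\<And>f. f \<in> L \<Longrightarrow> M \<le> length f \<Longrightarrow> \<exists>a b. f = a @ w @ b" using rec[OF w(1)] by blast
  \<comment> \<open>Words of length at least M contain \<open>w\<close>; \<open>Suc\<close> makes
    the halves \<open>w1\<close> and \<open>w2\<close> nonempty.\<close>
  define l where "l = Suc M"
  have id: "ideal f = ideal w" if f_in: "f \<in> L" "l \<le> length f" for f
  proof (rule card_subset_eq[OF finite_ideal])
    obtain a b where f: "f = a @ w @ b" using M[OF f_in(1)] f_in(2) by (auto simp: l_def)
    show sub: "ideal f \<subseteq> ideal w" unfolding f by (rule ideal_factor)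
    have "f \<noteq> []" using w(2) f by simp
    from wmin[OF f_in(1) this] card_mono[OF finite_ideal sub] show "card (ideal f) = card (ideal w)" by simp
  qed
  show ?thesis
  proof (intro exI[of _ l] conjI allI impI)
    show "0 < l" by (simp add: l_def)
    fix w1 w2 assume w1: "length w1 = l" and w2: "length w2 = l" and w12: "w1 @ w2 \<in> L"
    have n1: "w1 \<noteq> []" and n2: "w2 \<noteq> []" using w1 w2 by (auto simp: l_def)
    have "w1 \<in> L" "w2 \<in> L" using fac[of "[]" w1 w2] fac[of w1 w2 "[]"] w12 by auto
    then have i1: "ideal w1 = ideal w" and i2: "ideal w2 = ideal w" and i12: "ideal (w1 @ w2) = ideal w"
      using w1 w2 w12 by (auto intro!: id)
    \<comment> \<open>\<open>w1\<close> and \<open>w1 @ w2\<close> generate the same ideal, hence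
      appending \<open>w2\<close> can be undone on the right.\<close>
    obtain c where c: "h (w1 @ w2 @ c) = h w1"
      using ideal_right[OF n1, of w2] self_ideal[of w1] i1 i12 by auto
    \<comment> \<open>The blocks between the midpoints of two occurrences of \<open>w1 @ w2\<close>,
      which may overlap. Such v is R-equivalent to its prefix \<open>w2\<close> and L-equivalent to
      its suffix \<open>w1\<close>.\<close>
    define good where "good v \<longleftrightarrow> w1 @ v @ w2 \<in> L \<and> (\<exists>r. v = w2 @ r) \<and> (\<exists>r'. v = r' @ w1)" for v
    have unit: "\<exists>k>0. h (wpow v k @ v) = h v \<and> h (wpow v k @ w2) = h w2 \<and> h (w1 @ wpow v k) = h w1"
      if "good v" for v
    proof -
      obtain r r' where L: "w1 @ v @ w2 \<in> L" and r: "v = w2 @ r" and r': "v = r' @ w1"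
        using \<open>good v\<close> unfolding good_def by blast
      have nv: "v \<noteq> []" using r n2 by simp
      have "v \<in> L" using fac L by blast
      then have iv: "ideal v = ideal w" using r w2 by (intro id) auto
      obtain a where a: "h (v @ a) = h w2"
        using ideal_right[OF n2, of r] self_ideal[of w2] i2 iv r by auto
      obtain d where d: "h (d @ v) = h w1"
        using ideal_left[OF n1, of r'] self_ideal[of w1] i1 iv r' by auto
      define g where "g = a @ c"
      \<comment> \<open>v absorbs \<open>w2 @ c\<close> because it ends with \<open>w1\<close>, and
        \<open>w2\<close> may be replaced by \<open>v @ a\<close>. So v v is R-equivalent to v, and
        the iteration below yields a power of v that acts as a unit.\<close>
      have vv: "h (v @ v @ g) = h v"
      proof -
        have "h v = h (r' @ w1 @ w2 @ c)" using ctxl[OF c, of r'] n1 r' by simp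
        also have "\<dots> = h (v @ w2 @ c)" using r' by simp
        also have "\<dots> = h (v @ (v @ a) @ c)" using ctx[OF a, of v c] nv n2 by simp
        finally show ?thesis by (simp add: g_def)
      qed
      have it: "h (wpow v j @ v @ wpow g j) = h v" for j
      proof (induction j)
        case (Suc j)
        have "wpow v (Suc j) @ v @ wpow g (Suc j) = wpow v j @ (v @ v @ g) @ wpow g j"
          using wpow_comm[of v j] by simp
        also have "h \<dots> = h (wpow v j @ v @ wpow g j)"
          by (rule ctx[OF vv]) (use nv in auto)
        finally show ?case using Suc by simp
      qed simp
      obtain k where k: "k > 0" "h (wpow v k @ wpow v k) = h (wpow v k)" using idempotent_power[OF nv] by blast
      have nk: "wpow v k \<noteq> []" using nv k(1) by (simp add: wpow_eq_Nil del: concat_eq_Nil_conv)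
      have "h (wpow v k @ v) = h (wpow v k @ wpow v k @ v @ wpow g k)"
        using ctxl[OF it[of k, symmetric], of "wpow v k"] nv by simp
      also have "\<dots> = h (wpow v k @ v @ wpow g k)"
        using ctxr[OF k(2), of "v @ wpow g k"] nk by simp
      finally have kv: "h (wpow v k @ v) = h v" using it by simp
      have "h (wpow v k @ w2) = h (wpow v k @ v @ a)"
        by (rule ctxl[OF a[symmetric]]) (use nv n2 in auto)
      also have "\<dots> = h (v @ a)" using ctxr[OF kv, of a] nv by simp
      finally have 2: "h (wpow v k @ w2) = h w2" using a by simp
      have "h (w1 @ wpow v k) = h (d @ v @ wpow v k)"
        using ctxr[OF d[symmetric], of "wpow v k"] nv n1 by simp
      also have "\<dots> = h (d @ v)" using ctxl[OF kv, of d] nv by (simp add: wpow_comm)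
      finally have 1: "h (w1 @ wpow v k) = h w1" using d by simp
      show ?thesis using k(1) kv 1 2 by blast
    qed
    show "\<exists>E. E \<noteq> [] \<and> (\<forall>v r r'. w1 @ v @ w2 \<in> L \<longrightarrow> v = w2 @ r \<longrightarrow> v = r' @ w1 \<longrightarrow>
       h (v @ E) = h v \<and> (\<exists>n. h (wpow v (Suc n)) = h E))"
    proof (cases "\<exists>v. good v")
      case False
      then show ?thesis using n1 by (intro exI[of _ w1]) (auto simp: good_def)
    next
      case True
      then obtain u where u: "good u" by blast
      obtain k where k: "k > 0" "h (wpow u k @ w2) = h w2" "h (w1 @ wpow u k) = h w1"
        using unit[OF u] by blast
      \<comment> \<open>Two idempotents of one group coincide: v^j u^k equals u^k since u^k begins
        with \<open>w2\<close>, and equals v^j since v ends with \<open>w1\<close>. One block u thus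
        provides the unit for all blocks v.\<close>
      have G: "h (v @ wpow u k) = h v \<and> (\<exists>n. h (wpow v (Suc n)) = h (wpow u k))" if v: "good v" for v
      proof -
        obtain r' where r': "v = r' @ w1" using v by (auto simp: good_def)
        obtain s where s: "u = w2 @ s" using u by (auto simp: good_def)
        obtain j where j: "j > 0" "h (wpow v j @ w2) = h w2" using unit[OF v] by blast
        have vu: "h (v @ wpow u k) = h v" using ctxl[OF k(3), of r'] n1 r' by simp
        obtain n where n: "j = Suc n" using j(1) by (cases j) auto
        have "wpow u k = w2 @ s @ wpow u (k - 1)" using k(1) s by (cases k) auto
        then have "h (wpow v j @ wpow u k) = h (wpow u k)"
          using ctxr[OF j(2), of "s @ wpow u (k - 1)"] n2 by simp
        moreover have "wpow v j = wpow v n @ v" by (simp add: n wpow_comm)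
        then have "h (wpow v j @ wpow u k) = h (wpow v j)"
          using ctxl[OF vu, of "wpow v n"] r' n1 by simp
        ultimately show ?thesis using vu n by auto
      qed
      have "wpow u k \<noteq> []" using u k(1) n2 by (auto simp: wpow_eq_Nil good_def simp del: concat_eq_Nil_conv)
      moreover have "good v" if "w1 @ v @ w2 \<in> L" "v = w2 @ r" "v = r' @ w1" for v r r'
        unfolding good_def using that by blast
      ultimately show ?thesis using G by blast
    qed
  qed
qed

end

subsection \<open>Words coding a rotation\<close>

text \<open>Deleting n letters rotates the starting point by \<alpha> n, of which only the
  fractional part matters.\<close>

lemma mechanical_shift: "mechanical \<alpha> \<rho> (n + i) = mechanical \<alpha> (frac (\<alpha> * real n + \<rho>)) i"
proof -
  let ?k = "\<lfloor>\<alpha> * real n + \<rho>\<rfloor>"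
  have "\<lfloor>\<alpha> * real (n + j) + \<rho>\<rfloor> = \<lfloor>\<alpha> * real j + frac (\<alpha> * real n + \<rho>)\<rfloor> + ?k" for j
  proof -
    have "\<alpha> * real (n + j) + \<rho> = \<alpha> * real j + frac (\<alpha> * real n + \<rho>) + of_int ?k"
      by (simp add: frac_def algebra_simps)
    then show ?thesis by (simp only: floor_add_int)
  qed
  from this[of i] this[of "i + 1"] show ?thesis by (simp add: mechanical_def add.assoc)
qed

text \<open>Floors are continuous from the right only, hence the one-sided interval;
  \<open>g k\<close> is the gap from \<alpha> k + y0 up to the next larger integer.\<close>

lemma mechanical_locally_constant:
  assumes "y0 < 1"
  shows "\<exists>\<epsilon>>0. \<forall>y. y0 \<le> y \<longrightarrow> y < y0 + \<epsilon> \<longrightarrow> y < 1 \<and> (\<forall>k<n. mechanical \<alpha> y k = mechanical \<alpha> y0 k)"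
proof -
  define g where "g k = of_int \<lfloor>\<alpha> * real k + y0\<rfloor> + 1 - (\<alpha> * real k + y0)" for k
  have g: "g k > 0" for k unfolding g_def by linarith
  define \<epsilon> where "\<epsilon> = Min (insert (1 - y0) (g ` {..n}))"
  have "\<epsilon> > 0" unfolding \<epsilon>_def using g assms by (subst Min_gr_iff) auto
  have eg: "\<epsilon> \<le> g k" if "k \<le> n" for k unfolding \<epsilon>_def using that by (intro Min_le) auto
  have e1: "\<epsilon> \<le> 1 - y0" unfolding \<epsilon>_def by (intro Min_le) auto
  have "y < 1 \<and> (\<forall>k<n. mechanical \<alpha> y k = mechanical \<alpha> y0 k)" if y: "y0 \<le> y" "y < y0 + \<epsilon>" for y
  proof -
    have fl: "\<lfloor>\<alpha> * real k + y\<rfloor> = \<lfloor>\<alpha> * real k + y0\<rfloor>" if "k \<le> n" for k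
      using eg[OF that] y unfolding g_def by (intro floor_unique) linarith+
    have "mechanical \<alpha> y k = mechanical \<alpha> y0 k" if "k < n" for k
      unfolding mechanical_def using fl[of k] fl[of "k + 1"] that by simp
    then show ?thesis using y e1 by auto
  qed
  then show ?thesis using \<open>\<epsilon> > 0\<close> by blast
qed

lemma rotation_dense:
  assumes "\<alpha> \<notin> \<rat>" "\<epsilon> > 0"
  shows "\<exists>M. \<forall>y. \<exists>i\<le>M. frac (y + real i * \<alpha>) < \<epsilon>"
proof -
  \<comment> \<open>Approximating \<delta> with an error below \<delta> gives 0 < d < 2 \<delta>,
    and 2 \<delta> is the minimum of \<epsilon> and 1.\<close>
  define \<delta> where "\<delta> = min \<epsilon> 1 / 2"
  have \<delta>: "0 \<le> \<delta>" "\<delta> \<le> 1" "\<delta> > 0" using assms(2) by (auto simp: \<delta>_def)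
  obtain k where k: "k > 0" "\<bar>frac (real k * \<alpha>) - \<delta>\<bar> < \<delta>"
    using Kronecker_approx_1_explicit[OF assms(1) \<delta>] by blast
  define d where "d = frac (real k * \<alpha>)"
  have "0 < d" "d < 2 * \<delta>" using k(2) unfolding d_def by linarith+
  moreover have "2 * \<delta> \<le> \<epsilon>" "2 * \<delta> \<le> 1" by (simp_all add: \<delta>_def)
  ultimately have d: "0 < d" "d < \<epsilon>" "d < 1" by linarith+
  have "\<exists>i\<le>nat \<lceil>1 / d\<rceil> * k. frac (y + real i * \<alpha>) < \<epsilon>" for y
  proof -
    \<comment> \<open>c is the gap from y up to an integer; t is the first number of steps of size d
      that covers it, overshooting by less than d.\<close>
    define c where "c = of_int \<lceil>y\<rceil> - y"
    have c: "0 \<le> c" "c < 1" unfolding c_def by linarith+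
    define t where "t = nat \<lceil>c / d\<rceil>"
    have "0 \<le> c / d" using c d by simp
    then have "real t = of_int \<lceil>c / d\<rceil>" by (simp add: t_def)
    then have "c / d \<le> real t" "real t < c / d + 1" by linarith+
    then have td: "c \<le> real t * d" "real t * d < c + d"
      using d(1) by (simp_all add: pos_divide_le_eq field_simps)
    have "frac (y + real (t * k) * \<alpha>) = real t * d - c"
      unfolding frac_unique_iff
    proof (intro conjI)
      have "y + real (t * k) * \<alpha> - (real t * d - c) = of_int (int t * \<lfloor>real k * \<alpha>\<rfloor> + \<lceil>y\<rceil>)"
        by (simp add: d_def c_def frac_def algebra_simps)
      then show "y + real (t * k) * \<alpha> - (real t * d - c) \<in> \<int>" by (simp only: Ints_of_int)
    qed (use td d in linarith)+
    moreover have "c / d \<le> 1 / d" using c d by (simp add: divide_right_mono)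
    then have "t \<le> nat \<lceil>1 / d\<rceil>" unfolding t_def by (intro nat_mono ceiling_mono)
    then have "t * k \<le> nat \<lceil>1 / d\<rceil> * k" by simp
    ultimately show ?thesis using td d by (intro exI[of _ "t * k"]) auto
  qed
  then show ?thesis by blast
qed

text \<open>M is chosen before y, so that one bound serves the words of all shifts and therefore the
  whole language of the slope.\<close>

lemma mechanical_recurrent:
  assumes "\<alpha> \<notin> \<rat>" "0 \<le> y0" "y0 < 1"
  shows "\<exists>M. \<forall>y. \<exists>i\<le>M. \<forall>k<n. mechanical \<alpha> y (i + k) = mechanical \<alpha> y0 k"
proof -
  obtain \<epsilon> where \<epsilon>: "\<epsilon> > 0" "\<And>y. y0 \<le> y \<Longrightarrow> y < y0 + \<epsilon> \<Longrightarrow> y < 1 \<and> (\<forall>k<n. mechanical \<alpha> y k = mechanical \<alpha> y0 k)"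
    using mechanical_locally_constant[OF assms(3)] by metis
  obtain M where M: "\<And>y. \<exists>i\<le>M. frac (y + real i * \<alpha>) < \<epsilon>" using rotation_dense[OF assms(1) \<epsilon>(1)] by blast
  have "\<exists>i\<le>M. \<forall>k<n. mechanical \<alpha> y (i + k) = mechanical \<alpha> y0 k" for y
  proof -
    \<comment> \<open>Aiming at y - y0 makes the orbit land within \<epsilon> to the right of y0,
      where the first n letters are still those of y0.\<close>
    obtain i where i: "i \<le> M" "frac (y - y0 + real i * \<alpha>) < \<epsilon>" using M by blast
    define u where "u = frac (y - y0 + real i * \<alpha>)"
    have u: "0 \<le> u" "u < \<epsilon>" using i by (simp_all add: u_def)
    then have e: "y0 + u < 1" "\<forall>k<n. mechanical \<alpha> (y0 + u) k = mechanical \<alpha> y0 k" using \<epsilon>(2)[of "y0 + u"] by auto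
    have "frac (\<alpha> * real i + y) = y0 + u"
      unfolding frac_unique_iff
    proof (intro conjI)
      have "\<alpha> * real i + y - (y0 + u) = of_int \<lfloor>y - y0 + real i * \<alpha>\<rfloor>"
        by (simp add: u_def frac_def algebra_simps)
      then show "\<alpha> * real i + y - (y0 + u) \<in> \<int>" by (simp only: Ints_of_int)
    qed (use u e assms in simp_all)
    then show ?thesis using e(2) i(1) by (auto simp: mechanical_shift)
  qed
  then show ?thesis by blast
qed

text \<open>Every word of length \<open>N\<close> can be read off from one of the \<open>N + 1\<close> points of discontinuity.\<close>
lemma mechanical_discontinuity:
  assumes "0 \<le> y" "y < 1"
  shows "\<exists>j\<le>N. \<forall>i<N. mechanical \<alpha> y i = mechanical \<alpha> (frac (- (\<alpha> * real j))) i"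
proof -
  define f where "f j = frac (- (\<alpha> * real j))" for j :: nat
  define J where "J = {j. j \<le> N \<and> f j \<le> y}"
  \<comment> \<open>The word is read from the greatest discontinuity not exceeding y; index 0 is
    always a candidate.\<close>
  have J: "finite J" "0 \<in> J" using assms by (auto simp: J_def f_def)
  have "Max (f ` J) \<in> f ` J" using J by (intro Max_in) auto
  then obtain j where j: "j \<in> J" "f j = Max (f ` J)" by auto
  have jm: "f i \<le> f j" if "i \<in> J" for i unfolding j(2) using J that by (intro Max_ge) auto
  have fl: "\<lfloor>\<alpha> * real i + y\<rfloor> = \<lfloor>\<alpha> * real i + f j\<rfloor>" if "i \<le> N" for i
  proof (rule ccontr)
    assume ne: "\<not> ?thesis"
    have fj: "f j \<le> y" using j(1) by (simp add: J_def)
    have "\<lfloor>\<alpha> * real i + f j\<rfloor> \<le> \<lfloor>\<alpha> * real i + y\<rfloor>" by (intro floor_mono) (simp add: fj)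
    with ne have "\<lfloor>\<alpha> * real i + f j\<rfloor> < \<lfloor>\<alpha> * real i + y\<rfloor>" by simp
    then have lt: "\<alpha> * real i + f j < of_int \<lfloor>\<alpha> * real i + y\<rfloor>" by linarith
    \<comment> \<open>Were the floors different, the point r at which \<alpha> i + r is an integer
      would be a discontinuity above \<open>f j\<close> and not above y, against maximality.\<close>
    define r where "r = of_int \<lfloor>\<alpha> * real i + y\<rfloor> - \<alpha> * real i"
    have r: "f j < r" "r \<le> y" using lt by (simp_all add: r_def) linarith
    have "f i = r" unfolding f_def frac_unique_iff
    proof (intro conjI)
      have "- (\<alpha> * real i) - r = of_int (- \<lfloor>\<alpha> * real i + y\<rfloor>)" by (simp add: r_def)
      then show "- (\<alpha> * real i) - r \<in> \<int>" by (simp only: Ints_of_int)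
      show "0 \<le> r" using r(1) frac_ge_0[of "- (\<alpha> * real j)"] unfolding f_def by linarith
      show "r < 1" using r assms by simp
    qed
    then have "i \<in> J" using r that by (simp add: J_def)
    from jm[OF this] \<open>f i = r\<close> r show False by simp
  qed
  have "mechanical \<alpha> y i = mechanical \<alpha> (f j) i" if "i < N" for i
    unfolding mechanical_def using fl[of i] fl[of "i + 1"] that by simp
  then show ?thesis using j(1) by (auto simp: f_def J_def)
qed

text \<open>Starting at -\<alpha> j means reading the two-sided word of shift 0 from position -j. By
  irrationality \<lfloor>-x\<rfloor> = -\<lfloor>x\<rfloor> - 1 for the multiples x of \<alpha>
  concerned, so the left half is a mirror image: position -1 - q carries the letter of q for q > 0,
  while position -1 carries 1. All factors are thus read off from one computable word.\<close>

lemma mechanical_at_discontinuity: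
  assumes "\<alpha> \<notin> \<rat>" "0 < \<alpha>" "\<alpha> < 1"
  shows "mechanical \<alpha> (frac (- (\<alpha> * real j))) i =
    (if j \<le> i then mechanical \<alpha> 0 (i - j) else if j = Suc i then 1 else mechanical \<alpha> 0 (j - Suc i))"
proof -
  have F: "\<lfloor>\<alpha> * real k + frac (- (\<alpha> * real j))\<rfloor> = \<lfloor>\<alpha> * (real k - real j)\<rfloor> - \<lfloor>- (\<alpha> * real j)\<rfloor>" for k
  proof -
    have "\<alpha> * real k + frac (- (\<alpha> * real j)) = \<alpha> * (real k - real j) + of_int (- \<lfloor>- (\<alpha> * real j)\<rfloor>)"
      by (simp add: frac_def algebra_simps)
    then have "\<lfloor>\<alpha> * real k + frac (- (\<alpha> * real j))\<rfloor> = \<lfloor>\<alpha> * (real k - real j)\<rfloor> + - \<lfloor>- (\<alpha> * real j)\<rfloor>"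
      by (simp only: floor_add_int)
    then show ?thesis by simp
  qed
  have eq: "mechanical \<alpha> (frac (- (\<alpha> * real j))) i = \<lfloor>\<alpha> * (real (i + 1) - real j)\<rfloor> - \<lfloor>\<alpha> * (real i - real j)\<rfloor>"
    unfolding mechanical_def F by simp
  show ?thesis
  proof (cases "j \<le> i")
    case True
    then show ?thesis unfolding eq by (simp add: mechanical_def of_nat_diff algebra_simps)
  next
    case False
    define q where "q = j - Suc i"
    have q: "j = i + 1 + q" using False by (simp add: q_def)
    have neg: "\<lfloor>- (\<alpha> * real k)\<rfloor> = - \<lfloor>\<alpha> * real k\<rfloor> - 1" if "k > 0" for k
    proof -
      have "\<alpha> * real k \<notin> \<int>"
      proof
        assume "\<alpha> * real k \<in> \<int>"
        then have "\<alpha> * real k / real k \<in> \<rat>" by (intro Rats_divide) (auto dest: Ints_subset_Rats[THEN subsetD])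
        then show False using that assms(1) by simp
      qed
      then show ?thesis by (simp add: floor_minus ceiling_altdef) (metis Ints_of_int)
    qed
    have "\<alpha> * (real (i + 1) - real j) = - (\<alpha> * real q)" "\<alpha> * (real i - real j) = - (\<alpha> * real (Suc q))"
      by (simp_all add: q algebra_simps)
    then have e2: "mechanical \<alpha> (frac (- (\<alpha> * real j))) i = \<lfloor>- (\<alpha> * real q)\<rfloor> - \<lfloor>- (\<alpha> * real (Suc q))\<rfloor>"
      unfolding eq by simp
    show ?thesis
    proof (cases "q = 0")
      case True
      have "\<lfloor>\<alpha>\<rfloor> = 0" using assms by (simp add: floor_eq_iff)
      then show ?thesis unfolding e2 using True neg[of 1] q by simp
    next
      case False
      then have "j - Suc i = q" "j \<noteq> Suc i" "\<not> j \<le> i" using q by simp_all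
      then show ?thesis unfolding e2 using neg[of q] neg[of "Suc q"] False by (simp add: mechanical_def)
    qed
  qed
qed

text \<open>Letters as natural numbers, since integers are no instance of
  \<open>enc\<close>.\<close>

definition rot :: "real \<Rightarrow> real \<Rightarrow> nat \<Rightarrow> nat" where
  "rot \<alpha> y n = nat (mechanical \<alpha> y n)"

definition lang :: "real \<Rightarrow> nat list set" where
  "lang \<alpha> = {map (rot \<alpha> y) [0..<n] | y n. 0 \<le> y \<and> y < 1}"

definition factors :: "(nat \<Rightarrow> nat) \<Rightarrow> nat \<Rightarrow> nat list list" where
  "factors c N = map (\<lambda>j. map (\<lambda>i. if j \<le> i then c (i - j) else if j = Suc i then 1 else c (j - Suc i)) [0..<N]) [0..<Suc N]"

lemma int_rot: "0 < \<alpha> \<Longrightarrow> \<alpha> < 1 \<Longrightarrow> int (rot \<alpha> y n) = mechanical \<alpha> y n"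
  unfolding rot_def using mechanical_range[of \<alpha> y n] by auto

lemma rot_shift: "rot \<alpha> \<rho> (n + i) = rot \<alpha> (frac (\<alpha> * real n + \<rho>)) i"
  by (simp add: rot_def mechanical_shift)

lemma map_rot_shift: "map (rot \<alpha> \<rho>) [n..<n + k] = map (rot \<alpha> (frac (\<alpha> * real n + \<rho>))) [0..<k]"
  by (rule nth_equalityI) (simp_all add: rot_shift)

lemma map_rot_in_lang: "map (rot \<alpha> \<rho>) [n..<n + k] \<in> lang \<alpha>"
  unfolding map_rot_shift lang_def by (blast intro: frac_ge_0 frac_lt_1)

lemma lang_factor: "a @ w @ b \<in> lang \<alpha> \<Longrightarrow> w \<in> lang \<alpha>"
proof -
  assume "a @ w @ b \<in> lang \<alpha>"
  then obtain y n where y: "a @ w @ b = map (rot \<alpha> y) [0..<n]" by (auto simp: lang_def)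
  have n: "n = length a + length w + length b" using arg_cong[OF y, of length] by simp
  have "w = take (length w) (drop (length a) (a @ w @ b))" by simp
  also have "\<dots> = map (rot \<alpha> y) [length a..<length a + length w]"
    unfolding y by (simp add: n take_map drop_map)
  finally show ?thesis using map_rot_in_lang by metis
qed

lemma lang_recurrent:
  assumes "\<alpha> \<notin> \<rat>" and "w \<in> lang \<alpha>"
  shows "\<exists>M. \<forall>f\<in>lang \<alpha>. M \<le> length f \<longrightarrow> (\<exists>a b. f = a @ w @ b)"
proof -
  obtain y0 n where w: "w = map (rot \<alpha> y0) [0..<n]" "0 \<le> y0" "y0 < 1" using assms(2) by (auto simp: lang_def)
  obtain M where M: "\<And>y. \<exists>i\<le>M. \<forall>k<n. mechanical \<alpha> y (i + k) = mechanical \<alpha> y0 k"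
    using mechanical_recurrent[OF assms(1) w(2,3), of n] by blast
  have "\<exists>a b. f = a @ w @ b" if f: "f \<in> lang \<alpha>" "M + n \<le> length f" for f
  proof -
    obtain y l where y: "f = map (rot \<alpha> y) [0..<l]" using f(1) by (auto simp: lang_def)
    then have l: "M + n \<le> l" using f(2) by simp
    obtain i where i: "i \<le> M" and "\<forall>k<n. mechanical \<alpha> y (i + k) = mechanical \<alpha> y0 k" using M[of y] by blast
    then have rk: "rot \<alpha> y (i + k) = rot \<alpha> y0 k" if "k < n" for k using that by (simp add: rot_def)
    have "map (rot \<alpha> y) [i..<i + n] = w"
      unfolding w(1) by (rule nth_equalityI) (simp_all add: rk)
    moreover have "[0..<l] = [0..<i] @ [i..<i + n] @ [i + n..<l]"
      using i l upt_add_eq_append[of 0 i "l - i"] upt_add_eq_append[of i "i + n" "l - i - n"] by simp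
    ultimately show ?thesis unfolding y by (metis map_append)
  qed
  then show ?thesis by blast
qed

text \<open>The list runs over the starting points -\<alpha> j modulo 1 for j \<le> N. It is
  assembled from letters of the word of shift 0 alone, without comparing reals.\<close>

lemma set_factors:
  assumes "\<alpha> \<notin> \<rat>" "0 < \<alpha>" "\<alpha> < 1"
  shows "set (factors (rot \<alpha> 0) N) = {f \<in> lang \<alpha>. length f = N}"
proof -
  have eq: "factors (rot \<alpha> 0) N = map (\<lambda>j. map (rot \<alpha> (frac (- (\<alpha> * real j)))) [0..<N]) [0..<Suc N]"
    unfolding factors_def rot_def mechanical_at_discontinuity[OF assms] by (intro map_cong refl) simp
  show ?thesis
  proof (intro equalityI subsetI)
    fix f assume "f \<in> set (factors (rot \<alpha> 0) N)"
    then obtain j where "f = map (rot \<alpha> (frac (- (\<alpha> * real j)))) [0..<N]" unfolding eq by auto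
    then show "f \<in> {f \<in> lang \<alpha>. length f = N}"
      unfolding lang_def using frac_ge_0[of "- (\<alpha> * real j)"] frac_lt_1[of "- (\<alpha> * real j)"]
      by (intro CollectI conjI exI[of _ "frac (- (\<alpha> * real j))"] exI[of _ N]) simp_all
  next
    fix f assume "f \<in> {f \<in> lang \<alpha>. length f = N}"
    then obtain y n where yn: "f = map (rot \<alpha> y) [0..<n]" and y01: "0 \<le> y" "y < 1" and "length f = N"
      unfolding lang_def by blast
    then have "n = N" by simp
    note y = yn[unfolded this] y01
    obtain j where j: "j \<le> N" "\<forall>i<N. mechanical \<alpha> y i = mechanical \<alpha> (frac (- (\<alpha> * real j))) i"
      using mechanical_discontinuity[OF y(2,3), of N \<alpha>] by blast
    have "f = map (rot \<alpha> (frac (- (\<alpha> * real j)))) [0..<N]"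
      unfolding y(1) by (rule map_cong) (use j(2) in \<open>simp_all add: rot_def\<close>)
    then show "f \<in> set (factors (rot \<alpha> 0) N)" unfolding eq set_map
      by (rule image_eqI[of _ _ j]) (use j(1) in auto)
  qed
qed

subsection \<open>Certificates\<close>

text \<open>Type of a one-letter word. The variables placed on the letter are passed as the lists
  \<open>is\<close> and \<open>Ps\<close> instead of interpretations, which makes the function
  computable.\<close>

primrec lt :: "mso \<Rightarrow> nat \<Rightarrow> nat list \<Rightarrow> nat list \<Rightarrow> nat" where
  "lt (Succ p q) b is Ps = pr (of_bool (q \<in> set is)) (pr (of_bool (p \<in> set is)) 0)"
| "lt (Less p q) b is Ps = pr (of_bool (p \<in> set is)) (pr (of_bool (q \<in> set is)) 0)"
| "lt (Eq p q) b is Ps = of_bool (p \<in> set is \<and> q \<in> set is)"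
| "lt (Sym p a) b is Ps = of_bool (p \<in> set is \<and> int b = a)"
| "lt (Mem P p) b is Ps = of_bool (p \<in> set is \<and> P \<in> set Ps)"
| "lt (Neg \<phi>) b is Ps = lt \<phi> b is Ps"
| "lt (Conj \<phi> \<psi>) b is Ps = pr (lt \<phi> b is Ps) (lt \<psi> b is Ps)"
| "lt (Disj \<phi> \<psi>) b is Ps = pr (lt \<phi> b is Ps) (lt \<psi> b is Ps)"
| "lt (Impl \<phi> \<psi>) b is Ps = pr (lt \<phi> b is Ps) (lt \<psi> b is Ps)"
| "lt (ExI p \<phi>) b is Ps = pr (set_encode {lt \<phi> b (p # is) Ps}) (lt \<phi> b (filter (\<lambda>q. q \<noteq> p) is) Ps)"
| "lt (AllI p \<phi>) b is Ps = pr (set_encode {lt \<phi> b (p # is) Ps}) (lt \<phi> b (filter (\<lambda>q. q \<noteq> p) is) Ps)"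
| "lt (ExS P \<phi>) b is Ps = set_encode {lt \<phi> b is (P # Ps), lt \<phi> b is (filter (\<lambda>Q. Q \<noteq> P) Ps)}"
| "lt (AllS P \<phi>) b is Ps = set_encode {lt \<phi> b is (P # Ps), lt \<phi> b is (filter (\<lambda>Q. Q \<noteq> P) Ps)}"

lemma tp_singleton:
  assumes x: "x n = int b" and "\<And>p. n \<in> I p \<longleftrightarrow> p \<in> set is" and "\<And>P. n \<in> V P \<longleftrightarrow> P \<in> set Ps"
  shows "tp \<phi> x I V {n} = lt \<phi> b is Ps"
proof -
  define ok where "ok \<phi> \<longleftrightarrow> (\<forall>I V is Ps. (\<forall>p. n \<in> I p \<longleftrightarrow> p \<in> set is) \<longrightarrow> (\<forall>P. n \<in> V P \<longleftrightarrow> P \<in> set Ps) \<longrightarrow>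
    tp \<phi> x I V {n} = lt \<phi> b is Ps)" for \<phi>
  have okD: "tp \<phi> x I V {n} = lt \<phi> b is Ps" if "ok \<phi>" "\<forall>p. n \<in> I p \<longleftrightarrow> p \<in> set is" "\<forall>P. n \<in> V P \<longleftrightarrow> P \<in> set Ps"
    for \<phi> I V "is" Ps
    using that unfolding ok_def by blast
  have I: "ok (ExI p \<phi>)" if "ok \<phi>" for p \<phi>
    unfolding ok_def
  proof (intro allI impI)
    fix I V :: "nat \<Rightarrow> nat set" and "is" Ps
    assume IV: "\<forall>p. n \<in> I p \<longleftrightarrow> p \<in> set is" "\<forall>P. n \<in> V P \<longleftrightarrow> P \<in> set Ps"
    have "tp \<phi> x (I(p := {n})) V {n} = lt \<phi> b (p # is) Ps"
      "tp \<phi> x (I(p := {})) V {n} = lt \<phi> b (filter (\<lambda>q. q \<noteq> p) is) Ps"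
      by (rule okD[OF \<open>ok \<phi>\<close>]; simp add: IV)+
    then show "tp (ExI p \<phi>) x I V {n} = lt (ExI p \<phi>) b is Ps" by simp
  qed
  have S: "ok (ExS P \<phi>)" if "ok \<phi>" for P \<phi>
    unfolding ok_def
  proof (intro allI impI)
    fix I V :: "nat \<Rightarrow> nat set" and "is" Ps
    assume IV: "\<forall>p. n \<in> I p \<longleftrightarrow> p \<in> set is" "\<forall>P. n \<in> V P \<longleftrightarrow> P \<in> set Ps"
    have 1: "tp \<phi> x I (V(P := M)) {n} = lt \<phi> b is (P # Ps)" if "n \<in> M" for M
      by (rule okD[OF \<open>ok \<phi>\<close>]) (simp_all add: that IV)
    have 2: "tp \<phi> x I (V(P := M)) {n} = lt \<phi> b is (filter (\<lambda>Q. Q \<noteq> P) Ps)" if "n \<notin> M" for M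
      by (rule okD[OF \<open>ok \<phi>\<close>]) (simp_all add: that IV)
    have "tp \<phi> x I (V(P := M)) {n} \<in> {lt \<phi> b is (P # Ps), lt \<phi> b is (filter (\<lambda>Q. Q \<noteq> P) Ps)}" for M
      using 1[of M] 2[of M] by (cases "n \<in> M") simp_all
    moreover have "lt \<phi> b is (P # Ps) = tp \<phi> x I (V(P := {n})) {n}" using 1[of "{n}"] by simp
    moreover have "lt \<phi> b is (filter (\<lambda>Q. Q \<noteq> P) Ps) = tp \<phi> x I (V(P := {})) {n}" using 2[of "{}"] by simp
    ultimately have "range (\<lambda>M. tp \<phi> x I (V(P := M)) {n}) = {lt \<phi> b is (P # Ps), lt \<phi> b is (filter (\<lambda>Q. Q \<noteq> P) Ps)}"
      by blast
    then show "tp (ExS P \<phi>) x I V {n} = lt (ExS P \<phi>) b is Ps" by (simp only: tp.simps lt.simps)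
  qed
  have "ok \<phi>"
  proof (induction \<phi>)
    case (AllI p \<phi>)
    show ?case using I[OF AllI, of p] by (simp add: ok_def)
  next
    case (AllS P \<phi>)
    show ?case using S[OF AllS, of P] by (simp add: ok_def)
  qed (simp_all add: I S, auto simp: ok_def x)
  then show ?thesis by (rule okD) (simp_all add: assms)
qed

text \<open>The type of a finite word without variables, computed letter by letter; 0 is a dummy
  value for the empty word.\<close>

definition hw :: "mso \<Rightarrow> nat list \<Rightarrow> nat" where
  "hw \<phi> w = (case w of [] \<Rightarrow> 0 | b # bs \<Rightarrow> foldl (\<lambda>t b. mult \<phi> t (lt \<phi> b [] [])) (lt \<phi> b [] []) bs)"

lemma hw_snoc: "w \<noteq> [] \<Longrightarrow> hw \<phi> (w @ [b]) = mult \<phi> (hw \<phi> w) (lt \<phi> b [] [])"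
  by (cases w) (simp_all add: hw_def)

abbreviation wtp :: "mso \<Rightarrow> (nat \<Rightarrow> nat) \<Rightarrow> nat set \<Rightarrow> nat" where
  "wtp \<phi> x D \<equiv> tp \<phi> (\<lambda>n. int (x n)) (\<lambda>_. {}) (\<lambda>_. {}) D"

lemma wtp_hw: "i < j \<Longrightarrow> wtp \<phi> x {i..<j} = hw \<phi> (map x [i..<j])"
proof (induction j)
  case (Suc j)
  have 1: "wtp \<phi> x {j} = lt \<phi> (x j) [] []" by (rule tp_singleton) auto
  show ?case
  proof (cases "i = j")
    case True
    then show ?thesis using 1 by (simp add: hw_def)
  next
    case False
    then have "i < j" using Suc.prems by simp
    have "wtp \<phi> x {i..<Suc j} = mult \<phi> (wtp \<phi> x {i..<j}) (wtp \<phi> x {j..<Suc j})"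
      by (rule tp_split_fin) (use \<open>i < j\<close> in auto)
    also have "\<dots> = mult \<phi> (hw \<phi> (map x [i..<j])) (lt \<phi> (x j) [] [])"
      using Suc.IH[OF \<open>i < j\<close>] 1 by simp
    also have "\<dots> = hw \<phi> (map x [i..<Suc j])"
      using hw_snoc[of "map x [i..<j]"] \<open>i < j\<close> by simp
    finally show ?thesis .
  qed
qed simp

lemma map_nth_append1: "map (\<lambda>n. (u @ v) ! n) [0..<length u] = u"
  by (rule nth_equalityI) (simp_all add: nth_append)

lemma map_nth_append2: "map (\<lambda>n. (u @ v) ! n) [length u..<length u + length v] = v"
  by (rule nth_equalityI) (simp_all add: nth_append)

text \<open>Two words are laid side by side as one word, so multiplicativity is inherited from
  \<open>tp_split_fin\<close>.\<close>

interpretation hw: word_hom "hw \<phi>" "mult \<phi>" for \<phi>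
proof
  show "hw \<phi> (u @ v) = mult \<phi> (hw \<phi> u) (hw \<phi> v)" if "u \<noteq> []" "v \<noteq> []" for u v
  proof -
    let ?x = "\<lambda>n. (u @ v) ! n"
    have "map ?x [0..<length u + length v] = u @ v" by (metis length_append map_nth)
    then have "hw \<phi> (u @ v) = wtp \<phi> ?x {0..<length u + length v}"
      using wtp_hw[of 0 "length u + length v" \<phi> ?x] that by simp
    also have "\<dots> = mult \<phi> (wtp \<phi> ?x {0..<length u}) (wtp \<phi> ?x {length u..<length u + length v})"
      by (rule tp_split_fin) (use that in auto)
    also have "\<dots> = mult \<phi> (hw \<phi> u) (hw \<phi> v)"
      using that by (simp add: wtp_hw map_nth_append1 map_nth_append2)
    finally show ?thesis .
  qed
  show "finite (range (hw \<phi>))"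
  proof (rule finite_subset[of _ "insert 0 (types \<phi>)"])
    show "range (hw \<phi>) \<subseteq> insert 0 (types \<phi>)"
    proof
      fix t assume "t \<in> range (hw \<phi>)"
      then obtain w where w: "t = hw \<phi> w" by blast
      show "t \<in> insert 0 (types \<phi>)"
      proof (cases "w = []")
        case True then show ?thesis by (simp add: w hw_def)
      next
        case False
        then have "t = wtp \<phi> (\<lambda>n. w ! n) {0..<length w}"
          using wtp_hw[of 0 "length w" \<phi> "\<lambda>n. w ! n"] by (simp add: w map_nth)
        then show ?thesis by simp
      qed
    qed
  qed (simp add: finite_types)
qed

section \<open>Periodic words and infinite powers of group elements\<close>

lemma map_periodic: "u \<noteq> [] \<Longrightarrow> map (\<lambda>n. u ! (n mod length u)) [i * length u..<(i + k) * length u] = wpow u k"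
proof (induction k)
  case (Suc k)
  let ?l = "length u" and ?x = "\<lambda>n. u ! (n mod length u)"
  have "[i * ?l..<(i + Suc k) * ?l] = [i * ?l..<(i + k) * ?l] @ [(i + k) * ?l..<(i + k) * ?l + ?l]"
    using upt_add_eq_append[of "i * ?l" "(i + k) * ?l" ?l] by (simp add: algebra_simps)
  moreover have "map ?x [(i + k) * ?l..<(i + k) * ?l + ?l] = u"
    by (rule nth_equalityI) simp_all
  ultimately show ?case using Suc by (simp add: wpow_comm)
qed simp

lemma omega_hw:
  assumes "strict_mono c" and "\<And>k. hw \<phi> (map x [c k..<c (Suc k)]) = e" and "mult \<phi> e e = e"
  shows "wtp \<phi> x {c 0..} = omega \<phi> e"
  by (rule tp_omega[OF assms(1) _ assms(3)])
    (use assms(1,2) in \<open>simp add: wtp_hw strict_mono_less\<close>)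

text \<open>An element of the group with unit \<open>E\<close> is absorbed by the infinite power of \<open>E\<close>, as both are
  read off from the same periodic word.\<close>
lemma grp_omega:
  assumes E: "E \<noteq> []" and u: "hw.grp \<phi> E u" and EE: "hw \<phi> (E @ E) = hw \<phi> E"
  shows "mult \<phi> (hw \<phi> u) (omega \<phi> (hw \<phi> E)) = omega \<phi> (hw \<phi> E)"
proof -
  have nu: "u \<noteq> []" using u unfolding hw.grp_def by blast
  have e: "mult \<phi> (hw \<phi> E) (hw \<phi> E) = hw \<phi> E" using EE hw.hom[OF E E] by simp
  obtain k where k: "k > 0" "hw \<phi> (wpow u k) = hw \<phi> E" using hw.grp_power[OF E u] by blast
  let ?l = "length u"
  let ?x = "\<lambda>n. u ! (n mod ?l)"
  \<comment> \<open>Blocks of k periods have the type of \<open>E\<close>, whichever period is the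
    first. Comparing i = 0 with i = 1 below shows that the first \<open>u\<close> is
    absorbed.\<close>
  have om: "wtp \<phi> ?x {i * ?l..} = omega \<phi> (hw \<phi> E)" for i
  proof -
    have "wtp \<phi> ?x {(\<lambda>j. (i + j * k) * ?l) 0..} = omega \<phi> (hw \<phi> E)"
    proof (rule omega_hw[OF _ _ e])
      show "strict_mono (\<lambda>j. (i + j * k) * ?l)" using nu k(1) by (simp add: strict_mono_def)
      show "hw \<phi> (map ?x [(i + j * k) * ?l..<(i + Suc j * k) * ?l]) = hw \<phi> E" for j
        using map_periodic[OF nu, of "i + j * k" k] k(2) by (simp add: algebra_simps)
    qed
    then show ?thesis by simp
  qed
  have "wtp \<phi> ?x {0..} = mult \<phi> (wtp \<phi> ?x {0..<?l}) (wtp \<phi> ?x {?l..})"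
    by (rule tp_split_inf) (use nu in simp)
  moreover have "wtp \<phi> ?x {0..<?l} = hw \<phi> u"
    using map_periodic[OF nu, of 0 1] nu by (simp add: wtp_hw)
  ultimately show ?thesis using om[of 0] om[of 1] by simp
qed

text \<open>The exponent is n + 1, as there is no unit to serve as power 0.\<close>

definition pow :: "mso \<Rightarrow> nat \<Rightarrow> nat \<Rightarrow> nat" where
  "pow \<phi> g n = rec_nat g (\<lambda>_ t. mult \<phi> t g) n"

lemma pow_hw: "u \<noteq> [] \<Longrightarrow> pow \<phi> (hw \<phi> u) n = hw \<phi> (wpow u (Suc n))"
proof (induction n)
  case (Suc n)
  have "hw \<phi> (wpow u (Suc n) @ u) = mult \<phi> (hw \<phi> (wpow u (Suc n))) (hw \<phi> u)"
    using Suc.prems by (intro hw.hom) simp_all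
  moreover have "wpow u (Suc (Suc n)) = wpow u (Suc n) @ u"
    unfolding wpow_comm[of u "Suc n", symmetric] by simp
  moreover have "pow \<phi> (hw \<phi> u) (Suc n) = mult \<phi> (pow \<phi> (hw \<phi> u) n) (hw \<phi> u)" by (simp add: pow_def)
  ultimately show ?case using Suc.IH[OF Suc.prems] by (simp only:)
qed (simp add: pow_def)

text \<open>
  A certificate consists of a length \<open>l\<close> and a group unit \<open>e\<close>: any occurrence of the prefix \<open>W\<close> of
  length \<open>2 l\<close> is followed by another one such that the factor between their midpoints has a type in
  the group of \<open>e\<close>. The numbers \<open>N\<close> and \<open>B\<close> bound the searches.
\<close>
definition cert :: "nat list list \<Rightarrow> nat list \<Rightarrow> mso \<Rightarrow> nat \<Rightarrow> nat \<Rightarrow> nat \<Rightarrow> nat \<Rightarrow> bool" where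
  "cert F W \<phi> l N B e \<longleftrightarrow> 0 < l \<and> 2 * l \<le> N \<and>
     (\<forall>f\<in>set F. take (2 * l) f = W \<longrightarrow>
       (\<exists>i<N. i + 2 * l \<le> N \<and> 0 < i \<and> take (2 * l) (drop i f) = W \<and>
         mult \<phi> (hw \<phi> (take i (drop l f))) e = hw \<phi> (take i (drop l f)) \<and>
         (\<exists>n<B. pow \<phi> (hw \<phi> (take i (drop l f))) n = e)))"

lemma take_drop_map_upt: "a + b \<le> n \<Longrightarrow> take b (drop a (map x [i..<i + n])) = map x [i + a..<i + a + b]"
  by (simp add: take_map drop_map)

text \<open>Every window of length N is a listed factor, so each occurrence of the prefix leads to a
  later one; a chain of occurrences starting at 0 cuts the whole word at its midpoints.\<close>

theorem cert_sound:
  assumes F: "\<And>i. map x [i..<i + N] \<in> set F"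
    and cert: "cert F (map x [0..<2 * l]) \<phi> l N B e"
  shows "wtp \<phi> x {0..} = mult \<phi> (hw \<phi> (map x [0..<l])) (omega \<phi> e)"
proof -
  let ?W = "map x [0..<2 * l]"
  let ?g = "\<lambda>i j. map x [i + l..<i + l + j]"
  have l: "0 < l" "2 * l \<le> N" using cert by (auto simp: cert_def)
  have step: "\<exists>j>0. map x [i + j..<i + j + 2 * l] = ?W \<and> mult \<phi> (hw \<phi> (?g i j)) e = hw \<phi> (?g i j)
      \<and> (\<exists>n. pow \<phi> (hw \<phi> (?g i j)) n = e)" if "map x [i..<i + 2 * l] = ?W" for i
  proof -
    let ?f = "map x [i..<i + N]"
    have "take (2 * l) ?f = ?W" using take_drop_map_upt[of 0 "2 * l" N x i] l that by simp
    then obtain j where j: "j + 2 * l \<le> N" "0 < j" "take (2 * l) (drop j ?f) = ?W"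
        "mult \<phi> (hw \<phi> (take j (drop l ?f))) e = hw \<phi> (take j (drop l ?f))"
        "\<exists>n. pow \<phi> (hw \<phi> (take j (drop l ?f))) n = e"
      using cert F[of i] unfolding cert_def by blast
    have "take (2 * l) (drop j ?f) = map x [i + j..<i + j + 2 * l]" "take j (drop l ?f) = ?g i j"
      using j(1) by (intro take_drop_map_upt; simp)+
    with j show ?thesis by (intro exI[of _ j]) simp
  qed
  define nx where "nx i = (SOME j. j > 0 \<and> map x [i + j..<i + j + 2 * l] = ?W \<and>
    mult \<phi> (hw \<phi> (?g i j)) e = hw \<phi> (?g i j) \<and> (\<exists>n. pow \<phi> (hw \<phi> (?g i j)) n = e))" for i
  have nx: "nx i > 0" "map x [i + nx i..<i + nx i + 2 * l] = ?W"
    "mult \<phi> (hw \<phi> (?g i (nx i))) e = hw \<phi> (?g i (nx i))" "\<exists>n. pow \<phi> (hw \<phi> (?g i (nx i))) n = e"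
    if "map x [i..<i + 2 * l] = ?W" for i
    using someI_ex[OF step[OF that]] unfolding nx_def by blast+
  define pos where "pos = rec_nat 0 (\<lambda>_ i. i + nx i)"
  have pos: "pos 0 = 0" "pos (Suc k) = pos k + nx (pos k)" for k by (simp_all add: pos_def)
  have W: "map x [pos k..<pos k + 2 * l] = ?W" for k
  proof (induction k)
    case (Suc k) from nx(2)[OF this] show ?case by (simp add: pos)
  qed (simp add: pos)
  \<comment> \<open>The cuts are the midpoints of the occurrences; the first one is l, which leaves
    the prefix of length l.\<close>
  define c where "c k = pos k + l" for k
  have sm: "strict_mono c"
    unfolding strict_mono_Suc_iff c_def using nx(1)[OF W] by (simp add: pos)
  define blk where "blk i j = map x [c i..<c j]" for i j
  have blk: "blk k (Suc k) = ?g (pos k) (nx (pos k))" for k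
    by (simp add: blk_def c_def pos add.commute add.left_commute)
  have ne: "blk i j \<noteq> []" if "i < j" for i j
  proof -
    have "c i < c j" using sm that by (simp only: strict_mono_less)
    then show ?thesis by (simp add: blk_def)
  qed
  have app: "blk i j @ blk j k = blk i k" if "i < j" "j < k" for i j k
    unfolding blk_def map_append[symmetric] using sm that
    by (intro arg_cong[of _ _ "map x"]) (metis le_add_diff_inverse less_imp_le_nat strict_mono_less upt_add_eq_append)
  have b1: "mult \<phi> (hw \<phi> (blk k (Suc k))) e = hw \<phi> (blk k (Suc k))" "\<exists>n. pow \<phi> (hw \<phi> (blk k (Suc k))) n = e" for k
    unfolding blk using nx(3,4)[OF W] by blast+
  obtain n where n: "pow \<phi> (hw \<phi> (blk 0 1)) n = e" using b1(2)[of 0] by auto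
  \<comment> \<open>A certificate names only the number e; a power of the first block is a word of
    that type, which the group lemmas require.\<close>
  define E where "E = wpow (blk 0 1) (Suc n)"
  have E: "E \<noteq> []" using ne[of 0 1] by (simp add: E_def)
  have e: "hw \<phi> E = e" using n pow_hw[OF ne[of 0 1]] by (simp add: E_def)
  have g1: "hw.grp \<phi> E (blk k (Suc k))" for k
  proof -
    obtain n where n: "pow \<phi> (hw \<phi> (blk k (Suc k))) n = e" using b1(2) by blast
    show ?thesis
    proof (rule hw.grpI[OF ne E])
      show "hw \<phi> (blk k (Suc k) @ E) = hw \<phi> (blk k (Suc k))"
        using hw.hom[OF ne E, of k "Suc k"] b1(1)[of k] e by simp
      show "hw \<phi> (wpow (blk k (Suc k)) (Suc n)) = hw \<phi> E" using n e pow_hw[OF ne[of k "Suc k"]] by simp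
    qed simp
  qed
  have g: "hw.grp \<phi> E (blk i (Suc i + d))" for i d
  proof (induction d)
    case 0 show ?case using g1 by simp
  next
    case (Suc d)
    have "hw.grp \<phi> E (blk i (Suc i + d) @ blk (Suc i + d) (Suc (Suc i + d)))"
      by (intro hw.grp_append E Suc g1)
    then show ?case using app[of i "Suc i + d" "Suc (Suc i + d)"] by simp
  qed
  have grp: "hw.grp \<phi> E (blk i j)" if "i < j" for i j
    using g[of i "j - Suc i"] that by simp
  have EE: "hw \<phi> (E @ E) = hw \<phi> E"
  proof -
    obtain v where v: "v \<noteq> []" "hw \<phi> (blk 0 1 @ v) = hw \<phi> E"
      using grp[of 0 1] unfolding hw.grp_def by auto
    have "hw \<phi> (E @ blk 0 1) = hw \<phi> (blk 0 1)" using grp[of 0 1] unfolding hw.grp_def by auto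
    then have "hw \<phi> (E @ blk 0 1 @ v) = hw \<phi> (blk 0 1 @ v)"
      using hw.ctxr[of \<phi> "E @ blk 0 1" "blk 0 1" v] E ne[of 0 1] by simp
    moreover have "hw \<phi> (E @ blk 0 1 @ v) = hw \<phi> (E @ E)"
      by (rule hw.ctxl[OF v(2)]) (use v(1) E in auto)
    ultimately show ?thesis using v(2) by simp
  qed
  have ee: "mult \<phi> e e = e" using EE hw.hom[OF E E] e by simp
  have tpb: "wtp \<phi> x {c i..<c j} = hw \<phi> (blk i j)" if "i < j" for i j
    unfolding blk_def by (rule wtp_hw) (use sm that in \<open>simp add: strict_mono_less\<close>)
  \<comment> \<open>The blocks have various types in the group. Regrouping makes them equal, and
    their common type is idempotent, hence e.\<close>
  obtain d :: "nat \<Rightarrow> nat" and t where d: "strict_mono d"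
      and t: "\<And>i j. i < j \<Longrightarrow> wtp \<phi> x {c (d i)..<c (d j)} = t"
    using ramsey_blocks[OF sm, of \<phi> "\<lambda>n. int (x n)" "\<lambda>_. {}" "\<lambda>_. {}"] by blast
  have dl: "d i < d j" if "i < j" for i j using d that by (simp add: strict_mono_less)
  have tb: "hw \<phi> (blk (d i) (d j)) = t" if "i < j" for i j
    using tpb[OF dl[OF that]] t[OF that] by simp
  have "hw \<phi> (blk (d 0) (d 1) @ blk (d 0) (d 1)) = hw \<phi> (blk (d 0) (d 1) @ blk (d 1) (d 2))"
    using tb[of 0 1] tb[of 1 2] ne[OF dl] by (intro hw.ctxl) simp_all
  also have "\<dots> = hw \<phi> (blk (d 0) (d 1))" using app[OF dl dl, of 0 1 2] tb[of 0 1] tb[of 0 2] by simp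
  finally have uu: "hw \<phi> (blk (d 0) (d 1) @ blk (d 0) (d 1)) = hw \<phi> (blk (d 0) (d 1))" .
  have "hw \<phi> (blk (d 0) (d 1)) = hw \<phi> E"
    by (rule hw.grp_idempotent[OF E grp uu]) (simp add: dl)
  then have te: "t = e" using tb[of 0 1] e by simp
  have tail: "wtp \<phi> x {c (d 1)..} = omega \<phi> e"
  proof -
    have "wtp \<phi> x {(\<lambda>k. c (d (Suc k))) 0..} = omega \<phi> e"
    proof (rule omega_hw[OF _ _ ee])
      show "strict_mono (\<lambda>k. c (d (Suc k)))" using sm d by (simp add: strict_mono_def)
      show "hw \<phi> (map x [c (d (Suc k))..<c (d (Suc (Suc k)))]) = e" for k
        using tb[of "Suc k" "Suc (Suc k)"] te by (simp add: blk_def)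
    qed
    then show ?thesis by simp
  qed
  \<comment> \<open>The stretch from \<open>c 0\<close> to \<open>c (d 1)\<close> is a group element
    too and is absorbed, so the position of the regrouped cuts, which is not computed, has no
    influence.\<close>
  have d1: "0 < d 1" using dl[of 0 1] by simp
  then have "wtp \<phi> x {c 0..} = mult \<phi> (hw \<phi> (blk 0 (d 1))) (omega \<phi> e)"
    using tp_split_inf[of "c 0" "c (d 1)" \<phi> "\<lambda>n. int (x n)"] sm tail tpb[OF d1] by (simp add: strict_mono_less)
  also have "\<dots> = omega \<phi> e" using grp_omega[OF E grp[OF d1] EE] e by simp
  finally have "wtp \<phi> x {l..} = omega \<phi> e" by (simp add: c_def pos)
  then show ?thesis using tp_split_inf[of 0 l \<phi> "\<lambda>n. int (x n)"] l by (simp add: wtp_hw)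
qed

text \<open>l comes from \<open>uniform_group\<close>, N from a recurrence bound for the prefix of
  length 2 l, and e is the type of the common unit of all blocks.\<close>

theorem cert_complete:
  assumes \<alpha>: "\<alpha> \<notin> \<rat>" and F: "\<And>N. set (F N) = {f \<in> lang \<alpha>. length f = N}"
  shows "\<exists>l N B e. cert (F N) (map (rot \<alpha> \<rho>) [0..<2 * l]) \<phi> l N B e"
proof -
  have in_lang: "map (rot \<alpha> \<rho>) [n..<n + k] \<in> lang \<alpha>" for n k by (rule map_rot_in_lang)
  have "\<exists>l>0. \<forall>w1 w2. length w1 = l \<longrightarrow> length w2 = l \<longrightarrow> w1 @ w2 \<in> lang \<alpha> \<longrightarrow>
    (\<exists>E. E \<noteq> [] \<and> (\<forall>v r r'. w1 @ v @ w2 \<in> lang \<alpha> \<longrightarrow> v = w2 @ r \<longrightarrow> v = r' @ w1 \<longrightarrow>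
       hw \<phi> (v @ E) = hw \<phi> v \<and> (\<exists>n. hw \<phi> (wpow v (Suc n)) = hw \<phi> E)))"
  proof (rule hw.uniform_group)
    show "map (rot \<alpha> \<rho>) [0..<0 + 1] \<in> lang \<alpha>" by (rule in_lang)
  qed (use lang_factor lang_recurrent[OF \<alpha>] in auto)
  then obtain l where l: "l > 0" and grp: "\<And>w1 w2. length w1 = l \<Longrightarrow> length w2 = l \<Longrightarrow> w1 @ w2 \<in> lang \<alpha> \<Longrightarrow>
    (\<exists>E. E \<noteq> [] \<and> (\<forall>v r r'. w1 @ v @ w2 \<in> lang \<alpha> \<longrightarrow> v = w2 @ r \<longrightarrow> v = r' @ w1 \<longrightarrow>
       hw \<phi> (v @ E) = hw \<phi> v \<and> (\<exists>n. hw \<phi> (wpow v (Suc n)) = hw \<phi> E)))" by blast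
  define w1 where "w1 = map (rot \<alpha> \<rho>) [0..<l]"
  define w2 where "w2 = map (rot \<alpha> \<rho>) [l..<2 * l]"
  define W where "W = map (rot \<alpha> \<rho>) [0..<2 * l]"
  have len: "length w1 = l" "length w2 = l" by (simp_all add: w1_def w2_def)
  have W: "W = w1 @ w2"
    using upt_add_eq_append[of 0 l l] by (simp add: W_def w1_def w2_def mult_2)
  have WL: "W \<in> lang \<alpha>" using in_lang[of 0 "2 * l"] by (simp add: W_def)
  obtain E where E: "E \<noteq> []" and Eg: "\<And>v r r'. w1 @ v @ w2 \<in> lang \<alpha> \<Longrightarrow> v = w2 @ r \<Longrightarrow> v = r' @ w1 \<Longrightarrow>
       hw \<phi> (v @ E) = hw \<phi> v \<and> (\<exists>n. hw \<phi> (wpow v (Suc n)) = hw \<phi> E)"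
    using grp[OF len] WL unfolding W by blast
  obtain M where M: "\<And>f. f \<in> lang \<alpha> \<Longrightarrow> M \<le> length f \<Longrightarrow> \<exists>a b. f = a @ W @ b"
    using lang_recurrent[OF \<alpha> WL] by blast
  \<comment> \<open>At least M letters remain after dropping l, which guarantees a further
    occurrence of \<open>W\<close>.\<close>
  define N where "N = M + 2 * l + 1"
  let ?e = "hw \<phi> E"
  let ?g = "\<lambda>f i. hw \<phi> (take i (drop l f))"
  have step: "\<exists>i<N. i + 2 * l \<le> N \<and> 0 < i \<and> take (2 * l) (drop i f) = W \<and>
      mult \<phi> (?g f i) ?e = ?g f i \<and> (\<exists>n. pow \<phi> (?g f i) n = ?e)"
    if f: "f \<in> set (F N)" "take (2 * l) f = W" for f
  proof -
    have fL: "f \<in> lang \<alpha>" and fN: "length f = N" using f(1) F by auto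
    have "take l f @ drop l f @ [] \<in> lang \<alpha>" using fL by simp
    then have "drop l f \<in> lang \<alpha>" by (rule lang_factor)
    moreover have "M \<le> length (drop l f)" by (simp add: fN N_def)
    \<comment> \<open>Searching from position l on forces i \<ge> l, so that the block
      \<open>v\<close> is long enough to begin with \<open>w2\<close>.\<close>
    ultimately obtain a b where ab: "drop l f = a @ W @ b" using M by blast
    define i where "i = l + length a"
    have lf: "length f - l = length a + 2 * l + length b" using arg_cong[OF ab, of length] len by (simp add: W)
    then have iN: "i + 2 * l \<le> N" "i < N" "0 < i" using l by (simp_all add: i_def fN)
    have fa: "f = take l f @ a @ W @ b" using ab append_take_drop_id[of l f] by simp
    have dr: "drop i f = W @ b"
    proof -
      have "drop i f = drop (length a) (drop l f)" by (simp add: i_def add.commute)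
      then show ?thesis by (simp add: ab)
    qed
    have tk: "take (2 * l) (drop i f) = W" using dr len by (simp add: W)
    have tl: "take l f = w1" using arg_cong[OF f(2), of "take l"] len by (simp add: W min_def split: if_splits)
    define v where "v = take i (drop l f)"
    have v1: "v = a @ w1" using len by (simp add: v_def ab W i_def)
    have "w1 @ v @ w2 = take (i + 2 * l) f"
    proof -
      have "take (i + 2 * l) f = take i f @ take (2 * l) (drop i f)" by (rule take_add)
      also have "take i f = w1 @ a"
      proof -
        have "take i f = take l f @ take (length a) (drop l f)" unfolding i_def by (rule take_add)
        then show ?thesis by (simp add: tl ab)
      qed
      finally show ?thesis by (simp add: tk v1 W)
    qed
    then have vL: "w1 @ v @ w2 \<in> lang \<alpha>"
      using lang_factor[of "[]" "take (i + 2 * l) f" "drop (i + 2 * l) f"] fL by simp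
    have "take l v = w2"
    proof -
      have "take l v = take l (drop l f)" by (simp add: v_def i_def)
      also have "\<dots> = drop l (take (2 * l) f)" by (simp add: drop_take mult_2)
      also have "\<dots> = w2" using len by (simp add: f(2) W)
      finally show ?thesis .
    qed
    then have v2: "v = w2 @ drop l v" by (metis append_take_drop_id)
    have nv: "v \<noteq> []" using v1 len l by auto
    obtain n where n: "hw \<phi> (v @ E) = hw \<phi> v" "hw \<phi> (wpow v (Suc n)) = hw \<phi> E"
      using Eg[OF vL v2 v1] by blast
    then have "mult \<phi> (hw \<phi> v) ?e = hw \<phi> v" "pow \<phi> (hw \<phi> v) n = ?e"
      using hw.hom[OF nv E] pow_hw[OF nv] by simp_all
    then show ?thesis using iN tk by (intro exI[of _ i]) (auto simp: v_def)
  qed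
  define Q where "Q f i n \<longleftrightarrow> i < N \<and> i + 2 * l \<le> N \<and> 0 < i \<and> take (2 * l) (drop i f) = W \<and>
      mult \<phi> (?g f i) ?e = ?g f i \<and> pow \<phi> (?g f i) n = ?e" for f i n
  have "\<forall>f. \<exists>i n. f \<in> set (F N) \<longrightarrow> take (2 * l) f = W \<longrightarrow> Q f i n"
    using step unfolding Q_def by blast
  then obtain ci cn where c: "\<And>f. f \<in> set (F N) \<Longrightarrow> take (2 * l) f = W \<Longrightarrow> Q f (ci f) (cn f)" by metis
  define B where "B = Suc (Max (insert 0 (cn ` set (F N))))"
  have B: "cn f < B" if "f \<in> set (F N)" for f
    unfolding B_def using that by (intro le_imp_less_Suc Max_ge) auto
  have "cert (F N) W \<phi> l N B ?e"
    unfolding cert_def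
  proof (intro conjI ballI impI l)
    show "2 * l \<le> N" by (simp add: N_def)
    fix f assume f: "f \<in> set (F N)" "take (2 * l) f = W"
    show "\<exists>i<N. i + 2 * l \<le> N \<and> 0 < i \<and> take (2 * l) (drop i f) = W \<and>
         mult \<phi> (?g f i) ?e = ?g f i \<and> (\<exists>n<B. pow \<phi> (?g f i) n = ?e)"
      using c[OF f] B[OF f(1)] unfolding Q_def by blast
  qed
  then show ?thesis unfolding W_def by blast
qed

subsection \<open>Computing with types\<close>

text \<open>Compound formulas have nonzero tags, so their codes exceed those of their subformulas.
  With tag 0 this could fail, as 0 codes the pair (0, 0).\<close>

lemma rgt_less: "lft c \<noteq> 0 \<Longrightarrow> rgt c < c"
proof -
  assume "lft c \<noteq> 0"
  obtain a b where c: "c = pr a b" by (metis prod_decode_inverse surj_pair)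
  then have "a \<noteq> 0" "rgt c = b" using \<open>lft c \<noteq> 0\<close> by simp_all
  moreover have "n \<le> triangle n" for n by (induction n) simp_all
  then have "a + b \<le> triangle (a + b)" .
  moreover have "c = triangle (a + b) + a" unfolding c by (simp add: prod_encode_def)
  ultimately show ?thesis by linarith
qed

lemma lft_le: "lft c \<le> c" and rgt_le: "rgt c \<le> c"
  using le_prod_encode_1[of "lft c" "rgt c"] le_prod_encode_2[of "rgt c" "lft c"] by simp_all

text \<open>A total inverse of \<^const>\<open>mso_encode\<close>; codes with a tag beyond 12 are read as set quantifications.\<close>
function mso_decode :: "nat \<Rightarrow> mso" where
  "mso_decode c = (if lft c = 0 then Succ (lft (rgt c)) (rgt (rgt c))
    else if lft c = 1 then Less (lft (rgt c)) (rgt (rgt c))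
    else if lft c = 2 then Eq (lft (rgt c)) (rgt (rgt c))
    else if lft c = 3 then Sym (lft (rgt c)) (int_decode (rgt (rgt c)))
    else if lft c = 4 then Mem (lft (rgt c)) (rgt (rgt c))
    else if lft c = 5 then Neg (mso_decode (rgt c))
    else if lft c = 6 then Conj (mso_decode (lft (rgt c))) (mso_decode (rgt (rgt c)))
    else if lft c = 7 then Disj (mso_decode (lft (rgt c))) (mso_decode (rgt (rgt c)))
    else if lft c = 8 then Impl (mso_decode (lft (rgt c))) (mso_decode (rgt (rgt c)))
    else if lft c = 9 then ExI (lft (rgt c)) (mso_decode (rgt (rgt c)))
    else if lft c = 10 then AllI (lft (rgt c)) (mso_decode (rgt (rgt c)))
    else if lft c = 11 then ExS (lft (rgt c)) (mso_decode (rgt (rgt c)))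
    else AllS (lft (rgt c)) (mso_decode (rgt (rgt c))))"
  by auto
termination
  by (relation "Wellfounded.measure id")
    (auto intro: rgt_less le_less_trans[OF lft_le rgt_less] le_less_trans[OF rgt_le rgt_less])

declare mso_decode.simps [simp del]

lemma mso_decode_encode [simp]: "mso_decode (mso_encode \<phi>) = \<phi>"
  by (induction \<phi>) (subst mso_decode.simps, simp)+

lemma mso_decode_cases:
  obtains "lft c = 0" "mso_decode c = Succ (lft (rgt c)) (rgt (rgt c))"
  | "lft c = 1" "mso_decode c = Less (lft (rgt c)) (rgt (rgt c))"
  | "lft c = 2" "mso_decode c = Eq (lft (rgt c)) (rgt (rgt c))"
  | "lft c = 3" "mso_decode c = Sym (lft (rgt c)) (int_decode (rgt (rgt c)))"
  | "lft c = 4" "mso_decode c = Mem (lft (rgt c)) (rgt (rgt c))"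
  | "lft c = 5" "mso_decode c = Neg (mso_decode (rgt c))"
  | "lft c = 6" "mso_decode c = Conj (mso_decode (lft (rgt c))) (mso_decode (rgt (rgt c)))"
  | "lft c = 7" "mso_decode c = Disj (mso_decode (lft (rgt c))) (mso_decode (rgt (rgt c)))"
  | "lft c = 8" "mso_decode c = Impl (mso_decode (lft (rgt c))) (mso_decode (rgt (rgt c)))"
  | "lft c = 9" "mso_decode c = ExI (lft (rgt c)) (mso_decode (rgt (rgt c)))"
  | "lft c = 10" "mso_decode c = AllI (lft (rgt c)) (mso_decode (rgt (rgt c)))"
  | "lft c = 11" "mso_decode c = ExS (lft (rgt c)) (mso_decode (rgt (rgt c)))"
  | "lft c > 11" "mso_decode c = AllS (lft (rgt c)) (mso_decode (rgt (rgt c)))"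
proof -
  have "n = 0 \<or> n = 1 \<or> n = 2 \<or> n = 3 \<or> n = 4 \<or> n = 5 \<or> n = 6 \<or> n = 7 \<or> n = 8 \<or> n = 9
    \<or> n = 10 \<or> n = 11 \<or> n > 11" for n :: nat by presburger
  from this[of "lft c"] show thesis
    by (elim disjE) (rule that, assumption, subst mso_decode.simps, simp)+
qed

lemma subformula_less:
  "5 \<le> lft c \<Longrightarrow> rgt c < c" "5 \<le> lft c \<Longrightarrow> lft (rgt c) < c" "5 \<le> lft c \<Longrightarrow> rgt (rgt c) < c"
  using rgt_less[of c] le_less_trans[OF lft_le[of "rgt c"]] le_less_trans[OF rgt_le[of "rgt c"]] by auto

abbreviation (input) "tag z \<equiv> lft (fst z)"
abbreviation (input) "sub1 z \<equiv> lft (rgt (fst z))"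
abbreviation (input) "sub2 z \<equiv> rgt (rgt (fst z))"

lemma recursive_of_bool [rec_intros]: "decidable P \<Longrightarrow> recursive (\<lambda>x. of_bool (P x) :: nat)"
  by (simp add: decidable_def of_bool_def)

lemma recursive_max [rec_intros]: "recursive f \<Longrightarrow> recursive g \<Longrightarrow> recursive (\<lambda>x. max (f x) (g x) :: nat)"
  unfolding max_def by (intro rec_intros)

lemma image_pairs: "(\<lambda>(s, t). f s t) ` (A \<times> B) = (\<Union>s\<in>A. f s ` B)"
  by auto

text \<open>The recursion runs on the code of the formula. \<open>C\<close> lists the calls and
  \<open>G\<close> reassembles their values by position; for individual quantifiers the product with
  the variable elsewhere comes first, hence \<open>head ys\<close> and
  \<open>drop 1 ys\<close>.\<close>

lemma recursive_mult_fm: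
  "recursive (\<lambda>z. mult (mso_decode (fst z)) (fst (snd z)) (snd (snd z)))"
proof -
  define C :: "nat \<times> nat \<times> nat \<Rightarrow> (nat \<times> nat \<times> nat) list" where "C z =
    (if tag z < 5 then []
     else if tag z = 5 then [(rgt (fst z), fst (snd z), snd (snd z))]
     else if tag z < 9 then
       [(sub1 z, lft (fst (snd z)), lft (snd (snd z))),
        (sub2 z, rgt (fst (snd z)), rgt (snd (snd z)))]
     else if tag z < 11 then
       (sub2 z, rgt (fst (snd z)), rgt (snd (snd z))) #
       map (\<lambda>s. (sub2 z, s, rgt (snd (snd z)))) (elems (lft (fst (snd z)))) @
       map (\<lambda>t. (sub2 z, rgt (fst (snd z)), t)) (elems (lft (snd (snd z))))
     else concat (map (\<lambda>s. map (\<lambda>t. (sub2 z, s, t)) (elems (snd (snd z)))) (elems (fst (snd z)))))" for z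
  define G :: "nat \<times> nat \<times> nat \<Rightarrow> nat list \<Rightarrow> nat" where "G z ys =
    (if tag z = 0 then pr (lft (fst (snd z))) (pr (lft (rgt (snd (snd z))))
       (max (max (rgt (rgt (fst (snd z)))) (rgt (rgt (snd (snd z))))) (lft (rgt (fst (snd z))) * lft (snd (snd z)))))
     else if tag z = 1 then pr (max (lft (fst (snd z))) (lft (snd (snd z))))
       (pr (max (lft (rgt (fst (snd z)))) (lft (rgt (snd (snd z)))))
       (max (max (rgt (rgt (fst (snd z)))) (rgt (rgt (snd (snd z))))) (lft (fst (snd z)) * lft (rgt (snd (snd z))))))
     else if tag z < 5 then max (fst (snd z)) (snd (snd z))
     else if tag z = 5 then head ys
     else if tag z < 9 then pr (head ys) (head (drop 1 ys))
     else if tag z < 11 then pr (set_encode (set (drop 1 ys))) (head ys)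
     else set_encode (set ys))" for z ys
  show ?thesis
  proof (rule recursive_wf)
    show "recursive C" unfolding C_def by (intro rec_intros)
    show "recursive (\<lambda>p. G (fst p) (snd p))" unfolding G_def by (intro rec_intros)
    show "fst c < fst z" if "c \<in> set (C z)" for z c
      using that unfolding C_def by (auto simp: subformula_less split: if_splits)
    fix z :: "nat \<times> nat \<times> nat"
    obtain c a b where z: "z = (c, a, b)" by (cases z) auto
    show "mult (mso_decode (fst z)) (fst (snd z)) (snd (snd z))
      = G z (map (\<lambda>z. mult (mso_decode (fst z)) (fst (snd z)) (snd (snd z))) (C z))"
      unfolding z C_def G_def fst_conv snd_conv
      by (rule mso_decode_cases[of c])
        (simp_all add: image_image image_Un image_UN image_pairs)
  qed
qed

lemma recursive_mult' [rec_intros]: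
  "recursive c \<Longrightarrow> recursive a \<Longrightarrow> recursive b \<Longrightarrow> recursive (\<lambda>z. mult (mso_decode (c z)) (a z) (b z))"
  by (rule recursive_comp3[OF recursive_mult_fm])

lemma recursive_omega_fm: "recursive (\<lambda>z. omega (mso_decode (fst z)) (snd z))"
proof -
  define C :: "nat \<times> nat \<Rightarrow> (nat \<times> nat) list" where "C z =
    (if tag z < 5 then []
     else if tag z = 5 then [(rgt (fst z), snd z)]
     else if tag z < 9 then [(sub1 z, lft (snd z)), (sub2 z, rgt (snd z))]
     else if tag z < 11 then [(sub2 z, rgt (snd z))]
     else map (\<lambda>t. (sub2 z, t))
       (filter (\<lambda>t. mult (mso_decode (sub2 z)) t t = t) (elems (snd z))))" for z
  define G :: "nat \<times> nat \<Rightarrow> nat list \<Rightarrow> nat" where "G z ys =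
    (if tag z = 0 then pr (lft (snd z)) (pr 0 (rgt (rgt (snd z))))
     else if tag z < 5 then snd z
     else if tag z = 5 then head ys
     else if tag z < 9 then pr (head ys) (head (drop 1 ys))
     else if tag z < 11 then pr (set_encode (set (map (\<lambda>s. mult (mso_decode (sub2 z)) s (head ys))
       (elems (lft (snd z)))))) (head ys)
     else set_encode (set (concat (map (\<lambda>s. map (\<lambda>t. mult (mso_decode (sub2 z)) s t) ys)
       (elems (snd z))))))" for z ys
  show ?thesis
  proof (rule recursive_wf)
    show "recursive C" unfolding C_def by (intro rec_intros)
    show "recursive (\<lambda>p. G (fst p) (snd p))" unfolding G_def by (intro rec_intros)
    show "fst c < fst z" if "c \<in> set (C z)" for z c
      using that unfolding C_def by (auto simp: subformula_less split: if_splits)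
    fix z :: "nat \<times> nat"
    obtain c e where z: "z = (c, e)" by (cases z) auto
    show "omega (mso_decode (fst z)) (snd z) = G z (map (\<lambda>z. omega (mso_decode (fst z)) (snd z)) (C z))"
      unfolding z C_def G_def fst_conv snd_conv
      by (rule mso_decode_cases[of c]) (simp_all add: image_image image_pairs)
  qed
qed

lemma recursive_omega [rec_intros]:
  "recursive c \<Longrightarrow> recursive e \<Longrightarrow> recursive (\<lambda>z. omega (mso_decode (c z)) (e z))"
  by (rule recursive_comp2[OF recursive_omega_fm])

lemma recursive_acc_fm: "recursive (\<lambda>z. if acc (mso_decode (fst z)) (snd z) then 1 else 0 :: nat)"
proof -
  define C :: "nat \<times> nat \<Rightarrow> (nat \<times> nat) list" where "C z =
    (if tag z < 5 then []
     else if tag z = 5 then [(rgt (fst z), snd z)]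
     else if tag z < 9 then [(sub1 z, lft (snd z)), (sub2 z, rgt (snd z))]
     else if tag z < 11 then map (\<lambda>t. (sub2 z, t)) (elems (lft (snd z)))
     else map (\<lambda>t. (sub2 z, t)) (elems (snd z)))" for z
  define G :: "nat \<times> nat \<Rightarrow> nat list \<Rightarrow> nat" where "G z ys = of_bool
    (if tag z < 2 then rgt (rgt (snd z)) = 1
     else if tag z < 5 then snd z = 1
     else if tag z = 5 then head ys \<noteq> 1
     else if tag z = 6 then head ys = 1 \<and> head (drop 1 ys) = 1
     else if tag z = 7 then head ys = 1 \<or> head (drop 1 ys) = 1
     else if tag z = 8 then head ys = 1 \<longrightarrow> head (drop 1 ys) = 1
     else if tag z = 9 \<or> tag z = 11 then 1 \<in> set ys
     else 0 \<notin> set ys)" for z ys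
  have decidable_if: "decidable (\<lambda>x. if P x then Q x else R x)"
    if "decidable P" "decidable Q" "decidable R" for P Q R :: "(nat \<times> nat) \<times> nat list \<Rightarrow> bool"
    unfolding if_bool_eq_conj using that by (intro rec_intros)
  show ?thesis
  proof (rule recursive_wf)
    show "recursive C" unfolding C_def by (intro rec_intros)
    show "recursive (\<lambda>p. G (fst p) (snd p))" unfolding G_def by (intro decidable_if rec_intros)
    show "fst c < fst z" if "c \<in> set (C z)" for z c
      using that unfolding C_def by (auto simp: subformula_less split: if_splits)
    fix z :: "nat \<times> nat"
    obtain c e where z: "z = (c, e)" by (cases z) auto
    show "(if acc (mso_decode (fst z)) (snd z) then 1 else 0)
      = G z (map (\<lambda>z. if acc (mso_decode (fst z)) (snd z) then 1 else 0) (C z))"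
      unfolding z C_def G_def fst_conv snd_conv
      by (rule mso_decode_cases[of c]) (auto simp: image_iff)
  qed
qed

lemma decidable_acc [rec_intros]:
  "recursive c \<Longrightarrow> recursive t \<Longrightarrow> decidable (\<lambda>z. acc (mso_decode (c z)) (t z))"
  unfolding decidable_def by (rule recursive_comp2[OF recursive_acc_fm])

text \<open>Letters in formulas are integers whose coding doubles the nonnegative ones; this turns
  the test of a letter into one on natural numbers.\<close>

lemma int_eq_int_decode: "int b = int_decode n \<longleftrightarrow> n = 2 * b"
proof -
  have "int_encode (int b) = 2 * b" by (simp add: int_encode_def sum_encode_def)
  then show ?thesis by (metis int_decode_inverse int_encode_inverse)
qed

lemma recursive_lt_fm:
  "recursive (\<lambda>z. lt (mso_decode (fst z)) (fst (snd z)) (fst (snd (snd z))) (snd (snd (snd z))))"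
proof -
  define C :: "nat \<times> nat \<times> nat list \<times> nat list \<Rightarrow> (nat \<times> nat \<times> nat list \<times> nat list) list" where "C z =
    (if tag z < 5 then []
     else if tag z = 5 then [(rgt (fst z), snd z)]
     else if tag z < 9 then [(sub1 z, snd z), (sub2 z, snd z)]
     else if tag z < 11 then
       [(sub2 z, fst (snd z), sub1 z # fst (snd (snd z)), snd (snd (snd z))),
        (sub2 z, fst (snd z), filter (\<lambda>q. q \<noteq> sub1 z) (fst (snd (snd z))), snd (snd (snd z)))]
     else
       [(sub2 z, fst (snd z), fst (snd (snd z)), sub1 z # snd (snd (snd z))),
        (sub2 z, fst (snd z), fst (snd (snd z)), filter (\<lambda>q. q \<noteq> sub1 z) (snd (snd (snd z))))])" for z
  define G :: "nat \<times> nat \<times> nat list \<times> nat list \<Rightarrow> nat list \<Rightarrow> nat" where "G z ys =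
    (if tag z = 0 then pr (of_bool (sub2 z \<in> set (fst (snd (snd z)))))
       (pr (of_bool (sub1 z \<in> set (fst (snd (snd z))))) 0)
     else if tag z = 1 then pr (of_bool (sub1 z \<in> set (fst (snd (snd z)))))
       (pr (of_bool (sub2 z \<in> set (fst (snd (snd z))))) 0)
     else if tag z = 2 then of_bool (sub1 z \<in> set (fst (snd (snd z))) \<and>
       sub2 z \<in> set (fst (snd (snd z))))
     else if tag z = 3 then of_bool (sub1 z \<in> set (fst (snd (snd z))) \<and>
       sub2 z = 2 * fst (snd z))
     else if tag z = 4 then of_bool (sub2 z \<in> set (fst (snd (snd z))) \<and>
       sub1 z \<in> set (snd (snd (snd z))))
     else if tag z = 5 then head ys
     else if tag z < 9 then pr (head ys) (head (drop 1 ys))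
     else if tag z < 11 then pr (set_encode (set [head ys])) (head (drop 1 ys))
     else set_encode (set ys))" for z ys
  show ?thesis
  proof (rule recursive_wf)
    show "recursive C" unfolding C_def by (intro rec_intros)
    show "recursive (\<lambda>p. G (fst p) (snd p))" unfolding G_def by (intro rec_intros)
    show "fst c < fst z" if "c \<in> set (C z)" for z c
      using that unfolding C_def by (auto simp: subformula_less split: if_splits)
    fix z :: "nat \<times> nat \<times> nat list \<times> nat list"
    obtain c b l m where z: "z = (c, b, l, m)" by (cases z) auto
    show "lt (mso_decode (fst z)) (fst (snd z)) (fst (snd (snd z))) (snd (snd (snd z)))
      = G z (map (\<lambda>z. lt (mso_decode (fst z)) (fst (snd z)) (fst (snd (snd z))) (snd (snd (snd z)))) (C z))"
      unfolding z C_def G_def fst_conv snd_conv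
      by (rule mso_decode_cases[of c]) (simp_all add: int_eq_int_decode)
  qed
qed

lemma recursive_lt [rec_intros]:
  assumes "recursive c" "recursive b" "recursive l" "recursive m"
  shows "recursive (\<lambda>z. lt (mso_decode (c z)) (b z) (l z) (m z))"
  using recursive_comp[OF recursive_lt_fm, of "\<lambda>z. (c z, b z, l z, m z)"] assms
  by (simp add: rec_intros)

lemma recursive_hw [rec_intros]:
  assumes c: "recursive c" and w: "recursive w"
  shows "recursive (\<lambda>z. hw (mso_decode (c z)) (w z))"
  unfolding hw_def by (intro rec_intros recursive_comp[OF c] w)

lemma recursive_pow [rec_intros]:
  assumes c: "recursive c" and g: "recursive g" and n: "recursive n"
  shows "recursive (\<lambda>z. pow (mso_decode (c z)) (g z) (n z))"
  unfolding pow_def by (intro rec_intros recursive_comp[OF c] recursive_comp[OF g] n)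

lemma decidable_cert:
  assumes F: "recursive F" and W: "recursive W" and c: "recursive c" and l: "recursive l"
    and N: "recursive N" and B: "recursive B" and e: "recursive e"
  shows "decidable (\<lambda>z. cert (F z) (W z) (mso_decode (c z)) (l z) (N z) (B z) (e z))"
  unfolding cert_def
  by (intro rec_intros recursive_comp[OF F] recursive_comp[OF W] recursive_comp[OF c]
    recursive_comp[OF l] recursive_comp[OF N] recursive_comp[OF B] recursive_comp[OF e] F W l N B)

subsection \<open>Computable reals\<close>

lemma of_rat_decode: "real_of_rat (rat_decode m) = of_int (int_decode (lft m)) / real (Suc (rgt m))"
  by (simp add: rat_decode_def case_prod_beta of_rat_rat)

lemma int_decode_double: "int_decode (2 * n) = int n"
  by (simp add: int_decode_def sum_decode_def)

lemma int_decode_odd: "odd n \<Longrightarrow> int_decode n < 0"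
  by (simp add: int_decode_def sum_decode_def)

lemma computable_realI:
  assumes g: "recursive g" and a: "\<And>t. \<bar>a * real (Suc t) - real (g t)\<bar> < 2"
  shows "computable_real a"
proof -
  \<comment> \<open>A request of at least 1 / (j + 1) is met with denominator 2 (j + 1), because 2 /
    (2 (j + 1)) = 1 / (j + 1). Doubling the numerator codes a nonnegative integer, and denominators
    are stored minus one.\<close>
  define f where "f m = pr (2 * g (Suc (2 * rgt m))) (Suc (2 * rgt m))" for m
  have "recursive f" unfolding f_def by (intro rec_intros recursive_comp[OF g])
  moreover have "real_of_rat (rat_decode (f m)) \<in>
      {a - real_of_rat (rat_decode m) <..< a + real_of_rat (rat_decode m)}" if "rat_decode m > 0" for m
  proof -
    define j where "j = rgt m"
    define t where "t = Suc (2 * j)"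
    have "real_of_rat (rat_decode m) > 0" using that by simp
    then have "int_decode (lft m) > 0" unfolding of_rat_decode by (simp add: zero_less_divide_iff)
    then have "1 / real (Suc j) \<le> real_of_rat (rat_decode m)"
      unfolding of_rat_decode j_def by (intro divide_right_mono) simp_all
    moreover have "real_of_rat (rat_decode (f m)) = real (g t) / real (Suc t)"
      by (simp only: of_rat_decode f_def prod_encode_inverse fst_conv snd_conv int_decode_double t_def j_def
          of_int_of_nat_eq)
    moreover have "\<bar>a - real (g t) / real (Suc t)\<bar> < 1 / real (Suc j)"
    proof -
      have "\<bar>a - real (g t) / real (Suc t)\<bar> = \<bar>a * real (Suc t) - real (g t)\<bar> / real (Suc t)"
      proof -
        have "a - real (g t) / real (Suc t) = (a * real (Suc t) - real (g t)) / real (Suc t)"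
          by (simp add: diff_divide_distrib)
        then show ?thesis by (simp only: abs_divide abs_of_nat)
      qed
      also have "\<dots> < 2 / real (Suc t)" using a[of t] by (intro divide_strict_right_mono) simp_all
      also have "\<dots> = 1 / real (Suc j)" by (simp add: t_def field_simps)
      finally show ?thesis .
    qed
    ultimately show ?thesis by auto
  qed
  ultimately show ?thesis unfolding computable_real_def computable_iff_recursive by blast
qed

lemma computable_realD:
  assumes "computable_real a" "0 \<le> a"
  shows "\<exists>g. recursive g \<and> (\<forall>t. \<bar>a * real (Suc t) - real (g t)\<bar> < 2)"
proof -
  obtain f where f: "recursive f" and fa: "\<And>m. rat_decode m > 0 \<Longrightarrow> real_of_rat (rat_decode (f m)) \<in>
      {a - real_of_rat (rat_decode m) <..< a + real_of_rat (rat_decode m)}"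
    using assms(1) unfolding computable_real_def computable_iff_recursive by blast
  \<comment> \<open>\<open>pr 2 t\<close> codes 1 / (t + 1), as 2 codes the integer 1.\<close>
  define i where "i t = lft (f (pr 2 t))" for t
  define j where "j t = rgt (f (pr 2 t))" for t
  \<comment> \<open>Rounding down loses less than 1 in addition to an approximation error below 1,
    hence the bound 2. An odd code is a negative numerator; since a is nonnegative, 0 is then close
    enough.\<close>
  define g where "g t = (if even (i t) then ((i t div 2) * Suc t) div Suc (j t) else 0)" for t
  have ri: "recursive i" and rj: "recursive j"
    unfolding i_def j_def by (intro rec_intros recursive_comp[OF f])+
  have "recursive g" unfolding g_def by (intro rec_intros recursive_comp[OF ri] recursive_comp[OF rj])
  moreover have "\<bar>a * real (Suc t) - real (g t)\<bar> < 2" for t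
  proof -
    define q where "q = of_int (int_decode (i t)) / real (Suc (j t))"
    have q: "q = real_of_rat (rat_decode (f (pr 2 t)))" by (simp only: q_def of_rat_decode i_def j_def)
    have "int_decode 2 = 1" using int_decode_double[of 1] by simp
    then have e: "real_of_rat (rat_decode (pr 2 t)) = 1 / real (Suc t)" by (simp add: of_rat_decode)
    then have "real_of_rat (rat_decode (pr 2 t)) > 0" by simp
    then have "rat_decode (pr 2 t) > 0" by simp
    from fa[OF this] have "\<bar>a - q\<bar> < 1 / real (Suc t)" unfolding e q by auto
    then have "\<bar>a - q\<bar> * real (Suc t) < 1" by (simp add: field_simps)
    then have aq: "\<bar>a * real (Suc t) - q * real (Suc t)\<bar> < 1"
      by (simp add: abs_mult flip: left_diff_distrib)
    show ?thesis
    proof (cases "even (i t)")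
      case True
      then obtain b where b: "i t = 2 * b" by auto
      have qt: "q * real (Suc t) = real (b * Suc t) / real (Suc (j t))"
      proof -
        have "int_decode (i t) = int b" by (simp only: b int_decode_double)
        then show ?thesis by (simp add: q_def algebra_simps)
      qed
      have "real (g t) = of_int \<lfloor>q * real (Suc t)\<rfloor>"
        unfolding qt floor_divide_of_nat_eq by (simp add: g_def b)
      then show ?thesis using aq by linarith
    next
      case False
      then have "q < 0" unfolding q_def using int_decode_odd[of "i t"] by (simp add: divide_less_0_iff)
      then have "q * real (Suc t) < 0" by (simp add: mult_neg_pos)
      moreover have "0 \<le> a * real (Suc t)" using assms(2) by simp
      ultimately show ?thesis using aq False by (simp add: g_def)
    qed
  qed
  ultimately show ?thesis by blast
qed

text \<open>Approximations decide the floor except at the at most one index where the affine function is an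
  integer; its value there is built into the algorithm.\<close>
lemma recursive_floor:
  assumes \<alpha>: "\<alpha> \<notin> \<rat>" "0 < \<alpha>" and \<rho>: "0 \<le> \<rho>"
    and ra: "recursive a" and rb: "recursive b"
    and a: "\<And>t. \<bar>\<alpha> * real (Suc t) - real (a t)\<bar> < 2" and b: "\<And>t. \<bar>\<rho> * real (Suc t) - real (b t)\<bar> < 2"
  shows "recursive (\<lambda>n. nat \<lfloor>\<alpha> * real n + \<rho>\<rfloor>)"
proof -
  define z where "z n = \<alpha> * real n + \<rho>" for n
  have z0: "0 \<le> z n" for n using \<alpha> \<rho> by (simp add: z_def)
  have "\<exists>n0. \<forall>n. z n \<in> \<int> \<longrightarrow> n = n0"
  proof (cases "\<exists>n0. z n0 \<in> \<int>")
    case True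
    then obtain n0 where n0: "z n0 \<in> \<int>" by blast
    have "n = n0" if "z n \<in> \<int>" for n
    proof (rule ccontr)
      assume "n \<noteq> n0"
      have "z n - z n0 \<in> \<int>" using that n0 by (rule Ints_diff)
      then have "(z n - z n0) / (real n - real n0) \<in> \<rat>"
        using Ints_subset_Rats by (intro Rats_divide) auto
      moreover have "(z n - z n0) / (real n - real n0) = \<alpha>" using \<open>n \<noteq> n0\<close> by (simp add: z_def field_simps)
      ultimately show False using \<alpha> by simp
    qed
    then show ?thesis by blast
  qed blast
  then obtain n0 where n0: "\<And>n. z n \<in> \<int> \<Longrightarrow> n = n0" by blast
  \<comment> \<open>k codes a precision t and a candidate m. The scaled value (t + 1) z n differs
    from \<open>a t * n + b t\<close> by less than 2 (n + 1), hence the margin on both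
    sides.\<close>
  define P where "P n k \<longleftrightarrow> n = n0 \<or>
    rgt k * Suc (lft k) + 2 * Suc n \<le> a (lft k) * n + b (lft k) \<and>
    a (lft k) * n + b (lft k) + 2 * Suc n \<le> Suc (rgt k) * Suc (lft k)" for n k
  have err: "\<bar>z n * real (Suc t) - real (a t * n + b t)\<bar> < 2 * real (Suc n)" for n t
  proof -
    have "z n * real (Suc t) - real (a t * n + b t)
      = (\<alpha> * real (Suc t) - real (a t)) * real n + (\<rho> * real (Suc t) - real (b t))"
      by (simp add: z_def algebra_simps)
    moreover have "\<bar>(\<alpha> * real (Suc t) - real (a t)) * real n\<bar> \<le> 2 * real n"
      unfolding abs_mult using a[of t] by (intro mult_mono) simp_all
    ultimately show ?thesis using b[of t] by simp
  qed
  have sound: "nat \<lfloor>z n\<rfloor> = rgt k" if "P n k" "n \<noteq> n0" for n k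
  proof -
    define t m where "t = lft k" and "m = rgt k"
    have "m * Suc t + 2 * Suc n \<le> a t * n + b t" "a t * n + b t + 2 * Suc n \<le> Suc m * Suc t"
      using that by (simp_all only: P_def t_def m_def simp_thms)
    then have "real (m * Suc t + 2 * Suc n) \<le> real (a t * n + b t)"
        "real (a t * n + b t + 2 * Suc n) \<le> real (Suc m * Suc t)"
      by (simp_all only: of_nat_le_iff)
    then have "real m * real (Suc t) < z n * real (Suc t)" "z n * real (Suc t) < real (Suc m) * real (Suc t)"
      using err[of n t] by (simp_all only: of_nat_add of_nat_mult of_nat_numeral)
    then have "real m < z n" "z n < real (Suc m)" by (simp_all only: mult_less_cancel_right_disj) auto
    then have "\<lfloor>z n\<rfloor> = int m" by (intro floor_unique) simp_all
    then show ?thesis by (simp add: m_def)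
  qed
  have ex: "\<exists>k. P n k" for n
  proof (cases "n = n0")
    case True then show ?thesis by (simp add: P_def)
  next
    case False
    then have "z n \<notin> \<int>" using n0 by blast
    define m where "m = nat \<lfloor>z n\<rfloor>"
    have rm: "real m = of_int \<lfloor>z n\<rfloor>" using z0[of n] by (simp add: m_def)
    have "z n \<noteq> of_int \<lfloor>z n\<rfloor>" using \<open>z n \<notin> \<int>\<close> by (metis Ints_of_int)
    then have m: "real m < z n" "z n < real m + 1" unfolding rm by linarith+
    define d where "d = min (z n - real m) (real m + 1 - z n)"
    have d: "0 < d" "d \<le> z n - real m" "d \<le> real m + 1 - z n" using m by (auto simp: d_def)
    \<comment> \<open>The factor 4: the margin demanded by \<open>P\<close> and the approximation
      error each use up 2 (n + 1) of the scaled distance to the neighbouring integers.\<close>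
    obtain t :: nat where "4 * real (Suc n) / d < real t" using reals_Archimedean2 by blast
    then have "4 * real (Suc n) < real t * d" using d(1) by (simp add: field_simps)
    then have dt: "4 * real (Suc n) < d * real (Suc t)" using d(1) by (simp add: algebra_simps)
    have "d * real (Suc t) \<le> (z n - real m) * real (Suc t)" "d * real (Suc t) \<le> (real m + 1 - z n) * real (Suc t)"
      using d by (intro mult_right_mono; simp)+
    then have "real m * real (Suc t) + 2 * real (Suc n) \<le> real (a t * n + b t)"
        "real (a t * n + b t) + 2 * real (Suc n) \<le> (real m + 1) * real (Suc t)"
      using err[of n t] dt by (simp_all only: left_diff_distrib)
    then have "real (m * Suc t + 2 * Suc n) \<le> real (a t * n + b t)"
        "real (a t * n + b t + 2 * Suc n) \<le> real (Suc m * Suc t)"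
      by (simp_all add: algebra_simps)
    then have "P n (pr t m)" unfolding P_def of_nat_le_iff by simp
    then show ?thesis by blast
  qed
  have "decidable (\<lambda>p. P (fst p) (snd p))"
    unfolding P_def by (intro rec_intros recursive_comp[OF ra] recursive_comp[OF rb])
  then have "recursive (\<lambda>n. if n = n0 then nat \<lfloor>z n0\<rfloor> else rgt (LEAST k. P n k))"
    by (intro rec_intros recursive_Least ex)
  moreover have "(if n = n0 then nat \<lfloor>z n0\<rfloor> else rgt (LEAST k. P n k)) = nat \<lfloor>z n\<rfloor>" for n
    using sound[of n] LeastI_ex[OF ex[of n]] by auto
  ultimately show ?thesis by (simp add: z_def)
qed

lemma recursive_rot:
  assumes \<alpha>: "\<alpha> \<notin> \<rat>" "0 < \<alpha>" and \<rho>: "0 \<le> \<rho>" and "computable_real \<alpha>" "computable_real \<rho>"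
  shows "recursive (rot \<alpha> \<rho>)"
proof -
  obtain a where a: "recursive a" "\<And>t. \<bar>\<alpha> * real (Suc t) - real (a t)\<bar> < 2"
    using computable_realD[of \<alpha>] assms by auto
  obtain b where b: "recursive b" "\<And>t. \<bar>\<rho> * real (Suc t) - real (b t)\<bar> < 2"
    using computable_realD[of \<rho>] assms by auto
  note fl = recursive_floor[OF \<alpha> \<rho> a(1) b(1) a(2) b(2)]
  have "recursive (\<lambda>n. nat \<lfloor>\<alpha> * real (Suc n) + \<rho>\<rfloor> - nat \<lfloor>\<alpha> * real n + \<rho>\<rfloor>)"
    by (intro recursive_diff fl recursive_comp[OF fl] recursive_Suc recursive_id)
  moreover have "rot \<alpha> \<rho> n = nat \<lfloor>\<alpha> * real (Suc n) + \<rho>\<rfloor> - nat \<lfloor>\<alpha> * real n + \<rho>\<rfloor>" for n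
  proof -
    have "0 \<le> \<lfloor>\<alpha> * real k + \<rho>\<rfloor>" for k using \<alpha> \<rho> by simp
    from nat_diff_distrib'[OF this this, of "Suc n" n] show ?thesis
      by (simp only: rot_def mechanical_def Suc_eq_plus1)
  qed
  ultimately show ?thesis by presburger
qed

subsection \<open>From computable parameters to decidability\<close>

lemma computable_real_0: "computable_real 0"
  by (rule computable_realI[of "\<lambda>_. 0"]) (simp_all add: rec_intros)

text \<open>The search halts for every number c, since \<open>mso_decode c\<close> is always a
  formula and \<open>cert_complete\<close> covers all formulas. Whichever certificate is found,
  \<open>cert_sound\<close> yields the type of the word.\<close>

lemma decidable_mechanical:
  assumes \<alpha>: "\<alpha> \<notin> \<rat>" "0 < \<alpha>" "\<alpha> < 1" and \<rho>: "0 \<le> \<rho>"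
    and "computable_real \<alpha>" "computable_real \<rho>"
  shows "decidable_MT A (mechanical \<alpha> \<rho>)"
proof -
  define x where "x = rot \<alpha> \<rho>"
  have rx: "recursive x" and r0: "recursive (rot \<alpha> 0)"
    unfolding x_def using assms computable_real_0 by (simp_all add: recursive_rot)
  have X: "mechanical \<alpha> \<rho> = (\<lambda>n. int (x n))" unfolding x_def using int_rot[OF \<alpha>(2,3)] by simp
  define F where "F = factors (rot \<alpha> 0)"
  have F: "set (F N) = {f \<in> lang \<alpha>. length f = N}" for N
    unfolding F_def by (rule set_factors[OF \<alpha>])
  have rF: "recursive F"
    unfolding F_def factors_def by (intro rec_intros recursive_comp[OF r0])
  define P where "P c k \<longleftrightarrow> cert (F (fst (snd k))) (map x [0..<2 * fst k]) (mso_decode c) (fst k)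
    (fst (snd k)) (fst (snd (snd k))) (snd (snd (snd k)))" for c and k :: "nat \<times> nat \<times> nat \<times> nat"
  have ex: "\<exists>k. P c (dec k)" for c
  proof -
    obtain l N B e where "cert (F N) (map x [0..<2 * l]) (mso_decode c) l N B e"
      unfolding x_def using cert_complete[OF \<alpha>(1) F] by blast
    then have "P c (dec (enc (l, N, B, e)))" by (simp add: P_def)
    then show ?thesis by blast
  qed
  define s where "s c = (dec (LEAST k. P c (dec k)) :: nat \<times> nat \<times> nat \<times> nat)" for c
  have s: "P c (s c)" for c unfolding s_def by (rule LeastI_ex[OF ex])
  have rs: "recursive s"
    unfolding s_def
  proof (intro recursive_dec recursive_Least ex)
    show "decidable (\<lambda>p. P (fst p) (dec (snd p)))"
      unfolding P_def by (intro decidable_cert rec_intros recursive_dec recursive_comp[OF rF] recursive_comp[OF rx])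
  qed
  define f :: "nat \<Rightarrow> nat" where "f c = of_bool (acc (mso_decode c) (mult (mso_decode c)
    (hw (mso_decode c) (map x [0..<fst (s c)])) (omega (mso_decode c) (snd (snd (snd (s c)))))))" for c
  have "recursive f"
    unfolding f_def by (intro rec_intros recursive_comp[OF rx] recursive_comp[OF rs] rs)
  moreover have "f (mso_encode \<phi>) = (if \<phi> \<in> MT A (mechanical \<alpha> \<rho>) then 1 else 0)" if \<phi>: "\<phi> \<in> sentences A" for \<phi>
  proof -
    obtain l N B e where sk: "s (mso_encode \<phi>) = (l, N, B, e)" by (cases "s (mso_encode \<phi>)") auto
    have "cert (F N) (map x [0..<2 * l]) \<phi> l N B e"
      using s[of "mso_encode \<phi>"] unfolding P_def sk by simp
    moreover have "map x [i..<i + N] \<in> set (F N)" for i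
      unfolding F x_def by (simp add: map_rot_in_lang)
    ultimately have "wtp \<phi> x {0..} = mult \<phi> (hw \<phi> (map x [0..<l])) (omega \<phi> e)"
      by (intro cert_sound[of x N "F N" l \<phi> B e])
    moreover have "\<phi> \<in> MT A (mechanical \<alpha> \<rho>) \<longleftrightarrow> acc \<phi> (wtp \<phi> x {0..})"
      unfolding MT_iff[OF \<phi>, of _ "\<lambda>_. 0" "\<lambda>_. {}"] X
      by (rule acc_tp) (use \<phi> in \<open>simp add: sentences_def\<close>)
    ultimately show ?thesis by (simp add: f_def sk)
  qed
  ultimately show ?thesis unfolding decidable_MT_def computable_iff_recursive by blast
qed

subsection \<open>From decidability to computable parameters\<close>

text \<open>Walks n steps to the right of variable 0. Copying variable 1 back to 0 after each step
  keeps two variables sufficient and lets the code be computed by plain recursion on n.\<close>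

definition dig :: "nat \<Rightarrow> mso" where
  "dig n = rec_nat (Sym 0 1) (\<lambda>_ \<phi>. ExI 1 (Conj (Succ 0 1) (ExI 0 (Conj (Eq 0 1) \<phi>)))) n"

definition digit :: "nat \<Rightarrow> mso" where
  "digit n = ExI 0 (Conj (Neg (ExI 1 (Less 1 0))) (dig n))"

lemma sat_dig: "sat x v V (dig n) \<longleftrightarrow> x (v 0 + n) = 1"
  by (induction n arbitrary: v) (simp_all add: dig_def)

lemma sat_digit: "sat x v V (digit n) \<longleftrightarrow> x n = 1"
proof -
  have "sat x v V (digit n) \<longleftrightarrow> (\<exists>k. (\<forall>j. \<not> j < k) \<and> x (k + n) = 1)"
    by (simp add: digit_def sat_dig)
  also have "\<dots> \<longleftrightarrow> x n = 1" by (metis add_0 not_gr_zero not_less_zero)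
  finally show ?thesis .
qed

lemma digit_sentence: "digit n \<in> sentences {0, 1}"
proof -
  have "free_ind (dig n) = {0} \<and> free_set (dig n) = {} \<and> letters (dig n) = {1}"
    by (induction n) (auto simp: dig_def)
  then show ?thesis by (auto simp: sentences_def digit_def)
qed

lemma recursive_encode_digit: "recursive (\<lambda>n. mso_encode (digit n))"
proof -
  have "recursive (\<lambda>n. rec_nat (mso_encode (Sym 0 1))
    (\<lambda>_ r. pr 9 (pr 1 (pr 6 (pr (mso_encode (Succ 0 1)) (pr 9 (pr 0 (pr 6 (pr (mso_encode (Eq 0 1)) r)))))))) n)"
    by (intro rec_intros)
  moreover have "rec_nat (mso_encode (Sym 0 1))
    (\<lambda>_ r. pr 9 (pr 1 (pr 6 (pr (mso_encode (Succ 0 1)) (pr 9 (pr 0 (pr 6 (pr (mso_encode (Eq 0 1)) r)))))))) n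
    = mso_encode (dig n)" for n
    by (induction n) (simp_all add: dig_def)
  ultimately have "recursive (\<lambda>n. mso_encode (dig n))" by simp
  then have "recursive (\<lambda>n. pr 9 (pr 0 (pr 6 (pr (mso_encode (Neg (ExI 1 (Less 1 0)))) (mso_encode (dig n))))))"
    by (intro rec_intros)
  then show ?thesis by (simp add: digit_def)
qed

text \<open>The letters telescope: since \<lfloor>\<rho>\<rfloor> = 0, the first n of them add up to
  \<lfloor>\<alpha> n + \<rho>\<rfloor>, and each letter is the truth value of a sentence.\<close>

lemma recursive_floor_of_decidable:
  assumes \<alpha>: "0 < \<alpha>" "\<alpha> < 1" and \<rho>: "0 \<le> \<rho>" "\<rho> < 1"
    and "decidable_MT {0, 1} (mechanical \<alpha> \<rho>)"
  shows "recursive (\<lambda>n. nat \<lfloor>\<alpha> * real n + \<rho>\<rfloor>)"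
proof -
  obtain f :: "nat \<Rightarrow> nat" where f: "recursive f" and
    fd: "\<And>\<phi>. \<phi> \<in> sentences {0, 1} \<Longrightarrow> f (mso_encode \<phi>) = (if \<phi> \<in> MT {0, 1} (mechanical \<alpha> \<rho>) then 1 else 0)"
    using assms(5) unfolding decidable_MT_def computable_iff_recursive by blast
  have fx: "int (f (mso_encode (digit n))) = mechanical \<alpha> \<rho> n" for n
    unfolding fd[OF digit_sentence] MT_iff[OF digit_sentence, of _ _ "\<lambda>_. 0" "\<lambda>_. {}"] sat_digit
    using mechanical_range[OF \<alpha>, of \<rho> n] by auto
  have "recursive (\<lambda>n. rec_nat 0 (\<lambda>i r. r + f (mso_encode (digit i))) n)"
    by (intro rec_intros recursive_comp[OF f] recursive_comp[OF recursive_encode_digit])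
  moreover have "int (rec_nat 0 (\<lambda>i r. r + f (mso_encode (digit i))) n) = \<lfloor>\<alpha> * real n + \<rho>\<rfloor>" for n
  proof (induction n)
    case 0
    then show ?case using \<rho> by (simp add: floor_eq_iff)
  next
    case (Suc n)
    then show ?case using fx[of n] by (simp add: mechanical_def add.commute)
  qed
  then have "rec_nat 0 (\<lambda>i r. r + f (mso_encode (digit i))) n = nat \<lfloor>\<alpha> * real n + \<rho>\<rfloor>" for n
    by (metis nat_int)
  ultimately show ?thesis by simp
qed

text \<open>Since the fractional parts of \<open>\<alpha> n + \<rho>\<close> are dense in the unit interval, \<open>\<rho>\<close> is both the supremum of
  the numbers \<open>S n - \<alpha> n\<close> and the infimum of the numbers \<open>S m + 1 - \<alpha> m\<close>.\<close>
lemma computable_real_of_floor: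
  assumes irr: "\<alpha> \<notin> \<rat>" and \<alpha>: "0 < \<alpha>" and \<rho>: "0 \<le> \<rho>" "\<rho> < 1"
    and rS: "recursive (\<lambda>n. nat \<lfloor>\<alpha> * real n + \<rho>\<rfloor>)"
  shows "computable_real \<alpha>" "computable_real \<rho>"
proof -
  define S where "S n = nat \<lfloor>\<alpha> * real n + \<rho>\<rfloor>" for n
  have rS: "recursive S" using rS by (simp add: S_def[abs_def])
  have "0 \<le> \<alpha> * real n + \<rho>" for n using \<alpha> \<rho> by simp
  then have Sfl: "real (S n) = of_int \<lfloor>\<alpha> * real n + \<rho>\<rfloor>" for n by (simp add: S_def)
  have S: "real (S n) \<le> \<alpha> * real n + \<rho>" "\<alpha> * real n + \<rho> < real (S n) + 1" for n
    unfolding Sfl by linarith+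
  show "computable_real \<alpha>"
  proof (rule computable_realI)
    show "recursive (\<lambda>t. S (Suc t))" by (intro rec_intros recursive_comp[OF rS])
    show "\<bar>\<alpha> * real (Suc t) - real (S (Suc t))\<bar> < 2" for t
      using S[of "Suc t"] \<rho> by linarith
  qed
  \<comment> \<open>For k = (n, m, T, g) this says, cleared of denominators and subtractions, that g
    - 2 < (t + 1) (S n - n u) and (t + 1) (S m + 1 - m v) \<le> g + 2, where u = (S T + 1) / T and v
    = (S T - 1) / T enclose \<alpha>.\<close>
  define P where "P t k \<longleftrightarrow> 0 < fst (snd (snd k)) \<and>
    snd (snd (snd k)) * fst (snd (snd k)) + fst k * Suc t * Suc (S (fst (snd (snd k))))
      < S (fst k) * fst (snd (snd k)) * Suc t + 2 * fst (snd (snd k)) \<and>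
    Suc (S (fst (snd k))) * fst (snd (snd k)) * Suc t + fst (snd k) * Suc t
      \<le> (snd (snd (snd k)) + 2) * fst (snd (snd k)) + fst (snd k) * Suc t * S (fst (snd (snd k)))"
    for t and k :: "nat \<times> nat \<times> nat \<times> nat"
  have Pr: "P t (n, m, T, g) \<longleftrightarrow> 0 < T \<and>
    real g * real T + real n * real (Suc t) * (real (S T) + 1) < real (S n) * real T * real (Suc t) + 2 * real T \<and>
    (real (S m) + 1) * real T * real (Suc t) + real m * real (Suc t)
      \<le> (real g + 2) * real T + real m * real (Suc t) * real (S T)" for t n m T g
  proof -
    have "g * T + n * Suc t * Suc (S T) < S n * T * Suc t + 2 * T \<longleftrightarrow>
      real (g * T + n * Suc t * Suc (S T)) < real (S n * T * Suc t + 2 * T)" by (simp only: of_nat_less_iff)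
    moreover have "Suc (S m) * T * Suc t + m * Suc t \<le> (g + 2) * T + m * Suc t * S T \<longleftrightarrow>
      real (Suc (S m) * T * Suc t + m * Suc t) \<le> real ((g + 2) * T + m * Suc t * S T)" by (simp only: of_nat_le_iff)
    moreover have "real (Suc i) = real i + 1" for i by simp
    ultimately show ?thesis unfolding P_def fst_conv snd_conv by (simp only: of_nat_add of_nat_mult of_nat_numeral)
  qed
  have sound: "\<bar>\<rho> * real (Suc t) - real g\<bar> < 2" if "P t (n, m, T, g)" for t n m T g
  proof -
    let ?s = "real (Suc t)"
    have T: "0 < real T"
      and lo: "real g * real T + real n * ?s * (real (S T) + 1) < real (S n) * real T * ?s + 2 * real T"
      and hi: "(real (S m) + 1) * real T * ?s + real m * ?s \<le> (real g + 2) * real T + real m * ?s * real (S T)"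
      using that by (simp_all only: Pr of_nat_0_less_iff)
    have "real n * ?s * (\<alpha> * real T) \<le> real n * ?s * (real (S T) + 1)"
      using S(2)[of T] \<rho> by (intro mult_left_mono) simp_all
    moreover have "(real (S n) - \<alpha> * real n) * (real T * ?s) \<le> \<rho> * (real T * ?s)"
      using S(1)[of n] T by (intro mult_right_mono) simp_all
    ultimately have "(real g - 2) * real T < (\<rho> * ?s) * real T" using lo by (simp add: algebra_simps)
    then have 1: "real g - 2 < \<rho> * ?s" using T by simp
    have "real m * ?s * (real (S T) - 1) \<le> real m * ?s * (\<alpha> * real T)"
      using S(1)[of T] \<rho> by (intro mult_left_mono) simp_all
    moreover have "\<rho> * (real T * ?s) < (real (S m) + 1 - \<alpha> * real m) * (real T * ?s)"
      using S(2)[of m] T by (intro mult_strict_right_mono) simp_all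
    ultimately have "(\<rho> * ?s) * real T < (real g + 2) * real T" using hi by (simp add: algebra_simps)
    then have "\<rho> * ?s < real g + 2" using T by simp
    with 1 show ?thesis by linarith
  qed
  have ex: "\<exists>k. P t (dec k)" for t
  proof -
    define s where "s = real (Suc t)"
    have s: "0 < s" "1 \<le> s" by (simp_all add: s_def)
    define \<epsilon> where "\<epsilon> = 1 / (4 * s)"
    have \<epsilon>: "0 < \<epsilon>" "\<epsilon> < 1" "\<epsilon> * s = 1 / 4" using s by (simp_all add: \<epsilon>_def)
    obtain n where "frac (\<rho> + real n * \<alpha>) < \<epsilon>" using rotation_dense[OF irr \<epsilon>(1)] by blast
    then have n: "\<rho> - \<epsilon> < real (S n) - \<alpha> * real n" unfolding Sfl frac_def by (simp add: algebra_simps)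
    \<comment> \<open>The shift by \<epsilon> places \<alpha> m + \<rho> just below an integer,
      whereas n above places it just above one.\<close>
    obtain m where m0: "frac (\<rho> + \<epsilon> + real m * \<alpha>) < \<epsilon>" using rotation_dense[OF irr \<epsilon>(1)] by blast
    have m: "real (S m) + 1 - \<alpha> * real m \<le> \<rho> + \<epsilon>"
    proof -
      define K where "K = \<lfloor>\<rho> + \<epsilon> + real m * \<alpha>\<rfloor>"
      have "of_int K \<le> \<rho> + \<epsilon> + real m * \<alpha>" "\<rho> + \<epsilon> + real m * \<alpha> < of_int K + \<epsilon>"
        using m0 unfolding K_def frac_def by linarith+
      then have "\<lfloor>\<alpha> * real m + \<rho>\<rfloor> = K - 1" using \<epsilon> by (intro floor_unique) (simp_all add: algebra_simps)
      then have "real (S m) = of_int K - 1" by (simp add: Sfl)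
      then show ?thesis using \<open>of_int K \<le> _\<close> by (simp add: algebra_simps)
    qed
    define g where "g = nat \<lfloor>\<rho> * s\<rfloor>"
    have "0 \<le> \<rho> * s" using \<rho> s by simp
    then have "real g = of_int \<lfloor>\<rho> * s\<rfloor>" by (simp add: g_def)
    then have g: "real g \<le> \<rho> * s" "\<rho> * s < real g + 1" by linarith+
    \<comment> \<open>Enclosing \<alpha> by means of T costs at most 2 n s and 2 m s in the two
      inequalities; this T exceeds both by enough for the slack left by \<epsilon> and by the
      rounding of g.\<close>
    define T where "T = 2 * n * Suc t + 4 * m * Suc t + 1"
    have rT: "real T = 2 * real n * s + 4 * real m * s + 1" by (simp add: T_def s_def algebra_simps)
    have "0 < T" by (simp add: T_def)
    then have T0: "0 < real T" by simp
    have nm: "0 \<le> real n * s" "0 \<le> real m * s" using s by simp_all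
    have STu: "real n * s * (real (S T) + 1) \<le> real n * s * (\<alpha> * real T + 2)"
      using S(1)[of T] \<rho> nm by (intro mult_left_mono) simp_all
    have "(\<rho> - \<epsilon>) * s * real T \<le> (real (S n) - \<alpha> * real n) * s * real T"
      using n s T0 by (intro mult_right_mono) simp_all
    then have "(\<rho> * s - 1 / 4) * real T \<le> (real (S n) - \<alpha> * real n) * s * real T"
      using \<epsilon>(3) by (simp add: left_diff_distrib)
    moreover have "real g * real T \<le> \<rho> * s * real T" using g(1) T0 by (intro mult_right_mono) simp_all
    ultimately have "real g * real T + real n * s * (\<alpha> * real T + 2) < real (S n) * real T * s + 2 * real T"
      using rT nm by (simp add: algebra_simps)
    then have lo: "real g * real T + real n * s * (real (S T) + 1) < real (S n) * real T * s + 2 * real T"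
      using STu by linarith
    have STl: "real m * s * (\<alpha> * real T - 1) \<le> real m * s * real (S T)"
      using S(2)[of T] \<rho> nm by (intro mult_left_mono) simp_all
    have "(real (S m) + 1 - \<alpha> * real m) * s * real T \<le> (\<rho> + \<epsilon>) * s * real T"
      using m s T0 by (intro mult_right_mono) simp_all
    then have "(real (S m) + 1 - \<alpha> * real m) * s * real T \<le> (\<rho> * s + 1 / 4) * real T"
      using \<epsilon>(3) by (simp add: distrib_right)
    moreover have "\<rho> * s * real T \<le> (real g + 1) * real T" using g(2) T0 by (intro mult_right_mono) simp_all
    ultimately have "(real (S m) + 1) * real T * s + real m * s \<le> (real g + 2) * real T + real m * s * (\<alpha> * real T - 1)"
      using rT nm by (simp add: algebra_simps)
    then have hi: "(real (S m) + 1) * real T * s + real m * s \<le> (real g + 2) * real T + real m * s * real (S T)"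
      using STl by linarith
    have "P t (n, m, T, g)" unfolding Pr using T0 lo hi by (simp only: s_def of_nat_0_less_iff)
    then have "P t (dec (enc (n, m, T, g)))" by simp
    then show ?thesis by blast
  qed
  have dP: "decidable (\<lambda>p. P (fst p) (dec (snd p)))"
    unfolding P_def by (intro rec_intros recursive_dec recursive_comp[OF rS])
  show "computable_real \<rho>"
  proof (rule computable_realI)
    show "recursive (\<lambda>t. snd (snd (snd (dec (LEAST k. P t (dec k)) :: nat \<times> nat \<times> nat \<times> nat))))"
      by (intro recursive_snd recursive_dec recursive_Least dP ex)
    fix t
    have *: "P t (dec (LEAST k. P t (dec k)))" by (rule LeastI_ex[OF ex])
    obtain n m T g :: nat where k: "dec (LEAST k. P t (dec k)) = (n, m, T, g)"
      by (cases "dec (LEAST k. P t (dec k)) :: nat \<times> nat \<times> nat \<times> nat") auto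
    from sound[OF *[unfolded k]]
    show "\<bar>\<rho> * real (Suc t) - real (snd (snd (snd (dec (LEAST k. P t (dec k)) :: nat \<times> nat \<times> nat \<times> nat))))\<bar> < 2"
      unfolding k by simp
  qed
qed

theorem theorem23:
  fixes \<alpha> \<rho> :: real
  assumes "\<alpha> \<notin> \<rat>" and "0 < \<alpha>" and "\<alpha> < 1"
    and "0 \<le> \<rho>" and "\<rho> < 1"
  shows "decidable_MT {0, 1} (mechanical \<alpha> \<rho>) \<longleftrightarrow>
    computable_real \<alpha> \<and> computable_real \<rho>"
proof
  assume "decidable_MT {0, 1} (mechanical \<alpha> \<rho>)"
  then show "computable_real \<alpha> \<and> computable_real \<rho>"
    using computable_real_of_floor[OF assms(1,2,4,5)] recursive_floor_of_decidable[OF assms(2-5)] by blast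
next
  assume "computable_real \<alpha> \<and> computable_real \<rho>"
  then show "decidable_MT {0, 1} (mechanical \<alpha> \<rho>)"
    using decidable_mechanical[OF assms(1-4)] by blast
qed

end
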